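(* Let $(\mathcal{U},\mathcal{V})$ and $(\mathcal{X},\mathcal{Y})$ be two cotorsion pairs in $R\text{-Mod}$ with $\mathcal{U}\subseteq\mathcal{X}$. Then $(\widetilde{\mathcal{U}}_{\mathcal{X}},(\widetilde{\mathcal{U}}_{\mathcal{X}})^{\perp})$ is a cotorsion pair in $\mathrm{Ch}(R)$, and $(\widetilde{\mathcal{U}}_{\mathcal{X}})^{\perp}$ is the class of all chain complexes $V$ such that $V_n\in\mathcal{V}$ for every $n\in\mathbb{Z}$ and such that every chain map $U\to V$ with $U\in\widetilde{\mathcal{U}}_{\mathcal{X}}$ is null homotopic.
   Context: $R$ is an associative ring with $1$, $R\text{-Mod}$ is the category of left $R$-modules, and $\mathrm{Ch}(R)$ is the category of ($\mathbb{Z}$-indexed, unbounded) chain complexes $\cdots\to C_{n+1}\xrightarrow{\delta_{n+1}}C_n\xrightarrow{\delta_n}C_{n-1}\to\cdots$ of left $R$-modules. The $n$th cycle module of $C$ is $Z_nC=\mathrm{Ker}(\delta_n)$. A complex is exact if all its homology modules vanish. For a class $\mathcal{A}$ of objects in an abelian category $\mathcal{C}$, put $\mathcal{A}^{\perp}=\{X : \mathrm{Ext}^1_{\mathcal{C}}(A,X)=0 \text{ for all } A\in\mathcal{A}\}$ and ${}^{\perp}\mathcal{A}=\{X : \mathrm{Ext}^1_{\mathcal{C}}(X,A)=0\text{ for all }A\in\mathcal{A}\}$, where $\mathrm{Ext}^1_{\mathcal{C}}$ is the Yoneda group of (equivalence classes of) short exact sequences. A pair $(\mathcal{A},\mathcal{B})$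 of classes of objects of $\mathcal{C}$ is a cotorsion pair if $\mathcal{A}={}^{\perp}\mathcal{B}$ and $\mathcal{B}=\mathcal{A}^{\perp}$. For classes $\mathcal{U}\subseteq\mathcal{X}$ of $R$-modules, $\widetilde{\mathcal{U}}_{\mathcal{X}}$ denotes the class of all exact chain complexes $U$ in $\mathrm{Ch}(R)$ with $U_n\in\mathcal{U}$ and $Z_nU\in\mathcal{X}$ for every $n\in\mathbb{Z}$. *)

theory Defs
  imports "HOL-Algebra.Module" "HOL-Algebra.AbelCoset" "HOL-Algebra.Elementary_Groups" "HOL-Library.Equipollence"
begin

section \<open>Ext and cotorsion pairs\<close>

text \<open>
  A category together with its short exact sequences, given on explicit sets of objects and
  morphisms. Morphisms do not carry their domain, so composition and identities take it as an
  argument: \<open>Cmp C A g f\<close> is the composite of \<open>f\<close> (with domain \<open>A\<close>) followed by \<open>g\<close>.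
  \<open>Ses C B i E p A\<close> says that \<open>0 \<rightarrow> B \<rightarrow> E \<rightarrow> A \<rightarrow> 0\<close>, with maps \<open>i\<close> and \<open>p\<close>, is short exact.
\<close>

record ('o, 'f) ses_category =
  Obj :: "'o set"
  Mor :: "'o \<Rightarrow> 'o \<Rightarrow> 'f set"
  Cmp :: "'o \<Rightarrow> 'f \<Rightarrow> 'f \<Rightarrow> 'f"
  Idm :: "'o \<Rightarrow> 'f"
  Ses :: "'o \<Rightarrow> 'f \<Rightarrow> 'o \<Rightarrow> 'f \<Rightarrow> 'o \<Rightarrow> bool"

definition iso_mor :: "('o, 'f) ses_category \<Rightarrow> 'o \<Rightarrow> 'o \<Rightarrow> 'f \<Rightarrow> bool" where
  "iso_mor C E E' \<phi> \<longleftrightarrow> \<phi> \<in> Mor C E E' \<and>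
     (\<exists>\<psi> \<in> Mor C E' E. Cmp C E \<psi> \<phi> = Idm C E \<and> Cmp C E' \<phi> \<psi> = Idm C E')"

definition extensions :: "('o, 'f) ses_category \<Rightarrow> 'o \<Rightarrow> 'o \<Rightarrow> ('f \<times> 'o \<times> 'f) set" where
  "extensions C A B = {(i, E, p). E \<in> Obj C \<and> Ses C B i E p A}"

definition yoneda_equiv ::
    "('o, 'f) ses_category \<Rightarrow> 'o \<Rightarrow> 'o \<Rightarrow> (('f \<times> 'o \<times> 'f) \<times> ('f \<times> 'o \<times> 'f)) set" where
  "yoneda_equiv C A B =
     {((i, E, p), (i', E', p')).
        (i, E, p) \<in> extensions C A B \<and> (i', E', p') \<in> extensions C A B \<and>
        (\<exists>\<phi>. iso_mor C E E' \<phi> \<and> Cmp C B \<phi> i = i' \<and> Cmp C E p' \<phi> = p)}"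

text \<open>
  The underlying set of the Yoneda group of extensions of \<open>A\<close> by \<open>B\<close>, and its neutral element
  for the Baer sum, which is the class formed by the split extensions. The vanishing of the
  group involves nothing else of the group structure.
\<close>

definition Ext1 :: "('o, 'f) ses_category \<Rightarrow> 'o \<Rightarrow> 'o \<Rightarrow> ('f \<times> 'o \<times> 'f) set set" where
  "Ext1 C A B = extensions C A B // yoneda_equiv C A B"

definition Ext1_zero :: "('o, 'f) ses_category \<Rightarrow> 'o \<Rightarrow> 'o \<Rightarrow> ('f \<times> 'o \<times> 'f) set" where
  "Ext1_zero C A B =
     {(i, E, p) \<in> extensions C A B. \<exists>s \<in> Mor C A E. Cmp C A p s = Idm C A}"

definition Ext1_vanishes :: "('o, 'f) ses_category \<Rightarrow> 'o \<Rightarrow> 'o \<Rightarrow> bool" where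
  "Ext1_vanishes C A B \<longleftrightarrow> Ext1 C A B = {Ext1_zero C A B}"

definition right_perp :: "('o, 'f) ses_category \<Rightarrow> 'o set \<Rightarrow> 'o set" where
  "right_perp C \<A> = {B \<in> Obj C. \<forall>A \<in> \<A>. Ext1_vanishes C A B}"

definition left_perp :: "('o, 'f) ses_category \<Rightarrow> 'o set \<Rightarrow> 'o set" where
  "left_perp C \<B> = {A \<in> Obj C. \<forall>B \<in> \<B>. Ext1_vanishes C A B}"

definition cotorsion_pair :: "('o, 'f) ses_category \<Rightarrow> 'o set \<Rightarrow> 'o set \<Rightarrow> bool" where
  "cotorsion_pair C \<A> \<B> \<longleftrightarrow> \<A> = left_perp C \<B> \<and> \<B> = right_perp C \<A>"


section \<open>Left modules\<close>

text \<open>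
  The axioms of the library locale \<open>module\<close>, but over a ring that need not be commutative.
  The fields \<open>mult\<close> and \<open>one\<close> that the record type inherits from rings play no role.
\<close>

locale left_module = R?: ring R + M?: abelian_group M for R (structure) and M (structure) +
  assumes smult_closed:
      "\<lbrakk>a \<in> carrier R; x \<in> carrier M\<rbrakk> \<Longrightarrow> a \<odot>\<^bsub>M\<^esub> x \<in> carrier M"
    and smult_l_distr:
      "\<lbrakk>a \<in> carrier R; b \<in> carrier R; x \<in> carrier M\<rbrakk> \<Longrightarrow>
       (a \<oplus>\<^bsub>R\<^esub> b) \<odot>\<^bsub>M\<^esub> x = a \<odot>\<^bsub>M\<^esub> x \<oplus>\<^bsub>M\<^esub> b \<odot>\<^bsub>M\<^esub> x"
    and smult_r_distr:
      "\<lbrakk>a \<in> carrier R; x \<in> carrier M; y \<in> carrier M\<rbrakk> \<Longrightarrow>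
       a \<odot>\<^bsub>M\<^esub> (x \<oplus>\<^bsub>M\<^esub> y) = a \<odot>\<^bsub>M\<^esub> x \<oplus>\<^bsub>M\<^esub> a \<odot>\<^bsub>M\<^esub> y"
    and smult_assoc1:
      "\<lbrakk>a \<in> carrier R; b \<in> carrier R; x \<in> carrier M\<rbrakk> \<Longrightarrow>
       (a \<otimes>\<^bsub>R\<^esub> b) \<odot>\<^bsub>M\<^esub> x = a \<odot>\<^bsub>M\<^esub> (b \<odot>\<^bsub>M\<^esub> x)"
    and smult_one:
      "x \<in> carrier M \<Longrightarrow> \<one>\<^bsub>R\<^esub> \<odot>\<^bsub>M\<^esub> x = x"

text \<open>
  Homomorphisms are extensional functions on the carrier, so that equality of morphisms is
  equality in the logic.
\<close>

definition module_hom ::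
    "('r, 'e) ring_scheme \<Rightarrow> ('r, 'm) module \<Rightarrow> ('r, 'm) module \<Rightarrow> ('m \<Rightarrow> 'm) set" where
  "module_hom R M N =
     {f \<in> carrier M \<rightarrow>\<^sub>E carrier N.
        (\<forall>x \<in> carrier M. \<forall>y \<in> carrier M. f (x \<oplus>\<^bsub>M\<^esub> y) = f x \<oplus>\<^bsub>N\<^esub> f y) \<and>
        (\<forall>a \<in> carrier R. \<forall>x \<in> carrier M. f (a \<odot>\<^bsub>M\<^esub> x) = a \<odot>\<^bsub>N\<^esub> f x)}"

definition module_ses ::
    "('r, 'e) ring_scheme \<Rightarrow> ('r, 'm) module \<Rightarrow> ('m \<Rightarrow> 'm) \<Rightarrow> ('r, 'm) module \<Rightarrow>
     ('m \<Rightarrow> 'm) \<Rightarrow> ('r, 'm) module \<Rightarrow> bool" where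
  "module_ses R B i E p A \<longleftrightarrow>
     i \<in> module_hom R B E \<and> p \<in> module_hom R E A \<and>
     inj_on i (carrier B) \<and> i ` carrier B = a_kernel E A p \<and> p ` carrier E = carrier A"

definition LMod :: "('r, 'e) ring_scheme \<Rightarrow> (('r, 'm) module, 'm \<Rightarrow> 'm) ses_category" where
  "LMod R =
     \<lparr>Obj = {M. left_module R M},
      Mor = module_hom R,
      Cmp = (\<lambda>M g f. compose (carrier M) g f),
      Idm = (\<lambda>M. \<lambda>x \<in> carrier M. x),
      Ses = module_ses R\<rparr>"

text \<open>
  There is no type of all \<open>R\<close>-modules: the objects of \<open>LMod R\<close> are the modules carried by subsets
  of a type \<open>'m\<close>, which plays the role of the universe of sets. The following says that \<open>'m\<close> is
  not too small compared with \<open>R\<close>: its cardinality is at least \<open>\<aleph>\<^sub>0\<close> to the power \<open>|R|\<close>. In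
  particular \<open>'m\<close> is infinite, and it has room for quotients, finite direct sums and the
  injective cogenerator \<open>Hom\<^sub>\<int>(R, \<rat>/\<int>)\<close>.
\<close>

definition universe_for :: "('r, 'e) ring_scheme \<Rightarrow> 'm itself \<Rightarrow> bool" where
  "universe_for R (_ :: 'm itself) \<longleftrightarrow>
     (carrier R \<rightarrow>\<^sub>E (UNIV :: nat set)) \<lesssim> (UNIV :: 'm set)"


section \<open>Chain complexes\<close>

text \<open>\<open>diff C n\<close> is the differential from \<open>component C n\<close> to \<open>component C (n - 1)\<close>.\<close>

record ('r, 'm) complex_data =
  component :: "int \<Rightarrow> ('r, 'm) module"
  diff :: "int \<Rightarrow> 'm \<Rightarrow> 'm"

definition chain_complex :: "('r, 'e) ring_scheme \<Rightarrow> ('r, 'm) complex_data \<Rightarrow> bool" where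
  "chain_complex R C \<longleftrightarrow>
     (\<forall>n. left_module R (component C n)) \<and>
     (\<forall>n. diff C n \<in> module_hom R (component C n) (component C (n - 1))) \<and>
     (\<forall>n. \<forall>x \<in> carrier (component C n).
        diff C (n - 1) (diff C n x) = \<zero>\<^bsub>component C (n - 2)\<^esub>)"

definition chain_map ::
    "('r, 'e) ring_scheme \<Rightarrow> ('r, 'm) complex_data \<Rightarrow> ('r, 'm) complex_data \<Rightarrow>
     (int \<Rightarrow> 'm \<Rightarrow> 'm) set" where
  "chain_map R C D =
     {f. (\<forall>n. f n \<in> module_hom R (component C n) (component D n)) \<and>
         (\<forall>n. \<forall>x \<in> carrier (component C n). diff D n (f n x) = f (n - 1) (diff C n x))}"

text \<open>Kernels and cokernels of complexes are formed degreewise, hence so is exactness.\<close>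

definition Ch ::
    "('r, 'e) ring_scheme \<Rightarrow> (('r, 'm) complex_data, int \<Rightarrow> 'm \<Rightarrow> 'm) ses_category" where
  "Ch R =
     \<lparr>Obj = {C. chain_complex R C},
      Mor = chain_map R,
      Cmp = (\<lambda>C g f n. compose (carrier (component C n)) (g n) (f n)),
      Idm = (\<lambda>C n. \<lambda>x \<in> carrier (component C n). x),
      Ses = (\<lambda>B i E p A. i \<in> chain_map R B E \<and> p \<in> chain_map R E A \<and>
               (\<forall>n. module_ses R (component B n) (i n) (component E n) (p n) (component A n)))\<rparr>"

definition cycles :: "('r, 'm) complex_data \<Rightarrow> int \<Rightarrow> ('r, 'm) module" where
  "cycles C n =
     (component C n)\<lparr>carrier := a_kernel (component C n) (component C (n - 1)) (diff C n)\<rparr>"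

definition boundaries :: "('r, 'm) complex_data \<Rightarrow> int \<Rightarrow> 'm set" where
  "boundaries C n = diff C (n + 1) ` carrier (component C (n + 1))"

text \<open>The additive group of the homology module, which is all that its vanishing depends on.\<close>

definition homology :: "('r, 'm) complex_data \<Rightarrow> int \<Rightarrow> 'm set monoid" where
  "homology C n = cycles C n A_Mod boundaries C n"

definition exact_complex :: "('r, 'e) ring_scheme \<Rightarrow> ('r, 'm) complex_data \<Rightarrow> bool" where
  "exact_complex R C \<longleftrightarrow> chain_complex R C \<and> (\<forall>n. trivial_group (homology C n))"

definition tilde_class ::
    "('r, 'e) ring_scheme \<Rightarrow> ('r, 'm) module set \<Rightarrow> ('r, 'm) module set \<Rightarrow>
     ('r, 'm) complex_data set" where
  "tilde_class R \<U> \<X> =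
     {U. exact_complex R U \<and> (\<forall>n. component U n \<in> \<U> \<and> cycles U n \<in> \<X>)}"

definition null_homotopic ::
    "('r, 'e) ring_scheme \<Rightarrow> ('r, 'm) complex_data \<Rightarrow> ('r, 'm) complex_data \<Rightarrow>
     (int \<Rightarrow> 'm \<Rightarrow> 'm) \<Rightarrow> bool" where
  "null_homotopic R C D f \<longleftrightarrow>
     (\<exists>s. (\<forall>n. s n \<in> module_hom R (component C n) (component D (n + 1))) \<and>
          (\<forall>n. \<forall>x \<in> carrier (component C n).
             f n x = diff D (n + 1) (s n x) \<oplus>\<^bsub>component D n\<^esub> s (n - 1) (diff C n x)))"

end

theory Submission
  imports Defs HOL.Rat
begin

text \<open>
  A degreewise split extension of complexes \<open>0 \<rightarrow> V \<rightarrow> E \<rightarrow> X \<rightarrow> 0\<close> is \<open>V \<oplus> X\<close> with a differential twisted by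
  maps \<open>X\<^sub>n \<rightarrow> V\<^sub>n\<^sub>-\<^sub>1\<close> that anticommute with the differentials, and it splits iff these maps are null
  homotopic. Together with \<open>Ext\<^sup>1(D\<^sup>n(U), V) = Ext\<^sup>1(U, V\<^sub>n)\<close> for the disk complexes \<open>D\<^sup>n(U)\<close>, \<open>U \<in> \<U>\<close>, this
  describes the right orthogonal class. If \<open>X\<close> is left orthogonal to that class, then testing \<open>X\<close> against
  disks on modules in \<open>\<V>\<close> gives \<open>X\<^sub>n \<in> \<U>\<close>. Testing it against spheres on \<open>Y \<in> \<Y>\<close> shows that every map
  \<open>X\<^sub>n \<rightarrow> Y\<close> that kills the boundaries factors through the differential \<open>X\<^sub>n \<rightarrow> X\<^sub>n\<^sub>-\<^sub>1\<close>: an injective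
  cogenerator \<open>Y = Hom\<^sub>\<int>(R, \<rat>/\<int>)\<close> then forces exactness, and dimension shifting along
  \<open>0 \<rightarrow> Z\<^sub>n\<^sub>+\<^sub>1 \<rightarrow> X\<^sub>n\<^sub>+\<^sub>1 \<rightarrow> Z\<^sub>n \<rightarrow> 0\<close> gives \<open>Ext\<^sup>1(Z\<^sub>n, Y) = 0\<close>.
\<close>

section \<open>Linear maps and short exact sequences\<close>

text \<open>Two constraints shape the proof. All objects of \<open>LMod R\<close> are carried by
  subsets of one type \<open>'m\<close>, so every construction has to end in that type: quotients
  live on chosen representatives, direct sums on an injection of pairs into \<open>'m\<close>, and
  the characters of \<open>R\<close> are moved into \<open>'m\<close> by the injection that
  \<open>universe_for\<close> provides. Moreover, Ext is the bare set of Yoneda classes of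
  extensions, without a long exact sequence. Its vanishing is translated once into "every extension
  splits", for modules and for complexes, and the pieces of a long exact sequence that matter
  (extending a map from a submodule, lifting a map to an extension) are read off from pushouts and
  pullbacks. The cogenerator can be used as \<open>Y\<close> for any pair
  \<open>(\<X>, \<Y>)\<close>: it is injective, hence orthogonal to every module, hence in
  \<open>\<Y>\<close>. Spheres on modules of \<open>\<Y>\<close> may be used as test objects because
  the cycles of a complex in \<open>tilde_class R \<U> \<X>\<close> lie in \<open>\<X>\<close>,
  which makes the required extension of maps possible.\<close>

lemma (in left_module) right_minus_eq:
  assumes "x \<in> carrier M" "y \<in> carrier M" shows "x \<ominus>\<^bsub>M\<^esub> y = \<zero>\<^bsub>M\<^esub> \<longleftrightarrow> x = y"
  using assms M.minus_equality[of x "\<ominus>\<^bsub>M\<^esub> y"] by (auto simp: a_minus_def M.r_neg)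

lemma (in left_module) smult_zero:
  assumes "a \<in> carrier R" shows "a \<odot>\<^bsub>M\<^esub> \<zero>\<^bsub>M\<^esub> = \<zero>\<^bsub>M\<^esub>"
  using smult_r_distr[of a "\<zero>\<^bsub>M\<^esub>" "\<zero>\<^bsub>M\<^esub>"] smult_closed[of a "\<zero>\<^bsub>M\<^esub>"] assms
  by (simp del: M.add.r_cancel_one M.add.l_cancel_one add: M.add.l_cancel_one')

lemma (in left_module) smult_minus:
  assumes "a \<in> carrier R" "y \<in> carrier M" shows "a \<odot>\<^bsub>M\<^esub> (\<ominus>\<^bsub>M\<^esub> y) = \<ominus>\<^bsub>M\<^esub> (a \<odot>\<^bsub>M\<^esub> y)"
  using assms by (metis M.a_inv_closed M.l_neg M.minus_equality smult_closed smult_r_distr smult_zero)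

lemma (in left_module) uminus_zero: "\<ominus>\<^bsub>M\<^esub> \<zero>\<^bsub>M\<^esub> = \<zero>\<^bsub>M\<^esub>"
  by (rule M.minus_equality) simp_all

lemma (in left_module) add_eq_iff:
  assumes "x \<in> carrier M" "y \<in> carrier M" "z \<in> carrier M"
  shows "x \<oplus>\<^bsub>M\<^esub> y = z \<longleftrightarrow> y = \<ominus>\<^bsub>M\<^esub> x \<oplus>\<^bsub>M\<^esub> z"
  using assms by (metis M.add.inv_solve_left)

text \<open>Unlike \<open>module_hom\<close>, no extensionality is demanded and the element types
  may differ. Maps can thus be written as plain terms, and the characters of \<open>R\<close>, which
  live outside \<open>'m\<close>, can be sources and targets; \<open>restrict\<close> leads back to
  \<open>module_hom\<close>.\<close>

definition linear :: "('r, 'e) ring_scheme \<Rightarrow> ('r, 'a) module \<Rightarrow> ('r, 'b) module \<Rightarrow> ('a \<Rightarrow> 'b) \<Rightarrow> bool"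
  where "linear R M N f \<longleftrightarrow> f \<in> carrier M \<rightarrow> carrier N \<and>
    (\<forall>x \<in> carrier M. \<forall>y \<in> carrier M. f (x \<oplus>\<^bsub>M\<^esub> y) = f x \<oplus>\<^bsub>N\<^esub> f y) \<and>
    (\<forall>a \<in> carrier R. \<forall>x \<in> carrier M. f (a \<odot>\<^bsub>M\<^esub> x) = a \<odot>\<^bsub>N\<^esub> f x)"

lemma linearI:
  assumes "\<And>x. x \<in> carrier M \<Longrightarrow> f x \<in> carrier N"
    and "\<And>x y. x \<in> carrier M \<Longrightarrow> y \<in> carrier M \<Longrightarrow> f (x \<oplus>\<^bsub>M\<^esub> y) = f x \<oplus>\<^bsub>N\<^esub> f y"
    and "\<And>a x. a \<in> carrier R \<Longrightarrow> x \<in> carrier M \<Longrightarrow> f (a \<odot>\<^bsub>M\<^esub> x) = a \<odot>\<^bsub>N\<^esub> f x"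
  shows "linear R M N f"
  using assms by (auto simp: linear_def)

lemma linear_closed: "linear R M N f \<Longrightarrow> x \<in> carrier M \<Longrightarrow> f x \<in> carrier N"
  and linear_add: "linear R M N f \<Longrightarrow> x \<in> carrier M \<Longrightarrow> y \<in> carrier M \<Longrightarrow>
    f (x \<oplus>\<^bsub>M\<^esub> y) = f x \<oplus>\<^bsub>N\<^esub> f y"
  and linear_smult: "linear R M N f \<Longrightarrow> a \<in> carrier R \<Longrightarrow> x \<in> carrier M \<Longrightarrow>
    f (a \<odot>\<^bsub>M\<^esub> x) = a \<odot>\<^bsub>N\<^esub> f x"
  by (auto simp: linear_def)

lemma module_hom_iff: "f \<in> module_hom R M N \<longleftrightarrow> linear R M N f \<and> f \<in> extensional (carrier M)"
  by (auto simp: module_hom_def linear_def PiE_def)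

lemma left_module_zero: "left_module R M \<Longrightarrow> \<zero>\<^bsub>M\<^esub> \<in> carrier M"
  by (simp add: left_module_def abelian_group.axioms(1) abelian_monoid.zero_closed)

lemma linear_cong:
  assumes "left_module R M" "linear R M N f" "\<And>x. x \<in> carrier M \<Longrightarrow> g x = f x"
  shows "linear R M N g"
proof -
  interpret M: left_module R M by fact
  show ?thesis using assms(2,3)
    by (intro linearI) (auto simp: linear_def M.smult_closed)
qed

lemma module_hom_restrict:
  assumes "left_module R M" "linear R M N f"
  shows "restrict f (carrier M) \<in> module_hom R M N"
  using linear_cong[OF assms] by (simp add: module_hom_iff)

context
  fixes R :: "('r, 'e) ring_scheme" and M :: "('r, 'a) module" and N :: "('r, 'b) module"
  assumes M: "left_module R M" and N: "left_module R N"
begin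

interpretation M: left_module R M by (rule M)
interpretation N: left_module R N by (rule N)

lemma linear_zero:
  assumes "linear R M N f" shows "f \<zero>\<^bsub>M\<^esub> = \<zero>\<^bsub>N\<^esub>"
proof -
  have "f \<zero>\<^bsub>M\<^esub> \<oplus>\<^bsub>N\<^esub> f \<zero>\<^bsub>M\<^esub> = f \<zero>\<^bsub>M\<^esub>"
    using linear_add[OF assms, of "\<zero>\<^bsub>M\<^esub>" "\<zero>\<^bsub>M\<^esub>"] by simp
  with linear_closed[OF assms, of "\<zero>\<^bsub>M\<^esub>"] show ?thesis by (simp add: N.add.l_cancel_one')
qed

lemma linear_minus:
  assumes "linear R M N f" "x \<in> carrier M" shows "f (\<ominus>\<^bsub>M\<^esub> x) = \<ominus>\<^bsub>N\<^esub> f x"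
proof -
  have "f (\<ominus>\<^bsub>M\<^esub> x) \<oplus>\<^bsub>N\<^esub> f x = \<zero>\<^bsub>N\<^esub>"
    using linear_add[OF assms(1), of "\<ominus>\<^bsub>M\<^esub> x" x] assms
    by (simp add: M.l_neg linear_zero)
  with linear_closed[OF assms(1)] assms(2) show ?thesis
    by (metis M.a_inv_closed N.minus_equality)
qed

lemma linear_diff:
  assumes "linear R M N f" "x \<in> carrier M" "y \<in> carrier M"
  shows "f (x \<ominus>\<^bsub>M\<^esub> y) = f x \<ominus>\<^bsub>N\<^esub> f y"
  using assms by (simp add: a_minus_def linear_add linear_minus)

lemma linear_inj_on:
  assumes "linear R M N f" "\<And>x. x \<in> carrier M \<Longrightarrow> f x = \<zero>\<^bsub>N\<^esub> \<Longrightarrow> x = \<zero>\<^bsub>M\<^esub>"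
  shows "inj_on f (carrier M)"
proof (rule inj_onI)
  fix x y assume xy: "x \<in> carrier M" "y \<in> carrier M" "f x = f y"
  then have "f (x \<ominus>\<^bsub>M\<^esub> y) = \<zero>\<^bsub>N\<^esub>"
    using linear_closed[OF assms(1)] by (simp add: linear_diff[OF assms(1)] N.right_minus_eq)
  then show "x = y" using assms(2) xy by (metis M.minus_closed M.right_minus_eq)
qed

lemma linear_add_fun:
  assumes f: "linear R M N f" and g: "linear R M N g"
  shows "linear R M N (\<lambda>x. f x \<oplus>\<^bsub>N\<^esub> g x)"
proof (rule linearI)
  note [simp] = linear_closed[OF f] linear_closed[OF g]
  show "f x \<oplus>\<^bsub>N\<^esub> g x \<in> carrier N" if "x \<in> carrier M" for x using that by simp
  show "f (x \<oplus>\<^bsub>M\<^esub> y) \<oplus>\<^bsub>N\<^esub> g (x \<oplus>\<^bsub>M\<^esub> y) = f x \<oplus>\<^bsub>N\<^esub> g x \<oplus>\<^bsub>N\<^esub> (f y \<oplus>\<^bsub>N\<^esub> g y)"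
    if "x \<in> carrier M" "y \<in> carrier M" for x y
    using that by (simp add: linear_add[OF f] linear_add[OF g] N.a_ac)
  show "f (a \<odot>\<^bsub>M\<^esub> x) \<oplus>\<^bsub>N\<^esub> g (a \<odot>\<^bsub>M\<^esub> x) = a \<odot>\<^bsub>N\<^esub> (f x \<oplus>\<^bsub>N\<^esub> g x)"
    if "a \<in> carrier R" "x \<in> carrier M" for a x
    using that by (simp add: linear_smult[OF f] linear_smult[OF g] N.smult_r_distr)
qed

lemma linear_minus_fun:
  assumes f: "linear R M N f"
  shows "linear R M N (\<lambda>x. \<ominus>\<^bsub>N\<^esub> f x)"
  by (rule linearI)
    (simp_all add: linear_closed[OF f] linear_add[OF f] linear_smult[OF f]
      N.minus_add N.a_comm N.smult_minus)

lemma linear_diff_fun: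
  assumes "linear R M N f" "linear R M N g"
  shows "linear R M N (\<lambda>x. f x \<ominus>\<^bsub>N\<^esub> g x)"
  unfolding a_minus_def by (intro linear_add_fun linear_minus_fun assms)

lemma linear_zero_fun: "linear R M N (\<lambda>x. \<zero>\<^bsub>N\<^esub>)"
  by (rule linearI) (simp_all add: N.smult_zero)

end

lemma linear_id: "linear R M M (\<lambda>x. x)"
  by (simp add: linear_def)

lemma linear_comp:
  assumes "linear R M N f" "linear R N P g"
  shows "linear R M P (\<lambda>x. g (f x))"
  using assms by (auto simp: linear_def Pi_def)

lemma linear_inv_into:
  assumes M: "left_module R M" and f: "linear R M N f" and bij: "bij_betw f (carrier M) (carrier N)"
  shows "linear R N M (inv_into (carrier M) f)"
proof -
  interpret M: left_module R M by fact
  have inj: "inj_on f (carrier M)" using bij by (simp add: bij_betw_def)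
  have *: "\<exists>x \<in> carrier M. y = f x" if "y \<in> carrier N" for y
    using that bij by (auto simp: bij_betw_def)
  note [simp] = linear_add[OF f, symmetric] linear_smult[OF f, symmetric]
    inv_into_f_f[OF inj] M.smult_closed
  show ?thesis by (rule linearI) (auto dest!: *)
qed

text \<open>The homomorphism theorem without a quotient: \<open>h\<close> takes the value of
  \<open>f\<close> at any preimage under \<open>g\<close>, and two preimages differ by an element
  that \<open>g\<close>, hence \<open>f\<close>, kills.\<close>

lemma linear_factor:
  assumes M: "left_module R M" and N: "left_module R N" and Y: "left_module R Y"
    and g: "linear R M N g" "g ` carrier M = carrier N" and f: "linear R M Y f"
    and ker: "\<And>x. x \<in> carrier M \<Longrightarrow> g x = \<zero>\<^bsub>N\<^esub> \<Longrightarrow> f x = \<zero>\<^bsub>Y\<^esub>"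
  obtains h where "linear R N Y h" "\<And>x. x \<in> carrier M \<Longrightarrow> h (g x) = f x"
proof -
  interpret M: left_module R M by fact
  interpret N: left_module R N by fact
  interpret Y: left_module R Y by fact
  define h where "h = (\<lambda>z. f (inv_into (carrier M) g z))"
  have h: "h (g x) = f x" if x: "x \<in> carrier M" for x
  proof -
    define x' where "x' = inv_into (carrier M) g (g x)"
    have x': "x' \<in> carrier M" "g x' = g x"
      using x by (simp_all add: x'_def inv_into_into f_inv_into_f)
    then have "f (x' \<ominus>\<^bsub>M\<^esub> x) = \<zero>\<^bsub>Y\<^esub>"
      using x linear_closed[OF g(1)]
      by (intro ker) (simp_all add: linear_diff[OF M N g(1)] N.right_minus_eq)
    then show ?thesis using x x' linear_closed[OF f]
      by (simp add: linear_diff[OF M Y f] h_def x'_def[symmetric] Y.right_minus_eq)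
  qed
  have *: "\<exists>x \<in> carrier M. y = g x" if "y \<in> carrier N" for y
    using that g(2) by auto
  have "linear R N Y h"
    by (rule linearI)
      (auto dest!: * simp: h linear_closed[OF f] linear_add[OF f] linear_smult[OF f]
        linear_add[OF g(1), symmetric] linear_smult[OF g(1), symmetric] M.smult_closed)
  with h that show ?thesis by blast
qed

text \<open>\<open>module_ses\<close> freed from extensionality and from a common element type, in
  the same way as \<open>linear\<close> relaxes \<open>module_hom\<close>.\<close>

definition short_exact ::
    "('r, 'e) ring_scheme \<Rightarrow> ('r, 'a) module \<Rightarrow> ('a \<Rightarrow> 'b) \<Rightarrow> ('r, 'b) module \<Rightarrow>
     ('b \<Rightarrow> 'c) \<Rightarrow> ('r, 'c) module \<Rightarrow> bool" where
  "short_exact R B i E p A \<longleftrightarrow> linear R B E i \<and> linear R E A p \<and>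
     inj_on i (carrier B) \<and> i ` carrier B = {e \<in> carrier E. p e = \<zero>\<^bsub>A\<^esub>} \<and> p ` carrier E = carrier A"

lemma module_ses_iff: "module_ses R B i E p A \<longleftrightarrow> short_exact R B i E p A \<and>
    i \<in> extensional (carrier B) \<and> p \<in> extensional (carrier E)"
  by (auto simp: module_ses_def short_exact_def module_hom_iff a_kernel_def kernel_def)

lemma short_exact_cong:
  assumes "left_module R B" "left_module R E"
   "short_exact R B i E p A" "\<And>x. x \<in> carrier B \<Longrightarrow> i' x = i x" "\<And>x. x \<in> carrier E \<Longrightarrow> p' x = p x"
  shows "short_exact R B i' E p' A"
proof -
  have "i' ` carrier B = i ` carrier B" "p' ` carrier E = p ` carrier E" "inj_on i' (carrier B) = inj_on i (carrier B)"
    using assms(4,5) by (auto cong: inj_on_cong)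
  then show ?thesis
  using assms linear_cong[of R B E i i'] linear_cong[of R E A p p'] unfolding short_exact_def
  by auto
qed

text \<open>The values of \<open>k\<close> lie in the kernel of \<open>p\<close>, which is the image
  of \<open>i\<close>. The inverse of \<open>i\<close> there is linear because equations in
  \<open>B\<close> can be checked after the injective \<open>i\<close>.\<close>

lemma short_exact_kernel_lift:
  assumes B: "left_module R B" and E: "left_module R E" and M: "left_module R M"
    and ses: "short_exact R B i E p A" and k: "linear R M E k"
    and pk: "\<And>x. x \<in> carrier M \<Longrightarrow> p (k x) = \<zero>\<^bsub>A\<^esub>"
  obtains r where "linear R M B r" "\<And>x. x \<in> carrier M \<Longrightarrow> i (r x) = k x"
proof -
  interpret B: left_module R B by fact
  interpret M: left_module R M by fact
  define r where "r = (\<lambda>x. inv_into (carrier B) i (k x))"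
  have i: "linear R B E i" and inj: "inj_on i (carrier B)" using ses by (auto simp: short_exact_def)
  have im: "k x \<in> i ` carrier B" if "x \<in> carrier M" for x
    using that pk ses linear_closed[OF k] by (auto simp: short_exact_def)
  have r: "r x \<in> carrier B" "i (r x) = k x" if "x \<in> carrier M" for x
    using im[OF that] by (auto simp: r_def inv_into_into f_inv_into_f)
  have "linear R M B r"
  proof (rule linearI)
    fix x y assume xy: "x \<in> carrier M" "y \<in> carrier M"
    then have "i (r (x \<oplus>\<^bsub>M\<^esub> y)) = i (r x \<oplus>\<^bsub>B\<^esub> r y)"
      by (simp add: r linear_add[OF k] linear_add[OF i])
    then show "r (x \<oplus>\<^bsub>M\<^esub> y) = r x \<oplus>\<^bsub>B\<^esub> r y"
      using inj xy r by (meson B.add.m_closed M.add.m_closed inj_onD)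
  next
    fix a x assume ax: "a \<in> carrier R" "x \<in> carrier M"
    then have "i (r (a \<odot>\<^bsub>M\<^esub> x)) = i (a \<odot>\<^bsub>B\<^esub> r x)"
      by (simp add: r linear_smult[OF k] linear_smult[OF i] M.smult_closed)
    then show "r (a \<odot>\<^bsub>M\<^esub> x) = a \<odot>\<^bsub>B\<^esub> r x"
      using inj ax r by (meson B.smult_closed M.smult_closed inj_onD)
  qed (use r in auto)
  with r that show ?thesis by blast
qed

text \<open>The map \<open>e - s (p e)\<close> is killed by \<open>p\<close>, so it factors through
  \<open>i\<close>; the factor is \<open>r\<close>.\<close>

lemma short_exact_retraction:
  assumes B: "left_module R B" and E: "left_module R E" and A: "left_module R A"
    and ses: "short_exact R B i E p A" and s: "linear R A E s" "\<And>a. a \<in> carrier A \<Longrightarrow> p (s a) = a"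
  obtains r where "linear R E B r" "\<And>b. b \<in> carrier B \<Longrightarrow> r (i b) = b"
    "\<And>e. e \<in> carrier E \<Longrightarrow> e = i (r e) \<oplus>\<^bsub>E\<^esub> s (p e)"
proof -
  interpret B: left_module R B by fact
  interpret E: left_module R E by fact
  interpret A: left_module R A by fact
  have i: "linear R B E i" and p: "linear R E A p" and inj: "inj_on i (carrier B)"
    and pi: "\<And>b. b \<in> carrier B \<Longrightarrow> p (i b) = \<zero>\<^bsub>A\<^esub>"
    using ses by (auto simp: short_exact_def)
  note [simp] = linear_closed[OF i] linear_closed[OF p] linear_closed[OF s(1)]
  have k: "linear R E E (\<lambda>e. e \<ominus>\<^bsub>E\<^esub> s (p e))"
    by (intro linear_diff_fun[OF E E] linear_id linear_comp[OF p s(1)])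
  have pk: "p (e \<ominus>\<^bsub>E\<^esub> s (p e)) = \<zero>\<^bsub>A\<^esub>" if "e \<in> carrier E" for e
    using that by (simp add: linear_diff[OF E A p] s A.right_minus_eq)
  obtain r where r: "linear R E B r" "\<And>e. e \<in> carrier E \<Longrightarrow> i (r e) = e \<ominus>\<^bsub>E\<^esub> s (p e)"
    using short_exact_kernel_lift[OF B E E ses k] pk by blast
  show ?thesis
  proof
    show "r (i b) = b" if b: "b \<in> carrier B" for b
    proof -
      have "i (r (i b)) = i b" using b by (simp add: r pi linear_zero[OF A E s(1)] a_minus_def)
      then show ?thesis using inj b linear_closed[OF r(1)] by (simp add: inj_on_eq_iff)
    qed
    show "e = i (r e) \<oplus>\<^bsub>E\<^esub> s (p e)" if "e \<in> carrier E" for e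
      using that by (simp add: r a_minus_def E.a_assoc E.l_neg)
  qed (fact r)
qed

text \<open>The map \<open>e - i (r e)\<close> vanishes on the image of \<open>i\<close>, which is
  the kernel of \<open>p\<close>, so it descends along \<open>p\<close>; the descended map is
  \<open>s\<close>.\<close>

lemma short_exact_section:
  assumes B: "left_module R B" and E: "left_module R E" and A: "left_module R A"
    and ses: "short_exact R B i E p A" and r: "linear R E B r" "\<And>b. b \<in> carrier B \<Longrightarrow> r (i b) = b"
  obtains s where "linear R A E s" "\<And>a. a \<in> carrier A \<Longrightarrow> p (s a) = a"
proof -
  interpret B: left_module R B by fact
  interpret E: left_module R E by fact
  interpret A: left_module R A by fact
  have i: "linear R B E i" and p: "linear R E A p" "p ` carrier E = carrier A"
    and im: "i ` carrier B = {e \<in> carrier E. p e = \<zero>\<^bsub>A\<^esub>}"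
    using ses by (auto simp: short_exact_def)
  note [simp] = linear_closed[OF i] linear_closed[OF p(1)] linear_closed[OF r(1)]
  have k: "linear R E E (\<lambda>e. e \<ominus>\<^bsub>E\<^esub> i (r e))"
    by (intro linear_diff_fun[OF E E] linear_id linear_comp[OF r(1) i])
  have ker: "e \<ominus>\<^bsub>E\<^esub> i (r e) = \<zero>\<^bsub>E\<^esub>" if "e \<in> carrier E" "p e = \<zero>\<^bsub>A\<^esub>" for e
  proof -
    obtain b where "b \<in> carrier B" "e = i b" using im \<open>e \<in> carrier E\<close> \<open>p e = _\<close> by blast
    then show ?thesis by (simp add: r E.right_minus_eq)
  qed
  obtain s where s: "linear R A E s" "\<And>e. e \<in> carrier E \<Longrightarrow> s (p e) = e \<ominus>\<^bsub>E\<^esub> i (r e)"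
    using linear_factor[OF E A E p k] ker by blast
  have pi: "p (i b) = \<zero>\<^bsub>A\<^esub>" if "b \<in> carrier B" for b using im that by blast
  show ?thesis
  proof
    fix a assume "a \<in> carrier A"
    then obtain e where "e \<in> carrier E" "a = p e" using p(2) by blast
    then show "p (s a) = a" by (simp add: s linear_diff[OF E A p(1)] pi) (simp add: a_minus_def)
  qed (fact s)
qed

text \<open>A section gives coordinates \<open>r\<close> and \<open>p\<close> on \<open>E\<close>,
  and the map is \<open>i' r + s' p\<close>. The point to check is that \<open>r\<close> kills the
  image of \<open>s\<close>, so that the two coordinates are independent.\<close>

lemma split_extension_map:
  assumes B: "left_module R B" and E: "left_module R E" and A: "left_module R A" and E': "left_module R E'"
    and ses: "short_exact R B i E p A" and s: "linear R A E s" "\<And>a. a \<in> carrier A \<Longrightarrow> p (s a) = a"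
    and ses': "short_exact R B i' E' p' A" and s': "linear R A E' s'"
  obtains \<phi> where "linear R E E' \<phi>" "\<And>b a. b \<in> carrier B \<Longrightarrow> a \<in> carrier A \<Longrightarrow>
    \<phi> (i b \<oplus>\<^bsub>E\<^esub> s a) = i' b \<oplus>\<^bsub>E'\<^esub> s' a"
proof -
  interpret B: left_module R B by fact
  interpret E: left_module R E by fact
  interpret E': left_module R E' by fact
  interpret A: left_module R A by fact
  have i: "linear R B E i" and p: "linear R E A p" and inj: "inj_on i (carrier B)"
    and pi: "\<And>b. b \<in> carrier B \<Longrightarrow> p (i b) = \<zero>\<^bsub>A\<^esub>" and i': "linear R B E' i'"
    using ses ses' by (auto simp: short_exact_def)
  obtain r where r: "linear R E B r" "\<And>b. b \<in> carrier B \<Longrightarrow> r (i b) = b"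
    "\<And>e. e \<in> carrier E \<Longrightarrow> e = i (r e) \<oplus>\<^bsub>E\<^esub> s (p e)"
    using short_exact_retraction[OF B E A ses s] by blast
  note [simp] = linear_closed[OF i] linear_closed[OF p] linear_closed[OF r(1)]
    linear_closed[OF s(1)] linear_closed[OF s'] linear_closed[OF i']
  have rs: "r (s a) = \<zero>\<^bsub>B\<^esub>" if a: "a \<in> carrier A" for a
  proof -
    have "i (r (s a)) \<oplus>\<^bsub>E\<^esub> s a = s a" using r(3)[of "s a"] a s by simp
    then have "i (r (s a)) = i \<zero>\<^bsub>B\<^esub>" using a by (simp add: E.add.r_cancel_one' linear_zero[OF B E i])
    then show ?thesis using inj a by (simp add: inj_on_eq_iff)
  qed
  show ?thesis
  proof
    show "linear R E E' (\<lambda>e. i' (r e) \<oplus>\<^bsub>E'\<^esub> s' (p e))"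
      by (intro linear_add_fun[OF E E'] linear_comp[OF r(1) i'] linear_comp[OF p s'])
    show "i' (r (i b \<oplus>\<^bsub>E\<^esub> s a)) \<oplus>\<^bsub>E'\<^esub> s' (p (i b \<oplus>\<^bsub>E\<^esub> s a)) = i' b \<oplus>\<^bsub>E'\<^esub> s' a"
      if "b \<in> carrier B" "a \<in> carrier A" for b a
      using that by (simp add: linear_add[OF r(1)] linear_add[OF p] pi s r(2) rs)
  qed
qed

section \<open>Constructions of modules\<close>

lemma left_moduleI:
  assumes "ring R"
    and "\<zero>\<^bsub>M\<^esub> \<in> carrier M"
    and "\<And>x y. x \<in> carrier M \<Longrightarrow> y \<in> carrier M \<Longrightarrow> x \<oplus>\<^bsub>M\<^esub> y \<in> carrier M"
    and "\<And>x y z. x \<in> carrier M \<Longrightarrow> y \<in> carrier M \<Longrightarrow> z \<in> carrier M \<Longrightarrow>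
      x \<oplus>\<^bsub>M\<^esub> y \<oplus>\<^bsub>M\<^esub> z = x \<oplus>\<^bsub>M\<^esub> (y \<oplus>\<^bsub>M\<^esub> z)"
    and "\<And>x y. x \<in> carrier M \<Longrightarrow> y \<in> carrier M \<Longrightarrow> x \<oplus>\<^bsub>M\<^esub> y = y \<oplus>\<^bsub>M\<^esub> x"
    and "\<And>x. x \<in> carrier M \<Longrightarrow> \<zero>\<^bsub>M\<^esub> \<oplus>\<^bsub>M\<^esub> x = x"
    and "\<And>x. x \<in> carrier M \<Longrightarrow> \<exists>y \<in> carrier M. y \<oplus>\<^bsub>M\<^esub> x = \<zero>\<^bsub>M\<^esub>"
    and "\<And>a x. a \<in> carrier R \<Longrightarrow> x \<in> carrier M \<Longrightarrow> a \<odot>\<^bsub>M\<^esub> x \<in> carrier M"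
    and "\<And>a b x. a \<in> carrier R \<Longrightarrow> b \<in> carrier R \<Longrightarrow> x \<in> carrier M \<Longrightarrow>
      (a \<oplus>\<^bsub>R\<^esub> b) \<odot>\<^bsub>M\<^esub> x = a \<odot>\<^bsub>M\<^esub> x \<oplus>\<^bsub>M\<^esub> b \<odot>\<^bsub>M\<^esub> x"
    and "\<And>a x y. a \<in> carrier R \<Longrightarrow> x \<in> carrier M \<Longrightarrow> y \<in> carrier M \<Longrightarrow>
      a \<odot>\<^bsub>M\<^esub> (x \<oplus>\<^bsub>M\<^esub> y) = a \<odot>\<^bsub>M\<^esub> x \<oplus>\<^bsub>M\<^esub> a \<odot>\<^bsub>M\<^esub> y"
    and "\<And>a b x. a \<in> carrier R \<Longrightarrow> b \<in> carrier R \<Longrightarrow> x \<in> carrier M \<Longrightarrow>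
      (a \<otimes>\<^bsub>R\<^esub> b) \<odot>\<^bsub>M\<^esub> x = a \<odot>\<^bsub>M\<^esub> (b \<odot>\<^bsub>M\<^esub> x)"
    and "\<And>x. x \<in> carrier M \<Longrightarrow> \<one>\<^bsub>R\<^esub> \<odot>\<^bsub>M\<^esub> x = x"
  shows "left_module R M"
  by (intro left_module.intro left_module_axioms.intro abelian_groupI assms)

lemma left_module_submodule:
  assumes M: "left_module R M" and sub: "K \<subseteq> carrier M" and zero: "\<zero>\<^bsub>M\<^esub> \<in> K"
    and add: "\<And>x y. x \<in> K \<Longrightarrow> y \<in> K \<Longrightarrow> x \<oplus>\<^bsub>M\<^esub> y \<in> K"
    and neg: "\<And>x. x \<in> K \<Longrightarrow> \<ominus>\<^bsub>M\<^esub> x \<in> K"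
    and smult: "\<And>a x. a \<in> carrier R \<Longrightarrow> x \<in> K \<Longrightarrow> a \<odot>\<^bsub>M\<^esub> x \<in> K"
  shows "left_module R (M\<lparr>carrier := K\<rparr>)"
proof -
  interpret M: left_module R M by fact
  note [simp] = subsetD[OF sub]
  have "\<exists>y \<in> K. y \<oplus>\<^bsub>M\<^esub> x = \<zero>\<^bsub>M\<^esub>" if "x \<in> K" for x
    using that by (intro bexI[of _ "\<ominus>\<^bsub>M\<^esub> x"]) (simp_all add: neg M.l_neg)
  then show ?thesis
    by (intro left_moduleI[OF M.R.ring_axioms])
      (auto simp: zero add smult M.a_assoc M.smult_l_distr M.smult_r_distr M.smult_assoc1 M.smult_one
        intro: M.a_comm)
qed

lemma left_module_kernel:
  assumes M: "left_module R M" and N: "left_module R N" and f: "linear R M N f"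
  shows "left_module R (M\<lparr>carrier := {x \<in> carrier M. f x = \<zero>\<^bsub>N\<^esub>}\<rparr>)"
proof -
  interpret M: left_module R M by fact
  interpret N: left_module R N by fact
  show ?thesis
    by (rule left_module_submodule[OF M])
      (auto simp: linear_zero[OF M N f] linear_add[OF f] linear_smult[OF f]
        linear_minus[OF M N f] N.smult_zero M.smult_closed)
qed

lemma linear_restrict_carrier:
  assumes "linear R M N f" "K \<subseteq> carrier M"
  shows "linear R (M\<lparr>carrier := K\<rparr>) N f"
  using assms by (auto simp: linear_def subset_iff)

lemma short_exact_kernel:
  assumes f: "linear R M N f" and L: "L = f ` carrier M"
  shows "short_exact R (M\<lparr>carrier := {x \<in> carrier M. f x = \<zero>\<^bsub>N\<^esub>}\<rparr>) (\<lambda>x. x) M f (N\<lparr>carrier := L\<rparr>)"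
  using f by (auto simp: short_exact_def linear_def L)

text \<open>Covers both the transport of a module along an injection and, for a \<open>\<rho>\<close> that picks
  representatives of the classes modulo a submodule, the quotient without leaving the element type.\<close>

definition image_module :: "('a \<Rightarrow> 'b) \<Rightarrow> ('r, 'a) module \<Rightarrow> ('r, 'b) module" where
  "image_module \<rho> W = \<lparr>carrier = \<rho> ` carrier W, mult = undefined, one = undefined, zero = \<rho> \<zero>\<^bsub>W\<^esub>,
     add = (\<lambda>x y. \<rho> (inv_into (carrier W) \<rho> x \<oplus>\<^bsub>W\<^esub> inv_into (carrier W) \<rho> y)),
     smult = (\<lambda>a x. \<rho> (a \<odot>\<^bsub>W\<^esub> inv_into (carrier W) \<rho> x))\<rparr>"

text \<open>The hypotheses say that the fibres of \<open>\<rho>\<close> form a congruence. Hence the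
  arbitrary preimages chosen in the operations do not matter, and the module axioms pass along the
  surjection \<open>\<rho>\<close>.\<close>

lemma image_module:
  assumes W: "left_module R W"
    and add: "\<And>x x' y y'. x \<in> carrier W \<Longrightarrow> x' \<in> carrier W \<Longrightarrow> y \<in> carrier W \<Longrightarrow> y' \<in> carrier W \<Longrightarrow>
      \<rho> x = \<rho> x' \<Longrightarrow> \<rho> y = \<rho> y' \<Longrightarrow> \<rho> (x \<oplus>\<^bsub>W\<^esub> y) = \<rho> (x' \<oplus>\<^bsub>W\<^esub> y')"
    and smult: "\<And>a x x'. a \<in> carrier R \<Longrightarrow> x \<in> carrier W \<Longrightarrow> x' \<in> carrier W \<Longrightarrow>
      \<rho> x = \<rho> x' \<Longrightarrow> \<rho> (a \<odot>\<^bsub>W\<^esub> x) = \<rho> (a \<odot>\<^bsub>W\<^esub> x')"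
  shows "left_module R (image_module \<rho> W)" "linear R W (image_module \<rho> W) \<rho>"
proof -
  interpret W: left_module R W by fact
  let ?Q = "image_module \<rho> W"
  have inv: "inv_into (carrier W) \<rho> (\<rho> x) \<in> carrier W" "\<rho> (inv_into (carrier W) \<rho> (\<rho> x)) = \<rho> x"
    if "x \<in> carrier W" for x
    using that by (simp_all add: inv_into_into f_inv_into_f)
  have 1: "\<rho> x \<oplus>\<^bsub>?Q\<^esub> \<rho> y = \<rho> (x \<oplus>\<^bsub>W\<^esub> y)" if "x \<in> carrier W" "y \<in> carrier W" for x y
    using that by (simp add: image_module_def) (intro add inv that)
  have 2: "a \<odot>\<^bsub>?Q\<^esub> \<rho> x = \<rho> (a \<odot>\<^bsub>W\<^esub> x)" if "a \<in> carrier R" "x \<in> carrier W" for a x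
    using that by (simp add: image_module_def) (intro smult inv that)
  have 3: "\<zero>\<^bsub>?Q\<^esub> = \<rho> \<zero>\<^bsub>W\<^esub>" "carrier ?Q = \<rho> ` carrier W" by (simp_all add: image_module_def)
  show "left_module R ?Q"
  proof (rule left_moduleI[OF W.R.ring_axioms])
    fix x assume "x \<in> carrier ?Q"
    then obtain w where "w \<in> carrier W" "x = \<rho> w" by (auto simp: 3)
    then show "\<exists>y \<in> carrier ?Q. y \<oplus>\<^bsub>?Q\<^esub> x = \<zero>\<^bsub>?Q\<^esub>"
      by (intro bexI[of _ "\<rho> (\<ominus>\<^bsub>W\<^esub> w)"]) (simp_all add: 1 3 W.l_neg)
  qed (auto simp: 1 2 3 W.a_assoc W.smult_closed W.smult_l_distr W.smult_r_distr W.smult_assoc1 W.smult_one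
      intro: arg_cong[OF W.a_comm, of _ _ \<rho>])
  show "linear R W ?Q \<rho>"
    by (rule linearI) (simp_all add: 1 2 3)
qed

lemma inj_image_module:
  assumes W: "left_module R W" and inj: "inj_on \<rho> (carrier W)"
  shows "left_module R (image_module \<rho> W)" "linear R W (image_module \<rho> W) \<rho>"
    "bij_betw \<rho> (carrier W) (carrier (image_module \<rho> W))"
proof -
  show "left_module R (image_module \<rho> W)" "linear R W (image_module \<rho> W) \<rho>"
    using inj by (intro image_module[OF W]; simp add: inj_on_eq_iff)+
  show "bij_betw \<rho> (carrier W) (carrier (image_module \<rho> W))"
    using inj by (simp add: bij_betw_def image_module_def)
qed

lemma quotient_module:
  fixes W :: "('r, 'a) module"
  assumes W: "left_module R W" and K: "left_module R (W\<lparr>carrier := K\<rparr>)" and sub: "K \<subseteq> carrier W"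
  obtains Q :: "('r, 'a) module" and \<rho> where "left_module R Q" "linear R W Q \<rho>"
    "\<rho> ` carrier W = carrier Q" "\<And>x. x \<in> carrier W \<Longrightarrow> \<rho> x = \<zero>\<^bsub>Q\<^esub> \<longleftrightarrow> x \<in> K"
proof -
  interpret W: left_module R W by fact
  interpret K: left_module R "W\<lparr>carrier := K\<rparr>" by fact
  have zero: "\<zero>\<^bsub>W\<^esub> \<in> K" using K.zero_closed by simp
  have add: "x \<oplus>\<^bsub>W\<^esub> y \<in> K" if "x \<in> K" "y \<in> K" for x y using K.a_closed that by simp
  have smult: "a \<odot>\<^bsub>W\<^esub> x \<in> K" if "a \<in> carrier R" "x \<in> K" for a x using K.smult_closed that by simp
  \<comment> \<open>The negative in the module on \<open>K\<close> is taken with respect to the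
    smaller carrier; uniqueness of negatives identifies it with the one in \<open>W\<close>.\<close>
  have neg: "\<ominus>\<^bsub>W\<^esub> x \<in> K" if x: "x \<in> K" for x
  proof -
    obtain y where "y \<in> K" "y \<oplus>\<^bsub>W\<^esub> x = \<zero>\<^bsub>W\<^esub>" using K.add.l_inv_ex[of x] x by auto
    then show ?thesis using W.minus_equality[of y x] x sub by auto
  qed
  \<comment> \<open>The predicate under the choice operator depends only on the coset of
    \<open>x\<close>, so equal cosets get the same representative. Equality of values of
    \<open>\<rho>\<close> is thus congruence modulo \<open>K\<close>, which is shown next.\<close>
  define \<rho> where "\<rho> x = (SOME y. y \<in> carrier W \<and> y \<ominus>\<^bsub>W\<^esub> x \<in> K)" for x
  have \<rho>: "\<rho> x \<in> carrier W" "\<rho> x \<ominus>\<^bsub>W\<^esub> x \<in> K" if "x \<in> carrier W" for x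
    using someI[of "\<lambda>y. y \<in> carrier W \<and> y \<ominus>\<^bsub>W\<^esub> x \<in> K" x] that zero W.right_minus_eq[of x x]
    by (auto simp: \<rho>_def)
  have eq: "\<rho> x = \<rho> y \<longleftrightarrow> x \<ominus>\<^bsub>W\<^esub> y \<in> K" if xy: "x \<in> carrier W" "y \<in> carrier W" for x y
  proof
    assume "\<rho> x = \<rho> y"
    then have "\<rho> x \<ominus>\<^bsub>W\<^esub> y \<oplus>\<^bsub>W\<^esub> \<ominus>\<^bsub>W\<^esub> (\<rho> x \<ominus>\<^bsub>W\<^esub> x) \<in> K"
      using \<rho>(2)[OF xy(1)] \<rho>(2)[OF xy(2)] by (metis add neg)
    moreover have "\<rho> x \<ominus>\<^bsub>W\<^esub> y \<oplus>\<^bsub>W\<^esub> \<ominus>\<^bsub>W\<^esub> (\<rho> x \<ominus>\<^bsub>W\<^esub> x) = x \<ominus>\<^bsub>W\<^esub> y"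
      using xy \<rho>(1)[OF xy(1)] W.r_neg2[of "\<rho> x" "\<ominus>\<^bsub>W\<^esub> y"]
      by (simp add: a_minus_def W.minus_add W.a_ac)
    ultimately show "x \<ominus>\<^bsub>W\<^esub> y \<in> K" by simp
  next
    assume d: "x \<ominus>\<^bsub>W\<^esub> y \<in> K"
    have "z \<ominus>\<^bsub>W\<^esub> x \<in> K \<longleftrightarrow> z \<ominus>\<^bsub>W\<^esub> y \<in> K" if z: "z \<in> carrier W" for z
    proof -
      have 1: "z \<ominus>\<^bsub>W\<^esub> y = (z \<ominus>\<^bsub>W\<^esub> x) \<oplus>\<^bsub>W\<^esub> (x \<ominus>\<^bsub>W\<^esub> y)"
        using xy z by (simp add: a_minus_def W.a_assoc W.r_neg1)
      have 2: "z \<ominus>\<^bsub>W\<^esub> x = (z \<ominus>\<^bsub>W\<^esub> y) \<oplus>\<^bsub>W\<^esub> \<ominus>\<^bsub>W\<^esub> (x \<ominus>\<^bsub>W\<^esub> y)"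
        using xy z W.r_neg2[of y "z \<oplus>\<^bsub>W\<^esub> \<ominus>\<^bsub>W\<^esub> x"] by (simp add: a_minus_def W.minus_add W.a_ac)
      show ?thesis using add d neg 1 2 by metis
    qed
    then have "(\<lambda>z. z \<in> carrier W \<and> z \<ominus>\<^bsub>W\<^esub> x \<in> K) = (\<lambda>z. z \<in> carrier W \<and> z \<ominus>\<^bsub>W\<^esub> y \<in> K)" by blast
    then show "\<rho> x = \<rho> y" unfolding \<rho>_def by metis
  qed
  have add_cong: "\<rho> (x \<oplus>\<^bsub>W\<^esub> y) = \<rho> (x' \<oplus>\<^bsub>W\<^esub> y')"
    if "x \<in> carrier W" "x' \<in> carrier W" "y \<in> carrier W" "y' \<in> carrier W" "\<rho> x = \<rho> x'" "\<rho> y = \<rho> y'"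
    for x x' y y'
    using that add[of "x \<ominus>\<^bsub>W\<^esub> x'" "y \<ominus>\<^bsub>W\<^esub> y'"] by (simp add: eq a_minus_def W.minus_add W.a_ac)
  have smult_cong: "\<rho> (a \<odot>\<^bsub>W\<^esub> x) = \<rho> (a \<odot>\<^bsub>W\<^esub> x')"
    if "a \<in> carrier R" "x \<in> carrier W" "x' \<in> carrier W" "\<rho> x = \<rho> x'" for a x x'
    using that smult[of a "x \<ominus>\<^bsub>W\<^esub> x'"]
    by (simp add: eq a_minus_def W.smult_closed W.smult_r_distr W.smult_minus)
  show ?thesis
  proof
    show "left_module R (image_module \<rho> W)" by (rule image_module(1)[OF W add_cong smult_cong])
    show "linear R W (image_module \<rho> W) \<rho>" by (rule image_module(2)[OF W add_cong smult_cong])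
    show "\<rho> ` carrier W = carrier (image_module \<rho> W)" by (simp add: image_module_def)
    show "\<rho> x = \<zero>\<^bsub>image_module \<rho> W\<^esub> \<longleftrightarrow> x \<in> K" if "x \<in> carrier W" for x
      using that eq[of x "\<zero>\<^bsub>W\<^esub>"] W.minus_equality[of "\<zero>\<^bsub>W\<^esub>" "\<zero>\<^bsub>W\<^esub>"]
      by (simp add: image_module_def a_minus_def)
  qed
qed

text \<open>These are meaningful only for infinite types: a finite \<open>'m\<close> with more than one element has no
  injection \<open>'m \<times> 'm \<Rightarrow> 'm\<close>.\<close>

definition pairing :: "'m \<Rightarrow> 'm \<Rightarrow> 'm" where
  "pairing a b = (SOME h. inj h) (a, b)"

definition pair_fst :: "'m \<Rightarrow> 'm" where
  "pair_fst x = fst (inv_into UNIV (\<lambda>(a, b). pairing a b) x)"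

definition pair_snd :: "'m \<Rightarrow> 'm" where
  "pair_snd x = snd (inv_into UNIV (\<lambda>(a, b). pairing a b) x)"

text \<open>For an infinite type, cardinal arithmetic gives a bijection between the type and its
  square, so the choice in \<open>pairing\<close> does pick an injection.\<close>

lemma pair_simps:
  assumes "infinite (UNIV :: 'm set)"
  shows "pair_fst (pairing a b :: 'm) = a" "pair_snd (pairing a b :: 'm) = b"
proof -
  have "\<exists>h :: 'm \<times> 'm \<Rightarrow> 'm. inj h"
    using card_of_ordLeq[THEN iffD2, OF ordIso_imp_ordLeq[OF card_of_Times_same_infinite[OF assms]]]
    by auto
  then have "inj (SOME h :: 'm \<times> 'm \<Rightarrow> 'm. inj h)" by (rule someI_ex)
  moreover have "(\<lambda>(a, b). pairing a b :: 'm) = (SOME h. inj h)"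
    by (rule ext) (simp add: pairing_def split_beta)
  ultimately have "inj (\<lambda>(a, b). pairing a b :: 'm)" by (simp only:)
  from inv_f_f[OF this, of "(a, b)"]
  show "pair_fst (pairing a b :: 'm) = a" "pair_snd (pairing a b :: 'm) = b"
    by (simp_all add: pair_fst_def pair_snd_def)
qed

definition direct_sum :: "('r, 'm) module \<Rightarrow> ('r, 'm) module \<Rightarrow> ('r, 'm) module" where
  "direct_sum M N = \<lparr>carrier = {pairing a b |a b. a \<in> carrier M \<and> b \<in> carrier N},
     mult = undefined, one = undefined, zero = pairing \<zero>\<^bsub>M\<^esub> \<zero>\<^bsub>N\<^esub>,
     add = (\<lambda>x y. pairing (pair_fst x \<oplus>\<^bsub>M\<^esub> pair_fst y) (pair_snd x \<oplus>\<^bsub>N\<^esub> pair_snd y)),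
     smult = (\<lambda>a x. pairing (a \<odot>\<^bsub>M\<^esub> pair_fst x) (a \<odot>\<^bsub>N\<^esub> pair_snd x))\<rparr>"

text \<open>The argument \<open>ty\<close> pins down the type \<open>'m\<close>. Infinity is what
  makes \<open>pairing\<close> injective, and with it direct sums, pushouts and pullbacks stay
  inside \<open>'m\<close>.\<close>

locale module_universe = ring R for R :: "('r, 'e) ring_scheme" (structure) +
  fixes ty :: "'m itself"
  assumes infinite_universe: "infinite (UNIV :: 'm set)"
begin

lemma pair_fst [simp]: "pair_fst (pairing a b :: 'm) = a"
  and pair_snd [simp]: "pair_snd (pairing a b :: 'm) = b"
  using pair_simps[OF infinite_universe] by auto

lemma pairing_eq_iff [simp]: "pairing (a :: 'm) b = pairing c d \<longleftrightarrow> a = c \<and> b = d"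
  by (metis pair_fst pair_snd)

lemma direct_sum_simps [simp]:
  fixes a b c d :: 'm
  shows "\<zero>\<^bsub>direct_sum M N\<^esub> = pairing \<zero>\<^bsub>M\<^esub> \<zero>\<^bsub>N\<^esub>"
    and "pairing a b \<oplus>\<^bsub>direct_sum M N\<^esub> pairing c d = pairing (a \<oplus>\<^bsub>M\<^esub> c) (b \<oplus>\<^bsub>N\<^esub> d)"
    and "r \<odot>\<^bsub>direct_sum M N\<^esub> pairing a b = pairing (r \<odot>\<^bsub>M\<^esub> a) (r \<odot>\<^bsub>N\<^esub> b)"
    and "pairing a b \<in> carrier (direct_sum M N) \<longleftrightarrow> a \<in> carrier M \<and> b \<in> carrier N"
  by (auto simp: direct_sum_def)

lemma direct_sumE:
  fixes x :: 'm
  assumes "x \<in> carrier (direct_sum M N)"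
  obtains a b where "a \<in> carrier M" "b \<in> carrier N" "x = pairing a b"
  using assms by (auto simp: direct_sum_def)

lemma left_module_direct_sum:
  fixes M N :: "('r, 'm) module"
  assumes M: "left_module R M" and N: "left_module R N"
  shows "left_module R (direct_sum M N)"
proof -
  interpret M: left_module R M by fact
  interpret N: left_module R N by fact
  show ?thesis
  proof (rule left_moduleI[OF ring_axioms])
    fix x assume "x \<in> carrier (direct_sum M N)"
    then obtain a b where x: "a \<in> carrier M" "b \<in> carrier N" "x = pairing a b" by (rule direct_sumE)
    show "\<exists>y \<in> carrier (direct_sum M N). y \<oplus>\<^bsub>direct_sum M N\<^esub> x = \<zero>\<^bsub>direct_sum M N\<^esub>"
      by (rule bexI[of _ "pairing (\<ominus>\<^bsub>M\<^esub> a) (\<ominus>\<^bsub>N\<^esub> b)"]) (simp_all add: x M.l_neg N.l_neg)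
  qed (auto elim!: direct_sumE simp: M.a_assoc N.a_assoc M.smult_closed N.smult_closed
      M.smult_l_distr N.smult_l_distr M.smult_r_distr N.smult_r_distr M.smult_assoc1 N.smult_assoc1
      M.smult_one N.smult_one intro: M.a_comm N.a_comm)
qed

lemma direct_sum_linear:
  fixes M N :: "('r, 'm) module"
  assumes M: "left_module R M" and N: "left_module R N"
  shows "linear R M (direct_sum M N) (\<lambda>a. pairing a \<zero>\<^bsub>N\<^esub>)"
    "linear R N (direct_sum M N) (\<lambda>b. pairing \<zero>\<^bsub>M\<^esub> b)"
    "linear R (direct_sum M N) M pair_fst" "linear R (direct_sum M N) N pair_snd"
proof -
  interpret M: left_module R M by fact
  interpret N: left_module R N by fact
  show "linear R M (direct_sum M N) (\<lambda>a. pairing a \<zero>\<^bsub>N\<^esub>)"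
    "linear R N (direct_sum M N) (\<lambda>b. pairing \<zero>\<^bsub>M\<^esub> b)"
    "linear R (direct_sum M N) M pair_fst" "linear R (direct_sum M N) N pair_snd"
    by (rule linearI; auto elim!: direct_sumE simp: M.smult_zero N.smult_zero)+
qed

lemma linear_pairing:
  fixes P :: "('r, 'a) module" and M N :: "('r, 'm) module"
  assumes "linear R P M f" "linear R P N g"
  shows "linear R P (direct_sum M N) (\<lambda>x. pairing (f x) (g x))"
  using assms by (auto intro!: linearI simp: linear_closed linear_add linear_smult)

lemma short_exact_direct_sum:
  fixes M N :: "('r, 'm) module"
  assumes M: "left_module R M" and N: "left_module R N"
  shows "short_exact R M (\<lambda>a. pairing a \<zero>\<^bsub>N\<^esub>) (direct_sum M N) pair_snd N"
proof -
  have "b \<in> pair_snd ` carrier (direct_sum M N)" if "b \<in> carrier N" for b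
    using that left_module_zero[OF M] by (intro image_eqI[of _ _ "pairing \<zero>\<^bsub>M\<^esub> b"]) simp_all
  then have "pair_snd ` carrier (direct_sum M N) = carrier N"
    by (auto elim!: direct_sumE)
  moreover have "(\<lambda>a. pairing a \<zero>\<^bsub>N\<^esub>) ` carrier M = {e \<in> carrier (direct_sum M N). pair_snd e = \<zero>\<^bsub>N\<^esub>}"
    using left_module_zero[OF N] by (auto elim!: direct_sumE)
  ultimately show ?thesis
    using direct_sum_linear[OF M N] unfolding short_exact_def by (simp add: inj_on_def)
qed

end

section \<open>Vanishing of Ext and splitting\<close>

text \<open>Both maps come from \<open>split_extension_map\<close> and are inverse to each other on
  sums \<open>i b + s a\<close>. The clause that \<open>\<phi>\<close> carries \<open>s\<close> to
  \<open>s'\<close> serves complexes: it forces the isomorphisms chosen in each degree to commute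
  with the differentials.\<close>

lemma split_extension_iso:
  assumes B: "left_module R B" and E: "left_module R E" and A: "left_module R A" and E': "left_module R E'"
    and ses: "short_exact R B i E p A" and s: "linear R A E s" "\<And>a. a \<in> carrier A \<Longrightarrow> p (s a) = a"
    and ses': "short_exact R B i' E' p' A" and s': "linear R A E' s'" "\<And>a. a \<in> carrier A \<Longrightarrow> p' (s' a) = a"
  obtains \<phi> \<psi> where "linear R E E' \<phi>" "linear R E' E \<psi>"
    "\<And>e. e \<in> carrier E \<Longrightarrow> \<psi> (\<phi> e) = e" "\<And>e. e \<in> carrier E' \<Longrightarrow> \<phi> (\<psi> e) = e"
    "\<And>b. b \<in> carrier B \<Longrightarrow> \<phi> (i b) = i' b" "\<And>a. a \<in> carrier A \<Longrightarrow> \<phi> (s a) = s' a"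
    "\<And>e. e \<in> carrier E \<Longrightarrow> p' (\<phi> e) = p e"
proof -
  interpret B: left_module R B by fact
  interpret E: left_module R E by fact
  interpret E': left_module R E' by fact
  interpret A: left_module R A by fact
  have i: "linear R B E i" "linear R B E' i'" and p: "linear R E A p" "linear R E' A p'"
    and pi: "\<And>b. b \<in> carrier B \<Longrightarrow> p (i b) = \<zero>\<^bsub>A\<^esub>" "\<And>b. b \<in> carrier B \<Longrightarrow> p' (i' b) = \<zero>\<^bsub>A\<^esub>"
    using ses ses' by (auto simp: short_exact_def)
  note [simp] = linear_closed[OF i(1)] linear_closed[OF i(2)] linear_closed[OF s(1)]
    linear_closed[OF s'(1)]
  obtain r where r: "linear R E B r" "\<And>b. b \<in> carrier B \<Longrightarrow> r (i b) = b"
    "\<And>e. e \<in> carrier E \<Longrightarrow> e = i (r e) \<oplus>\<^bsub>E\<^esub> s (p e)"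
    by (rule short_exact_retraction[OF B E A ses s], assumption, rule that)
  obtain r' where r': "linear R E' B r'" "\<And>b. b \<in> carrier B \<Longrightarrow> r' (i' b) = b"
    "\<And>e. e \<in> carrier E' \<Longrightarrow> e = i' (r' e) \<oplus>\<^bsub>E'\<^esub> s' (p' e)"
    by (rule short_exact_retraction[OF B E' A ses' s'], assumption, rule that)
  obtain \<phi> where \<phi>: "linear R E E' \<phi>" "\<And>b a. b \<in> carrier B \<Longrightarrow> a \<in> carrier A \<Longrightarrow>
      \<phi> (i b \<oplus>\<^bsub>E\<^esub> s a) = i' b \<oplus>\<^bsub>E'\<^esub> s' a"
    using split_extension_map[OF B E A E' ses s ses' s'(1)] by blast
  obtain \<psi> where \<psi>: "linear R E' E \<psi>" "\<And>b a. b \<in> carrier B \<Longrightarrow> a \<in> carrier A \<Longrightarrow>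
      \<psi> (i' b \<oplus>\<^bsub>E'\<^esub> s' a) = i b \<oplus>\<^bsub>E\<^esub> s a"
    using split_extension_map[OF B E' A E ses' s' ses s(1)] by blast
  have dec: "\<exists>b \<in> carrier B. \<exists>a \<in> carrier A. e = i b \<oplus>\<^bsub>E\<^esub> s a" if "e \<in> carrier E" for e
    using r(3)[OF that] linear_closed[OF r(1) that] linear_closed[OF p(1) that] by blast
  have dec': "\<exists>b \<in> carrier B. \<exists>a \<in> carrier A. e = i' b \<oplus>\<^bsub>E'\<^esub> s' a" if "e \<in> carrier E'" for e
    using r'(3)[OF that] linear_closed[OF r'(1) that] linear_closed[OF p(2) that] by blast
  show ?thesis
  proof
    show "\<psi> (\<phi> e) = e" if "e \<in> carrier E" for e using dec[OF that] by (auto simp: \<phi> \<psi>)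
    show "\<phi> (\<psi> e) = e" if "e \<in> carrier E'" for e using dec'[OF that] by (auto simp: \<phi> \<psi>)
    show "p' (\<phi> e) = p e" if "e \<in> carrier E" for e
      using dec[OF that] by (auto simp: \<phi> linear_add[OF p(1)] linear_add[OF p(2)] pi s(2) s'(2))
    show "\<phi> (i b) = i' b" if "b \<in> carrier B" for b
      using \<phi>(2)[OF that A.zero_closed] that
      by (simp add: linear_zero[OF A E s(1)] linear_zero[OF A E' s'(1)])
    show "\<phi> (s a) = s' a" if "a \<in> carrier A" for a
      using \<phi>(2)[OF B.zero_closed that] that
      by (simp add: linear_zero[OF B E i(1)] linear_zero[OF B E' i(2)])
  qed fact+
qed

lemma yoneda_equivI:
  assumes "(i, E, p) \<in> extensions C A B" "(i', E', p') \<in> extensions C A B"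
    and "\<phi> \<in> Mor C E E'" "\<psi> \<in> Mor C E' E"
    and "Cmp C E \<psi> \<phi> = Idm C E" "Cmp C E' \<phi> \<psi> = Idm C E'" "Cmp C B \<phi> i = i'" "Cmp C E p' \<phi> = p"
  shows "((i, E, p), (i', E', p')) \<in> yoneda_equiv C A B"
  using assms unfolding yoneda_equiv_def iso_mor_def by blast

text \<open>The part common to \<open>LMod R\<close> and \<open>Ch R\<close>. If Ext vanishes, the
  class of any extension, which contains it by reflexivity, is the class of split ones. Conversely,
  if all extensions split, they are pairwise equivalent and form a single class; some extension has
  to exist, since otherwise \<open>Ext1\<close> would be empty instead of a singleton.\<close>

lemma Ext1_vanishes_iff:
  assumes ne: "extensions C A B \<noteq> {}"
    and refl: "\<And>x. x \<in> extensions C A B \<Longrightarrow> (x, x) \<in> yoneda_equiv C A B"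
    and iso: "\<And>x y. x \<in> Ext1_zero C A B \<Longrightarrow> y \<in> Ext1_zero C A B \<Longrightarrow> (x, y) \<in> yoneda_equiv C A B"
  shows "Ext1_vanishes C A B \<longleftrightarrow> extensions C A B \<subseteq> Ext1_zero C A B"
proof
  assume van: "Ext1_vanishes C A B"
  show "extensions C A B \<subseteq> Ext1_zero C A B"
  proof
    fix x assume x: "x \<in> extensions C A B"
    then have "yoneda_equiv C A B `` {x} \<in> Ext1 C A B" by (auto simp: Ext1_def quotient_def)
    then show "x \<in> Ext1_zero C A B" using van refl[OF x] by (auto simp: Ext1_vanishes_def)
  qed
next
  assume sub: "extensions C A B \<subseteq> Ext1_zero C A B"
  then have eq: "Ext1_zero C A B = extensions C A B" by (auto simp: Ext1_zero_def)
  have "yoneda_equiv C A B `` {x} = extensions C A B" if x: "x \<in> extensions C A B" for x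
    using iso[of x] x eq by (fastforce simp: yoneda_equiv_def)
  with ne show "Ext1_vanishes C A B" by (auto simp: Ext1_vanishes_def Ext1_def quotient_def eq)
qed

lemma LMod_simps:
  "Obj (LMod R) = {M. left_module R M}" "Mor (LMod R) = module_hom R"
  "Cmp (LMod R) M g f = compose (carrier M) g f" "Idm (LMod R) M = (\<lambda>x \<in> carrier M. x)"
  "Ses (LMod R) = module_ses R"
  by (simp_all add: LMod_def)

lemma compose_eq_restrict: "compose A g f = restrict h A" if "\<And>x. x \<in> A \<Longrightarrow> g (f x) = h x"
  using that by (auto simp: compose_def restrict_def)

lemma compose_eqI:
  assumes "h \<in> extensional A" "\<And>x. x \<in> A \<Longrightarrow> g (f x) = h x" shows "compose A g f = h"
  using assms by (auto simp: compose_def restrict_def extensional_def fun_eq_iff)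

context module_universe
begin

text \<open>The working form of Ext vanishing, on \<open>linear\<close> maps. The direct sum shows
  that extensions exist, and restricting both maps to the carriers turns a
  \<open>short_exact\<close> sequence into an object of \<open>extensions\<close> without affecting
  sections.\<close>

lemma LMod_Ext1_vanishes_iff:
  fixes A B :: "('r, 'm) module"
  assumes A: "left_module R A" and B: "left_module R B"
  shows "Ext1_vanishes (LMod R) A B \<longleftrightarrow>
    (\<forall>i (E :: ('r, 'm) module) p. left_module R E \<longrightarrow> short_exact R B i E p A \<longrightarrow>
      (\<exists>s. linear R A E s \<and> (\<forall>a \<in> carrier A. p (s a) = a)))"
    (is "_ \<longleftrightarrow> ?split")
proof -
  have ext: "(i, E, p) \<in> extensions (LMod R) A B \<longleftrightarrow> left_module R E \<and> short_exact R B i E p A \<and>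
      i \<in> extensional (carrier B) \<and> p \<in> extensional (carrier E)" for i E p
    by (auto simp: extensions_def LMod_simps module_ses_iff)
  have zero: "(i, E, p) \<in> Ext1_zero (LMod R) A B \<longleftrightarrow> (i, E, p) \<in> extensions (LMod R) A B \<and>
      (\<exists>s. linear R A E s \<and> (\<forall>a \<in> carrier A. p (s a) = a))" for i E p
  proof -
    have "(\<exists>s \<in> module_hom R A E. compose (carrier A) p s = (\<lambda>x \<in> carrier A. x)) \<longleftrightarrow>
      (\<exists>s. linear R A E s \<and> (\<forall>a \<in> carrier A. p (s a) = a))" (is "?l \<longleftrightarrow> ?r")
    proof
      assume ?l then show ?r by (metis compose_eq module_hom_iff restrict_apply')
    next
      assume ?r
      then obtain s where "linear R A E s" "\<forall>a \<in> carrier A. p (s a) = a" by blast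
      then show ?l using module_hom_restrict[OF A]
        by (intro bexI[of _ "restrict s (carrier A)"]) (auto simp: compose_eq_restrict)
    qed
    then show ?thesis by (auto simp: Ext1_zero_def LMod_simps)
  qed
  have restr: "(restrict i (carrier B), E, restrict p (carrier E)) \<in> extensions (LMod R) A B"
    if "left_module R E" "short_exact R B i E p A" for i E p
    using that short_exact_cong[OF B that] by (simp add: ext)
  have "Ext1_vanishes (LMod R) A B \<longleftrightarrow> extensions (LMod R) A B \<subseteq> Ext1_zero (LMod R) A B"
  proof (rule Ext1_vanishes_iff)
    show "extensions (LMod R) A B \<noteq> {}"
      using restr[OF left_module_direct_sum[OF B A] short_exact_direct_sum[OF B A]] by blast
  next
    fix x assume "x \<in> extensions (LMod R) A B"
    then obtain i E p where x: "x = (i, E, p)" "(i, E, p) \<in> extensions (LMod R) A B" by (cases x) auto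
    then have E: "left_module R E" and ses: "short_exact R B i E p A"
      and [simp]: "i \<in> extensional (carrier B)" "p \<in> extensional (carrier E)" by (auto simp: ext)
    have i: "i b \<in> carrier E" if "b \<in> carrier B" for b
      using that ses by (auto simp: short_exact_def linear_closed)
    let ?id = "\<lambda>x \<in> carrier E. x"
    have "?id \<in> module_hom R E E" by (rule module_hom_restrict[OF E linear_id])
    moreover have "compose (carrier E) ?id ?id = ?id" by (rule compose_eq_restrict) simp
    moreover have "compose (carrier B) ?id i = i" "compose (carrier E) p ?id = p"
      by (auto intro!: compose_eqI simp: i)
    ultimately show "(x, x) \<in> yoneda_equiv (LMod R) A B"
      using x by (auto simp: yoneda_equiv_def iso_mor_def LMod_simps)
  next
    fix x y assume "x \<in> Ext1_zero (LMod R) A B" "y \<in> Ext1_zero (LMod R) A B"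
    then obtain i E p i' E' p' where x: "x = (i, E, p)" "(i, E, p) \<in> Ext1_zero (LMod R) A B"
      and y: "y = (i', E', p')" "(i', E', p') \<in> Ext1_zero (LMod R) A B" by (cases x, cases y) auto
    obtain s where E: "left_module R E" and ses: "short_exact R B i E p A"
      and s: "linear R A E s" "\<And>a. a \<in> carrier A \<Longrightarrow> p (s a) = a"
      and [simp]: "i \<in> extensional (carrier B)" "p \<in> extensional (carrier E)"
      using x(2) by (auto simp: ext zero)
    obtain s' where E': "left_module R E'" and ses': "short_exact R B i' E' p' A"
      and s': "linear R A E' s'" "\<And>a. a \<in> carrier A \<Longrightarrow> p' (s' a) = a"
      and [simp]: "i' \<in> extensional (carrier B)" "p' \<in> extensional (carrier E')"
      using y(2) by (auto simp: ext zero)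
    have i: "i b \<in> carrier E" if "b \<in> carrier B" for b
      using that ses by (auto simp: short_exact_def linear_closed)
    obtain \<phi> \<psi> where \<phi>: "linear R E E' \<phi>" "linear R E' E \<psi>"
      "\<And>e. e \<in> carrier E \<Longrightarrow> \<psi> (\<phi> e) = e" "\<And>e. e \<in> carrier E' \<Longrightarrow> \<phi> (\<psi> e) = e"
      "\<And>b. b \<in> carrier B \<Longrightarrow> \<phi> (i b) = i' b" "\<And>e. e \<in> carrier E \<Longrightarrow> p' (\<phi> e) = p e"
      using split_extension_iso[OF B E A E' ses s ses' s'] by metis
    let ?\<phi> = "restrict \<phi> (carrier E)" and ?\<psi> = "restrict \<psi> (carrier E')"
    have "?\<phi> \<in> module_hom R E E'" "?\<psi> \<in> module_hom R E' E"
      using \<phi> by (intro module_hom_restrict E E'; simp)+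
    moreover have "compose (carrier E) ?\<psi> ?\<phi> = (\<lambda>x \<in> carrier E. x)" "compose (carrier E') ?\<phi> ?\<psi> = (\<lambda>x \<in> carrier E'. x)"
      using \<phi> linear_closed[OF \<phi>(1)] linear_closed[OF \<phi>(2)] by (auto intro!: compose_eq_restrict)
    moreover have "compose (carrier B) ?\<phi> i = i'" "compose (carrier E) p' ?\<phi> = p"
      using \<phi> i by (auto intro!: compose_eqI)
    ultimately show "(x, y) \<in> yoneda_equiv (LMod R) A B"
      using x y by (auto simp: yoneda_equiv_def iso_mor_def LMod_simps zero)
  qed
  also have "\<dots> \<longleftrightarrow> ?split"
  proof
    assume sub: "extensions (LMod R) A B \<subseteq> Ext1_zero (LMod R) A B"
    show ?split
    proof (intro allI impI)
      fix i p and E :: "('r, 'm) module" assume E: "left_module R E" "short_exact R B i E p A"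
      then have "(restrict i (carrier B), E, restrict p (carrier E)) \<in> Ext1_zero (LMod R) A B"
        using sub restr by blast
      then obtain s where s: "linear R A E s"
        "\<forall>a \<in> carrier A. restrict p (carrier E) (s a) = a"
        unfolding zero by blast
      then show "\<exists>s. linear R A E s \<and> (\<forall>a \<in> carrier A. p (s a) = a)"
        by (intro exI[of _ s]) (simp add: linear_closed)
    qed
  qed (auto simp: ext zero)
  finally show ?thesis .
qed

end

section \<open>Complexes, twisted sums and the splitting criterion in \<open>Ch R\<close>\<close>

abbreviation elems :: "('r, 'm) complex_data \<Rightarrow> int \<Rightarrow> 'm set" where
  "elems C n \<equiv> carrier (component C n)"

text \<open>\<open>chain_map\<close> without extensionality, parallel to
  \<open>linear\<close>.\<close>

definition complex_map :: "('r, 'e) ring_scheme \<Rightarrow> ('r, 'm) complex_data \<Rightarrow> ('r, 'm) complex_data \<Rightarrow>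
    (int \<Rightarrow> 'm \<Rightarrow> 'm) \<Rightarrow> bool" where
  "complex_map R C D f \<longleftrightarrow> (\<forall>n. linear R (component C n) (component D n) (f n)) \<and>
    (\<forall>n. \<forall>x \<in> elems C n. diff D n (f n x) = f (n - 1) (diff C n x))"

definition complex_ses :: "('r, 'e) ring_scheme \<Rightarrow> ('r, 'm) complex_data \<Rightarrow> (int \<Rightarrow> 'm \<Rightarrow> 'm) \<Rightarrow>
    ('r, 'm) complex_data \<Rightarrow> (int \<Rightarrow> 'm \<Rightarrow> 'm) \<Rightarrow> ('r, 'm) complex_data \<Rightarrow> bool" where
  "complex_ses R B i E p A \<longleftrightarrow> complex_map R B E i \<and> complex_map R E A p \<and>
    (\<forall>n. short_exact R (component B n) (i n) (component E n) (p n) (component A n))"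

lemma complex_map_linear: "complex_map R C D f \<Longrightarrow> linear R (component C n) (component D n) (f n)"
  and complex_map_diff: "complex_map R C D f \<Longrightarrow> x \<in> elems C n \<Longrightarrow>
    diff D n (f n x) = f (n - 1) (diff C n x)"
  by (auto simp: complex_map_def)

lemma complex_map_closed: "complex_map R C D f \<Longrightarrow> x \<in> elems C n \<Longrightarrow> f n x \<in> elems D n"
  by (auto simp: complex_map_def intro: linear_closed)

lemma chain_map_iff: "f \<in> chain_map R C D \<longleftrightarrow>
    complex_map R C D f \<and> (\<forall>n. f n \<in> extensional (elems C n))"
  by (auto simp: chain_map_def complex_map_def module_hom_iff)

context
  fixes R :: "('r, 'e) ring_scheme" and C :: "('r, 'm) complex_data"
  assumes C: "chain_complex R C"
begin

lemma complex_module: "left_module R (component C n)"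
  and diff_linear: "linear R (component C n) (component C (n - 1)) (diff C n)"
  and diff_closed: "x \<in> elems C n \<Longrightarrow> diff C n x \<in> elems C (n - 1)"
  and diff_diff:
    "x \<in> elems C n \<Longrightarrow> diff C (n - 1) (diff C n x) = \<zero>\<^bsub>component C (n - 2)\<^esub>"
  using C by (auto simp: chain_complex_def module_hom_iff intro: linear_closed)

end

lemma complex_map_cong:
  assumes C: "chain_complex R C" and f: "complex_map R C D f"
    and eq: "\<And>n x. x \<in> elems C n \<Longrightarrow> g n x = f n x"
  shows "complex_map R C D g"
proof -
  have "linear R (component C n) (component D n) (g n)" for n
    by (rule linear_cong[OF complex_module[OF C] complex_map_linear[OF f]]) (rule eq)
  then show ?thesis using f eq diff_closed[OF C] by (simp add: complex_map_def)
qed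

text \<open>\<open>chain_complex\<close> demands differentials in \<open>module_hom\<close>, hence
  extensional ones; the restriction allows them to be given by any term.\<close>

definition make_complex :: "(int \<Rightarrow> ('r, 'm) module) \<Rightarrow> (int \<Rightarrow> 'm \<Rightarrow> 'm) \<Rightarrow> ('r, 'm) complex_data" where
  "make_complex M d = \<lparr>component = M, diff = (\<lambda>n. restrict (d n) (carrier (M n)))\<rparr>"

lemma make_complex_simps [simp]:
  "component (make_complex M d) = M"
  "x \<in> carrier (M n) \<Longrightarrow> diff (make_complex M d) n x = d n x"
  by (simp_all add: make_complex_def)

lemma chain_complex_make:
  assumes "\<And>n. left_module R (M n)" "\<And>n. linear R (M n) (M (n - 1)) (d n)"
    and "\<And>n x. x \<in> carrier (M n) \<Longrightarrow> d (n - 1) (d n x) = \<zero>\<^bsub>M (n - 2)\<^esub>"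
  shows "chain_complex R (make_complex M d)"
  using assms module_hom_restrict[OF assms(1,2)] linear_closed[OF assms(2)]
  by (auto simp: chain_complex_def make_complex_def)

lemma Ch_simps:
  "Obj (Ch R) = {C. chain_complex R C}" "Mor (Ch R) = chain_map R"
  "Cmp (Ch R) C g f = (\<lambda>n. compose (elems C n) (g n) (f n))"
  "Idm (Ch R) C = (\<lambda>n. \<lambda>x \<in> elems C n. x)"
  "Ses (Ch R) B i E p A \<longleftrightarrow> complex_ses R B i E p A \<and> (\<forall>n. i n \<in> extensional (elems B n)) \<and>
     (\<forall>n. p n \<in> extensional (elems E n))"
  by (auto simp add: Ch_def complex_ses_def chain_map_iff module_ses_iff)

text \<open>The differential is upper triangular, with \<open>f\<close> off the diagonal.
  Equivalently, this is the mapping cone of \<open>f\<close> seen as a chain map to \<open>V\<close>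
  from \<open>X\<close> shifted by one with negated differential.\<close>

definition twisted_sum :: "('r, 'm) complex_data \<Rightarrow> ('r, 'm) complex_data \<Rightarrow> (int \<Rightarrow> 'm \<Rightarrow> 'm) \<Rightarrow>
    ('r, 'm) complex_data" where
  "twisted_sum V X f = make_complex (\<lambda>n. direct_sum (component V n) (component X n))
    (\<lambda>n e. pairing (diff V n (pair_fst e) \<oplus>\<^bsub>component V (n - 1)\<^esub> f n (pair_snd e)) (diff X n (pair_snd e)))"

context module_universe
begin

text \<open>The off-diagonal entry of the squared differential is \<open>d f + f d\<close>, so
  \<open>anti\<close> is exactly what makes it zero.\<close>

lemma twisted_sum:
  fixes V X :: "('r, 'm) complex_data"
  assumes V: "chain_complex R V" and X: "chain_complex R X"
    and f: "\<And>n. linear R (component X n) (component V (n - 1)) (f n)"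
    and anti: "\<And>n x. x \<in> elems X n \<Longrightarrow>
      diff V (n - 1) (f n x) \<oplus>\<^bsub>component V (n - 2)\<^esub> f (n - 1) (diff X n x) = \<zero>\<^bsub>component V (n - 2)\<^esub>"
  shows "chain_complex R (twisted_sum V X f)"
    "complex_ses R V (\<lambda>n a. pairing a \<zero>\<^bsub>component X n\<^esub>) (twisted_sum V X f) (\<lambda>n. pair_snd) X"
proof -
  note VM = complex_module[OF V] and XM = complex_module[OF X]
  note Vd = diff_linear[OF V] and Xd = diff_linear[OF X]
  interpret V: left_module R "component V n" for n by (rule VM)
  interpret X: left_module R "component X n" for n by (rule XM)
  have anti': "diff V (n - 1) (diff V n a \<oplus>\<^bsub>component V (n - 1)\<^esub> f n b) \<oplus>\<^bsub>component V (n - 2)\<^esub> f (n - 1) (diff X n b)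
       = \<zero>\<^bsub>component V (n - 2)\<^esub>"
    if "a \<in> elems V n" "b \<in> elems X n" for n a b
  proof -
    have [simp]: "diff V n a \<in> elems V (n - 1)" "f n b \<in> elems V (n - 1)"
      "diff V (n - 1) (f n b) \<in> elems V (n - 2)" "f (n - 1) (diff X n b) \<in> elems V (n - 2)"
      using that linear_closed[OF f] diff_closed[OF V] diff_closed[OF X]
        linear_closed[OF f, of _ "n - 1"] diff_closed[OF V, of _ "n - 1"]
      by auto
    show ?thesis
      using that linear_add[OF Vd, of "diff V n a" "n - 1" "f n b"]
      by (simp add: diff_diff[OF V] V.a_assoc anti)
  qed
  let ?d = "\<lambda>n e. pairing (diff V n (pair_fst e) \<oplus>\<^bsub>component V (n - 1)\<^esub> f n (pair_snd e)) (diff X n (pair_snd e))"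
  show "chain_complex R (twisted_sum V X f)"
    unfolding twisted_sum_def
  proof (rule chain_complex_make)
    fix n
    show "left_module R (direct_sum (component V n) (component X n))"
      by (intro left_module_direct_sum VM XM)
    note lin = direct_sum_linear(3,4)[OF VM XM, of n]
    show "linear R (direct_sum (component V n) (component X n))
       (direct_sum (component V (n - 1)) (component X (n - 1))) (?d n)"
      by (intro linear_pairing linear_add_fun[OF left_module_direct_sum[OF VM XM] VM]
          linear_comp[OF lin(1) Vd] linear_comp[OF lin(2) Xd] linear_comp[OF lin(2) f])
  next
    fix n x assume "x \<in> carrier (direct_sum (component V n) (component X n))"
    then obtain a b where "a \<in> elems V n" "b \<in> elems X n" "x = pairing a b"
      by (rule direct_sumE)
    then show "?d (n - 1) (?d n x) = \<zero>\<^bsub>direct_sum (component V (n - 2)) (component X (n - 2))\<^esub>"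
      by (simp add: anti' diff_diff[OF X])
  qed
  show "complex_ses R V (\<lambda>n a. pairing a \<zero>\<^bsub>component X n\<^esub>) (twisted_sum V X f) (\<lambda>n. pair_snd) X"
    using short_exact_direct_sum[OF VM XM] direct_sum_linear[OF VM XM]
    by (auto simp: complex_ses_def complex_map_def twisted_sum_def linear_zero[OF XM XM Xd]
        linear_zero[OF XM VM f] diff_closed[OF V] elim!: direct_sumE)
qed

text \<open>As for modules, but the isomorphism between two split extensions is first obtained
  degree by degree and then has to be recognised as a chain map.\<close>

lemma Ch_Ext1_vanishes_iff:
  fixes A B :: "('r, 'm) complex_data"
  assumes A: "chain_complex R A" and B: "chain_complex R B"
  shows "Ext1_vanishes (Ch R) A B \<longleftrightarrow>
    (\<forall>i (E :: ('r, 'm) complex_data) p. chain_complex R E \<longrightarrow> complex_ses R B i E p A \<longrightarrow>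
      (\<exists>s. complex_map R A E s \<and> (\<forall>n. \<forall>a \<in> elems A n. p n (s n a) = a)))"
    (is "_ \<longleftrightarrow> ?split")
proof -
  note AM = complex_module[OF A] and BM = complex_module[OF B]
  have ext: "(i, E, p) \<in> extensions (Ch R) A B \<longleftrightarrow> chain_complex R E \<and> complex_ses R B i E p A \<and>
      (\<forall>n. i n \<in> extensional (elems B n)) \<and> (\<forall>n. p n \<in> extensional (elems E n))" for i E p
    by (auto simp: extensions_def Ch_simps)
  have restr_map: "(\<lambda>n. restrict (s n) (elems C n)) \<in> chain_map R C D"
    if "chain_complex R C" "complex_map R C D s" for s and C D :: "('r, 'm) complex_data"
    using that complex_map_cong[OF that, of "\<lambda>n. restrict (s n) (elems C n)"]
    by (simp add: chain_map_iff)
  have zero: "(i, E, p) \<in> Ext1_zero (Ch R) A B \<longleftrightarrow> (i, E, p) \<in> extensions (Ch R) A B \<and>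
      (\<exists>s. complex_map R A E s \<and> (\<forall>n. \<forall>a \<in> elems A n. p n (s n a) = a))" for i E p
  proof -
    have "(\<exists>s \<in> chain_map R A E. (\<lambda>n. compose (elems A n) (p n) (s n)) =
        (\<lambda>n. \<lambda>x \<in> elems A n. x)) \<longleftrightarrow>
      (\<exists>s. complex_map R A E s \<and> (\<forall>n. \<forall>a \<in> elems A n. p n (s n a) = a))" (is "?l \<longleftrightarrow> ?r")
    proof
      assume ?l
      then obtain s where s: "s \<in> chain_map R A E" and eq: "(\<lambda>n. compose (elems A n) (p n) (s n)) =
        (\<lambda>n. \<lambda>x \<in> elems A n. x)" by blast
      have "p n (s n a) = a" if "a \<in> elems A n" for n a
        using fun_cong[OF fun_cong[OF eq], of n a] that by (simp add: compose_def)
      then show ?r using s by (auto simp: chain_map_iff)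
    next
      assume ?r
      then obtain s where "complex_map R A E s" "\<forall>n. \<forall>a \<in> elems A n. p n (s n a) = a" by blast
      then show ?l using restr_map[OF A, of E s]
        by (intro bexI[of _ "\<lambda>n. restrict (s n) (elems A n)"]) (auto simp: compose_eq_restrict)
    qed
    then show ?thesis by (auto simp: Ext1_zero_def Ch_simps)
  qed
  have restr: "(\<lambda>n. restrict (i n) (elems B n), E, \<lambda>n. restrict (p n) (elems E n))
      \<in> extensions (Ch R) A B"
    if "chain_complex R E" "complex_ses R B i E p A" for i E p
  proof -
    have "short_exact R (component B n) (restrict (i n) (elems B n)) (component E n)
        (restrict (p n) (elems E n)) (component A n)" for n
      by (rule short_exact_cong[OF BM complex_module[OF that(1)], where i = "i n" and p = "p n"])
        (use that(2) in \<open>simp_all add: complex_ses_def\<close>)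
    then show ?thesis
      using that restr_map[OF B, of E i] restr_map[OF that(1), of A p]
      by (auto simp: ext complex_ses_def chain_map_iff)
  qed
  have "Ext1_vanishes (Ch R) A B \<longleftrightarrow> extensions (Ch R) A B \<subseteq> Ext1_zero (Ch R) A B"
  proof (rule Ext1_vanishes_iff)
    \<comment> \<open>The untwisted sum, that is, the direct sum of complexes, is the extension that
      shows nonemptiness.\<close>
    let ?f = "\<lambda>n x. \<zero>\<^bsub>component B (n - 1)\<^esub>"
    have "diff B (n - 1) \<zero>\<^bsub>component B (n - 1)\<^esub> \<oplus>\<^bsub>component B (n - 2)\<^esub> \<zero>\<^bsub>component B (n - 2)\<^esub> = \<zero>\<^bsub>component B (n - 2)\<^esub>" for n
    proof -
      interpret left_module R "component B (n - 2)" by (rule BM)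
      show ?thesis using linear_zero[OF BM BM diff_linear[OF B], of "n - 1"] by simp
    qed
    then show "extensions (Ch R) A B \<noteq> {}"
      using restr[OF twisted_sum[OF B A, of ?f]] linear_zero_fun[OF AM BM] by fastforce
  next
    fix x assume "x \<in> extensions (Ch R) A B"
    then obtain i E p where x: "x = (i, E, p)" "(i, E, p) \<in> extensions (Ch R) A B" by (cases x) auto
    then have E: "chain_complex R E" and ses: "complex_ses R B i E p A"
      and [simp]: "i n \<in> extensional (elems B n)" "p n \<in> extensional (elems E n)"
      for n by (auto simp: ext)
    have i: "i n b \<in> elems E n" if "b \<in> elems B n" for n b
      using that ses complex_map_closed by (auto simp: complex_ses_def)
    let ?id = "\<lambda>n. \<lambda>x \<in> elems E n. x"
    have "complex_map R E E (\<lambda>n x. x)" by (simp add: complex_map_def linear_id)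
    then have "?id \<in> chain_map R E E" by (rule restr_map[OF E])
    moreover have "compose (elems E n) (?id n) (?id n) = ?id n" for n by (rule compose_eq_restrict) simp
    moreover have "compose (elems B n) (?id n) (i n) = i n" "compose (elems E n) (p n) (?id n) = p n" for n
      by (auto intro!: compose_eqI simp: i)
    ultimately show "(x, x) \<in> yoneda_equiv (Ch R) A B"
      unfolding x(1) by (intro yoneda_equivI[where \<phi> = ?id and \<psi> = ?id] x(2)) (simp_all add: Ch_simps)
  next
    fix x y assume "x \<in> Ext1_zero (Ch R) A B" "y \<in> Ext1_zero (Ch R) A B"
    then obtain i E p i' E' p' where x: "x = (i, E, p)" "(i, E, p) \<in> Ext1_zero (Ch R) A B"
      and y: "y = (i', E', p')" "(i', E', p') \<in> Ext1_zero (Ch R) A B" by (cases x, cases y) auto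
    obtain s where E: "chain_complex R E" and ses: "complex_ses R B i E p A"
      and s: "complex_map R A E s" "\<And>n a. a \<in> elems A n \<Longrightarrow> p n (s n a) = a"
      and [simp]: "\<And>n. i n \<in> extensional (elems B n)" "\<And>n. p n \<in> extensional (elems E n)"
      using x(2) by (auto simp: ext zero)
    obtain s' where E': "chain_complex R E'" and ses': "complex_ses R B i' E' p' A"
      and s': "complex_map R A E' s'" "\<And>n a. a \<in> elems A n \<Longrightarrow> p' n (s' n a) = a"
      and [simp]: "\<And>n. i' n \<in> extensional (elems B n)" "\<And>n. p' n \<in> extensional (elems E' n)"
      using y(2) by (auto simp: ext zero)
    note EM = complex_module[OF E] and EM' = complex_module[OF E']
    have sn: "short_exact R (component B n) (i n) (component E n) (p n) (component A n)"
      "short_exact R (component B n) (i' n) (component E' n) (p' n) (component A n)" for n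
      using ses ses' by (auto simp: complex_ses_def)
    have i: "complex_map R B E i" "complex_map R B E' i'" using ses ses' by (auto simp: complex_ses_def)
    have p: "complex_map R E A p" using ses by (auto simp: complex_ses_def)
    note cl = complex_map_closed[OF i(1)] complex_map_closed[OF i(2)]
       complex_map_closed[OF s(1)] complex_map_closed[OF s'(1)]
       diff_closed[OF A] diff_closed[OF B] diff_closed[OF E] diff_closed[OF E']
    have "\<exists>\<phi> \<psi>. linear R (component E n) (component E' n) \<phi> \<and> linear R (component E' n) (component E n) \<psi> \<and>
      (\<forall>e \<in> elems E n. \<psi> (\<phi> e) = e) \<and> (\<forall>e \<in> elems E' n. \<phi> (\<psi> e) = e) \<and>
      (\<forall>b \<in> elems B n. \<phi> (i n b) = i' n b) \<and> (\<forall>a \<in> elems A n. \<phi> (s n a) = s' n a) \<and>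
      (\<forall>e \<in> elems E n. p' n (\<phi> e) = p n e)" for n
      by (rule split_extension_iso[OF BM EM AM EM' sn(1) complex_map_linear[OF s(1)] s(2)
             sn(2) complex_map_linear[OF s'(1)] s'(2)], assumption, assumption, blast)
    then obtain \<phi> \<psi> where \<phi>: "\<And>n. linear R (component E n) (component E' n) (\<phi> n)"
      "\<And>n. linear R (component E' n) (component E n) (\<psi> n)"
      "\<And>n e. e \<in> elems E n \<Longrightarrow> \<psi> n (\<phi> n e) = e" "\<And>n e. e \<in> elems E' n \<Longrightarrow> \<phi> n (\<psi> n e) = e"
      "\<And>n b. b \<in> elems B n \<Longrightarrow> \<phi> n (i n b) = i' n b"
      "\<And>n a. a \<in> elems A n \<Longrightarrow> \<phi> n (s n a) = s' n a"
      "\<And>n e. e \<in> elems E n \<Longrightarrow> p' n (\<phi> n e) = p n e" by metis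
    note \<phi>_cl = linear_closed[OF \<phi>(1)] linear_closed[OF \<phi>(2)]
    \<comment> \<open>Each \<open>e\<close> is \<open>i b + s a\<close>. The maps \<open>i\<close>,
      \<open>s\<close>, \<open>i'\<close>, \<open>s'\<close> are chain maps, and
      \<open>\<phi>\<close> takes \<open>i\<close> to \<open>i'\<close> and \<open>s\<close> to
      \<open>s'\<close> in every degree, so \<open>\<phi>\<close> commutes with the
      differentials.\<close>
    have comm: "diff E' n (\<phi> n e) = \<phi> (n - 1) (diff E n e)" if e: "e \<in> elems E n" for n e
    proof -
      obtain r where r: "linear R (component E n) (component B n) r"
        "e = i n (r e) \<oplus>\<^bsub>component E n\<^esub> s n (p n e)"
        using short_exact_retraction[OF BM EM AM sn(1) complex_map_linear[OF s(1)] s(2)] e by metis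
      define b a where "b = r e" "a = p n e"
      have ba: "b \<in> elems B n" "a \<in> elems A n" "e = i n b \<oplus>\<^bsub>component E n\<^esub> s n a"
        using r(2) linear_closed[OF r(1) e] complex_map_closed[OF p e] by (simp_all add: b_a_def)
      note add = linear_add[OF \<phi>(1)] linear_add[OF diff_linear[OF E]] linear_add[OF diff_linear[OF E']]
      show ?thesis
        using ba by (simp add: add cl \<phi> complex_map_diff[OF i(1)] complex_map_diff[OF i(2)]
          complex_map_diff[OF s(1)] complex_map_diff[OF s'(1)])
    qed
    have "diff E n (\<psi> n e) = \<psi> (n - 1) (diff E' n e)" if e: "e \<in> elems E' n" for n e
      using comm[of "\<psi> n e" n] e by (metis \<phi>(3,4) \<phi>_cl(2) cl(7))
    then have map: "complex_map R E E' \<phi>" "complex_map R E' E \<psi>" using comm \<phi> by (simp_all add: complex_map_def)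
    let ?\<phi> = "\<lambda>n. restrict (\<phi> n) (elems E n)" and ?\<psi> = "\<lambda>n. restrict (\<psi> n) (elems E' n)"
    have "?\<phi> \<in> chain_map R E E'" "?\<psi> \<in> chain_map R E' E"
      using map by (intro restr_map E E'; simp)+
    moreover have "compose (elems E n) (?\<psi> n) (?\<phi> n) = (\<lambda>x \<in> elems E n. x)"
      "compose (elems E' n) (?\<phi> n) (?\<psi> n) = (\<lambda>x \<in> elems E' n. x)" for n
      using \<phi>(3,4) \<phi>_cl by (auto intro!: compose_eq_restrict)
    moreover have "compose (elems B n) (?\<phi> n) (i n) = i' n" "compose (elems E n) (p' n) (?\<phi> n) = p n" for n
      using \<phi>(5,7) cl by (auto intro!: compose_eqI)
    ultimately show "(x, y) \<in> yoneda_equiv (Ch R) A B"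
      unfolding x(1) y(1) using x(2) y(2)
      by (intro yoneda_equivI[where \<phi> = ?\<phi> and \<psi> = ?\<psi>]) (simp_all add: Ch_simps zero)
  qed
  also have "\<dots> \<longleftrightarrow> ?split"
  proof
    assume sub: "extensions (Ch R) A B \<subseteq> Ext1_zero (Ch R) A B"
    show ?split
    proof (intro allI impI)
      fix i p and E :: "('r, 'm) complex_data" assume E: "chain_complex R E" "complex_ses R B i E p A"
      then have "(\<lambda>n. restrict (i n) (elems B n), E, \<lambda>n. restrict (p n) (elems E n))
          \<in> Ext1_zero (Ch R) A B"
        using sub restr by blast
      then obtain s where s: "complex_map R A E s"
        "\<forall>n. \<forall>a \<in> elems A n. restrict (p n) (elems E n) (s n a) = a"
        unfolding zero by blast
      then show "\<exists>s. complex_map R A E s \<and> (\<forall>n. \<forall>a \<in> elems A n. p n (s n a) = a)"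
        using complex_map_closed[OF s(1)] by (intro exI[of _ s]) simp
    qed
  qed (auto simp: ext zero)
  finally show ?thesis .
qed

end

section \<open>Pushouts, pullbacks and lifting\<close>

lemma left_module_image:
  assumes M: "left_module R M" and N: "left_module R N" and f: "linear R M N f"
  shows "left_module R (N\<lparr>carrier := f ` carrier M\<rparr>)"
proof -
  interpret M: left_module R M by fact
  interpret N: left_module R N by fact
  show ?thesis
  proof (rule left_module_submodule[OF N])
    show "\<zero>\<^bsub>N\<^esub> \<in> f ` carrier M"
      using linear_zero[OF M N f] M.zero_closed by (metis imageI)
  qed (auto simp: linear_closed[OF f] linear_add[OF f, symmetric] linear_smult[OF f, symmetric]
      linear_minus[OF M N f, symmetric] M.smult_closed)
qed

context module_universe
begin

text \<open>\<open>P\<close> is the quotient of the direct sum of \<open>B'\<close> and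
  \<open>E\<close> by the pairs \<open>(- f b, i b)\<close>. Besides the extension, the
  decomposition of its elements and the universal property are recorded, because differentials into
  and out of \<open>P\<close> have to be built later. Injectivity of \<open>i'\<close> holds since
  \<open>(b', 0) = (- f b, i b)\<close> forces \<open>b\<close>, and then \<open>b'\<close>, to be
  zero.\<close>

lemma pushout:
  fixes B E A B' :: "('r, 'm) module"
  assumes B: "left_module R B" and E: "left_module R E" and A: "left_module R A" and B': "left_module R B'"
    and ses: "short_exact R B i E p A" and f: "linear R B B' f"
  obtains P :: "('r, 'm) module" and i' g p' where "left_module R P" "short_exact R B' i' P p' A" "linear R E P g"
    "\<And>b. b \<in> carrier B \<Longrightarrow> g (i b) = i' (f b)" "\<And>e. e \<in> carrier E \<Longrightarrow> p' (g e) = p e"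
    "\<And>x. x \<in> carrier P \<Longrightarrow> \<exists>b \<in> carrier B'. \<exists>e \<in> carrier E. x = i' b \<oplus>\<^bsub>P\<^esub> g e"
    "\<And>(C :: ('r, 'm) module) k l. left_module R C \<Longrightarrow> linear R B' C k \<Longrightarrow> linear R E C l \<Longrightarrow>
       (\<And>b. b \<in> carrier B \<Longrightarrow> k (f b) = l (i b)) \<Longrightarrow>
       \<exists>m. linear R P C m \<and> (\<forall>b \<in> carrier B'. m (i' b) = k b) \<and> (\<forall>e \<in> carrier E. m (g e) = l e)"
proof -
  interpret B: left_module R B by fact
  interpret E: left_module R E by fact
  interpret A: left_module R A by fact
  interpret B': left_module R B' by fact
  have i: "linear R B E i" and p: "linear R E A p" and inj: "inj_on i (carrier B)"
    and im: "i ` carrier B = {e \<in> carrier E. p e = \<zero>\<^bsub>A\<^esub>}" and surj: "p ` carrier E = carrier A"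
    using ses by (auto simp: short_exact_def)
  have pi: "p (i b) = \<zero>\<^bsub>A\<^esub>" if "b \<in> carrier B" for b using im that by blast
  note [simp] = linear_closed[OF i] linear_closed[OF p] linear_closed[OF f]
  define W where "W = direct_sum B' E"
  have W: "left_module R W" unfolding W_def by (rule left_module_direct_sum[OF B' E])
  interpret W: left_module R W by fact
  have lin: "linear R B' W (\<lambda>b. pairing b \<zero>\<^bsub>E\<^esub>)" "linear R E W (\<lambda>e. pairing \<zero>\<^bsub>B'\<^esub> e)"
    "linear R W B' pair_fst" "linear R W E pair_snd"
    unfolding W_def by (rule direct_sum_linear[OF B' E])+
  define h where "h b = pairing (\<ominus>\<^bsub>B'\<^esub> f b) (i b)" for b
  have h: "linear R B W h"
    unfolding h_def W_def by (intro linear_pairing linear_minus_fun[OF B B' f] i)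
  obtain P :: "('r, 'm) module" and \<rho> where P: "left_module R P" and \<rho>: "linear R W P \<rho>"
    "\<rho> ` carrier W = carrier P" "\<And>x. x \<in> carrier W \<Longrightarrow> \<rho> x = \<zero>\<^bsub>P\<^esub> \<longleftrightarrow> x \<in> h ` carrier B"
    using quotient_module[OF W left_module_image[OF B W h]] linear_closed[OF h] by blast
  interpret P: left_module R P by fact
  define i' g where "i' b = \<rho> (pairing b \<zero>\<^bsub>E\<^esub>)" and "g e = \<rho> (pairing \<zero>\<^bsub>B'\<^esub> e)" for b e
  have i': "linear R B' P i'" and g: "linear R E P g"
    unfolding i'_def g_def by (rule linear_comp[OF lin(1) \<rho>(1)], rule linear_comp[OF lin(2) \<rho>(1)])
  have \<rho>_pair: "\<rho> (pairing b e) = i' b \<oplus>\<^bsub>P\<^esub> g e" if "b \<in> carrier B'" "e \<in> carrier E" for b e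
    using linear_add[OF \<rho>(1), of "pairing b \<zero>\<^bsub>E\<^esub>" "pairing \<zero>\<^bsub>B'\<^esub> e"] that
    by (simp add: W_def i'_def g_def)
  have dec: "\<exists>b \<in> carrier B'. \<exists>e \<in> carrier E. x = i' b \<oplus>\<^bsub>P\<^esub> g e" if x: "x \<in> carrier P" for x
  proof -
    obtain w where w: "w \<in> carrier W" "x = \<rho> w" using x \<rho>(2) by blast
    obtain b e where be: "b \<in> carrier B'" "e \<in> carrier E" "w = pairing b e"
      by (rule direct_sumE[OF w(1)[unfolded W_def]])
    with w(2) have "x = i' b \<oplus>\<^bsub>P\<^esub> g e" by (simp add: \<rho>_pair)
    with be show ?thesis by blast
  qed
  have gi: "g (i b) = i' (f b)" if b: "b \<in> carrier B" for b
  proof -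
    have "\<rho> (h b) = \<zero>\<^bsub>P\<^esub>" using b \<rho>(3) linear_closed[OF h] by blast
    moreover have "pairing \<zero>\<^bsub>B'\<^esub> (i b) = pairing (f b) \<zero>\<^bsub>E\<^esub> \<oplus>\<^bsub>W\<^esub> h b"
      using b by (simp add: W_def h_def B'.r_neg)
    ultimately show ?thesis
      using b linear_add[OF \<rho>(1), of "pairing (f b) \<zero>\<^bsub>E\<^esub>" "h b"] linear_closed[OF h b]
        linear_closed[OF \<rho>(1), of "pairing (f b) \<zero>\<^bsub>E\<^esub>"]
      by (simp add: g_def i'_def) (simp add: W_def)
  qed
  have univ: "\<exists>m. linear R P C m \<and> (\<forall>b \<in> carrier B'. m (i' b) = k b) \<and> (\<forall>e \<in> carrier E. m (g e) = l e)"
    if C: "left_module R C" and k: "linear R B' C k" and l: "linear R E C l"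
      and eq: "\<And>b. b \<in> carrier B \<Longrightarrow> k (f b) = l (i b)" for C :: "('r, 'm) module" and k l
  proof -
    interpret C: left_module R C by fact
    note [simp] = linear_closed[OF k] linear_closed[OF l]
    have "linear R W C (\<lambda>x. k (pair_fst x) \<oplus>\<^bsub>C\<^esub> l (pair_snd x))"
      by (intro linear_add_fun[OF W C] linear_comp[OF lin(3) k] linear_comp[OF lin(4) l])
    moreover have "k (pair_fst x) \<oplus>\<^bsub>C\<^esub> l (pair_snd x) = \<zero>\<^bsub>C\<^esub>" if "x \<in> carrier W" "\<rho> x = \<zero>\<^bsub>P\<^esub>" for x
      using that by (auto simp: \<rho>(3) h_def linear_minus[OF B' C k] eq C.l_neg)
    ultimately obtain m where m: "linear R P C m"
      "\<And>x. x \<in> carrier W \<Longrightarrow> m (\<rho> x) = k (pair_fst x) \<oplus>\<^bsub>C\<^esub> l (pair_snd x)"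
      using linear_factor[OF W P C \<rho>(1,2)] by blast
    have "m (i' b) = k b" if "b \<in> carrier B'" for b
      using that by (simp add: i'_def m(2) W_def linear_zero[OF E C l])
    moreover have "m (g e) = l e" if "e \<in> carrier E" for e
      using that by (simp add: g_def m(2) W_def linear_zero[OF B' C k])
    ultimately show ?thesis using m(1) by blast
  qed
  obtain p' where p': "linear R P A p'" "\<forall>b \<in> carrier B'. p' (i' b) = \<zero>\<^bsub>A\<^esub>" "\<forall>e \<in> carrier E. p' (g e) = p e"
    using univ[OF A linear_zero_fun[OF B' A] p] pi by force
  have ses': "short_exact R B' i' P p' A"
    unfolding short_exact_def
  proof (intro conjI)
    show "inj_on i' (carrier B')"
    proof (rule linear_inj_on[OF B' P i'])
      fix b' assume b': "b' \<in> carrier B'" "i' b' = \<zero>\<^bsub>P\<^esub>"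
      then obtain b where b: "b \<in> carrier B" "pairing b' \<zero>\<^bsub>E\<^esub> = h b"
        using \<rho>(3)[of "pairing b' \<zero>\<^bsub>E\<^esub>"] by (auto simp: i'_def W_def)
      then have "i b = i \<zero>\<^bsub>B\<^esub>" by (simp add: h_def linear_zero[OF B E i])
      then have "b = \<zero>\<^bsub>B\<^esub>" using inj b by (simp add: inj_on_eq_iff)
      then show "b' = \<zero>\<^bsub>B'\<^esub>"
        using b B'.minus_equality[of "\<zero>\<^bsub>B'\<^esub>" "\<zero>\<^bsub>B'\<^esub>"] by (simp add: h_def linear_zero[OF B B' f])
    qed
    show "i' ` carrier B' = {x \<in> carrier P. p' x = \<zero>\<^bsub>A\<^esub>}"
    proof (intro equalityI subsetI)
      fix x assume "x \<in> {x \<in> carrier P. p' x = \<zero>\<^bsub>A\<^esub>}"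
      then have x: "x \<in> carrier P" "p' x = \<zero>\<^bsub>A\<^esub>" by auto
      obtain b e where be: "b \<in> carrier B'" "e \<in> carrier E" "x = i' b \<oplus>\<^bsub>P\<^esub> g e" using dec[OF x(1)] by blast
      then have "p e = \<zero>\<^bsub>A\<^esub>"
        using x(2) p' linear_closed[OF i'] linear_closed[OF g] by (simp add: linear_add[OF p'(1)])
      then obtain c where "c \<in> carrier B" "e = i c" using im be by blast
      then have "x = i' (b \<oplus>\<^bsub>B'\<^esub> f c)" using be by (simp add: gi linear_add[OF i'])
      then show "x \<in> i' ` carrier B'" using be \<open>c \<in> _\<close> by simp
    qed (use p' linear_closed[OF i'] in auto)
    show "p' ` carrier P = carrier A"
    proof (intro equalityI subsetI)
      fix a assume "a \<in> carrier A"
      then obtain e where "e \<in> carrier E" "a = p e" using surj by blast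
      then show "a \<in> p' ` carrier P" using p'(3) linear_closed[OF g] by (metis imageI)
    qed (use linear_closed[OF p'(1)] in auto)
  qed (fact i' p')+
  show ?thesis
  proof (rule that[OF P ses' g])
    show "g (i b) = i' (f b)" if "b \<in> carrier B" for b using that by (rule gi)
    show "p' (g e) = p e" if "e \<in> carrier E" for e using that p'(3) by blast
    show "\<exists>b \<in> carrier B'. \<exists>e \<in> carrier E. x = i' b \<oplus>\<^bsub>P\<^esub> g e" if "x \<in> carrier P" for x
      using that by (rule dec)
  qed (rule univ)
qed

text \<open>\<open>P\<close> consists of the pairs \<open>(a, e)\<close> with
  \<open>f a = p e\<close>. The clause that an element with both projections zero is zero serves to
  check equations in \<open>P\<close>, such as the vanishing of a composite differential.\<close>

lemma pullback:
  fixes B E A A' :: "('r, 'm) module"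
  assumes B: "left_module R B" and E: "left_module R E" and A: "left_module R A" and A': "left_module R A'"
    and ses: "short_exact R B i E p A" and f: "linear R A' A f"
  obtains P :: "('r, 'm) module" and i' g p' where "left_module R P" "short_exact R B i' P p' A'" "linear R P E g"
    "\<And>b. b \<in> carrier B \<Longrightarrow> g (i' b) = i b" "\<And>x. x \<in> carrier P \<Longrightarrow> p (g x) = f (p' x)"
    "\<And>x. x \<in> carrier P \<Longrightarrow> p' x = \<zero>\<^bsub>A'\<^esub> \<Longrightarrow> g x = \<zero>\<^bsub>E\<^esub> \<Longrightarrow> x = \<zero>\<^bsub>P\<^esub>"
    "\<And>(C :: ('r, 'm) module) k l. left_module R C \<Longrightarrow> linear R C A' k \<Longrightarrow> linear R C E l \<Longrightarrow>
       (\<And>c. c \<in> carrier C \<Longrightarrow> f (k c) = p (l c)) \<Longrightarrow>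
       \<exists>m. linear R C P m \<and> (\<forall>c \<in> carrier C. p' (m c) = k c) \<and> (\<forall>c \<in> carrier C. g (m c) = l c)"
proof -
  interpret B: left_module R B by fact
  interpret E: left_module R E by fact
  interpret A: left_module R A by fact
  interpret A': left_module R A' by fact
  have i: "linear R B E i" and p: "linear R E A p" and inj: "inj_on i (carrier B)"
    and im: "i ` carrier B = {e \<in> carrier E. p e = \<zero>\<^bsub>A\<^esub>}" and surj: "p ` carrier E = carrier A"
    using ses by (auto simp: short_exact_def)
  have pi: "p (i b) = \<zero>\<^bsub>A\<^esub>" if "b \<in> carrier B" for b using im that by blast
  note [simp] = linear_closed[OF i] linear_closed[OF p] linear_closed[OF f]
  define W where "W = direct_sum A' E"
  have W: "left_module R W" unfolding W_def by (rule left_module_direct_sum[OF A' E])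
  have lin: "linear R W A' pair_fst" "linear R W E pair_snd"
    unfolding W_def by (rule direct_sum_linear[OF A' E])+
  \<comment> \<open>Writing the condition as the vanishing of a difference of linear maps makes
    \<open>left_module_kernel\<close> applicable.\<close>
  define K where "K = {x \<in> carrier W. f (pair_fst x) \<ominus>\<^bsub>A\<^esub> p (pair_snd x) = \<zero>\<^bsub>A\<^esub>}"
  define P where "P = W\<lparr>carrier := K\<rparr>"
  have P: "left_module R P"
    unfolding P_def K_def
    by (intro left_module_kernel[OF W A] linear_diff_fun[OF W A] linear_comp[OF lin(1) f] linear_comp[OF lin(2) p])
  have K: "x \<in> K \<longleftrightarrow> (\<exists>a \<in> carrier A'. \<exists>e \<in> carrier E. x = pairing a e \<and> f a = p e)" for x
    by (auto simp: K_def W_def A.right_minus_eq elim!: direct_sumE)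
  have g: "linear R P E pair_snd" and p': "linear R P A' pair_fst"
    unfolding P_def by (intro linear_restrict_carrier lin; simp add: K_def)+
  have univ: "linear R C P (\<lambda>c. pairing (k c) (l c))"
    if k: "linear R C A' k" and l: "linear R C E l"
      and eq: "\<And>c. c \<in> carrier C \<Longrightarrow> f (k c) = p (l c)" for C :: "('r, 'm) module" and k l
    using that linear_pairing[OF k l] linear_closed[OF k] linear_closed[OF l]
    by (auto simp: linear_def P_def W_def[symmetric] K)
  have ses': "short_exact R B (\<lambda>b. pairing \<zero>\<^bsub>A'\<^esub> (i b)) P pair_fst A'"
    unfolding short_exact_def
  proof (intro conjI)
    show "linear R B P (\<lambda>b. pairing \<zero>\<^bsub>A'\<^esub> (i b))"
      by (intro univ linear_zero_fun[OF B A'] i) (simp add: pi linear_zero[OF A' A f])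
    show "inj_on (\<lambda>b. pairing \<zero>\<^bsub>A'\<^esub> (i b)) (carrier B)" using inj by (simp add: inj_on_def)
    show "(\<lambda>b. pairing \<zero>\<^bsub>A'\<^esub> (i b)) ` carrier B = {x \<in> carrier P. pair_fst x = \<zero>\<^bsub>A'\<^esub>}"
    proof (intro equalityI subsetI)
      fix x assume "x \<in> {x \<in> carrier P. pair_fst x = \<zero>\<^bsub>A'\<^esub>}"
      then obtain e where e: "e \<in> carrier E" "x = pairing \<zero>\<^bsub>A'\<^esub> e" "p e = \<zero>\<^bsub>A\<^esub>"
        by (auto simp: P_def K linear_zero[OF A' A f])
      then obtain b where "b \<in> carrier B" "e = i b" using im by blast
      with e show "x \<in> (\<lambda>b. pairing \<zero>\<^bsub>A'\<^esub> (i b)) ` carrier B" by blast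
    qed (auto simp: P_def K pi linear_zero[OF A' A f])
    show "pair_fst ` carrier P = carrier A'"
    proof (intro equalityI subsetI)
      fix a assume a: "a \<in> carrier A'"
      then obtain e where "e \<in> carrier E" "f a = p e" using surj linear_closed[OF f a] by (metis imageE)
      then show "a \<in> pair_fst ` carrier P" using a by (intro image_eqI[of _ _ "pairing a e"]) (auto simp: P_def K)
    qed (use linear_closed[OF p'] in auto)
  qed (fact p')
  show ?thesis
  proof (rule that[OF P ses' g])
    fix C :: "('r, 'm) module" and k l
    assume "linear R C A' k" "linear R C E l" "\<And>c. c \<in> carrier C \<Longrightarrow> f (k c) = p (l c)"
    from univ[OF this] show "\<exists>m. linear R C P m \<and> (\<forall>c \<in> carrier C. pair_fst (m c) = k c) \<and>
       (\<forall>c \<in> carrier C. pair_snd (m c) = l c)" by (intro exI[of _ "\<lambda>c. pairing (k c) (l c)"]) simp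
  qed (auto simp: P_def K W_def)
qed

text \<open>The exactness of
  \<open>Hom(P, Y) \<rightarrow> Hom(K, Y) \<rightarrow> Ext(A, Y)\<close>: the pushout along
  \<open>f\<close> splits, and its retraction composed with \<open>P \<rightarrow> Q\<close> extends
  \<open>f\<close>.\<close>

lemma Ext1_extend:
  fixes A Y K P :: "('r, 'm) module"
  assumes van: "Ext1_vanishes (LMod R) A Y"
    and A: "left_module R A" and Y: "left_module R Y" and K: "left_module R K" and P: "left_module R P"
    and ses: "short_exact R K i P p A" and f: "linear R K Y f"
  obtains g where "linear R P Y g" "\<And>k. k \<in> carrier K \<Longrightarrow> g (i k) = f k"
proof -
  obtain Q :: "('r, 'm) module" and i' g p' where Q: "left_module R Q" and ses': "short_exact R Y i' Q p' A"
    and g: "linear R P Q g" "\<And>b. b \<in> carrier K \<Longrightarrow> g (i b) = i' (f b)"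
    by (rule pushout[OF K P A Y ses f], blast)
  obtain s where s: "linear R A Q s" "\<And>a. a \<in> carrier A \<Longrightarrow> p' (s a) = a"
    using van Q ses' LMod_Ext1_vanishes_iff[OF A Y] by blast
  obtain r where r: "linear R Q Y r" "\<And>b. b \<in> carrier Y \<Longrightarrow> r (i' b) = b"
    using short_exact_retraction[OF Y Q A ses' s] by metis
  show ?thesis
    using that[OF linear_comp[OF g(1) r(1)]] g(2) r(2) linear_closed[OF f] by simp
qed

text \<open>Dual to \<open>Ext1_extend\<close>: the pullback along \<open>f\<close> splits, and its
  section composed with the projection to \<open>E\<close> lifts \<open>f\<close>.\<close>

lemma Ext1_lift:
  fixes A Y E C :: "('r, 'm) module"
  assumes van: "Ext1_vanishes (LMod R) A Y"
    and A: "left_module R A" and Y: "left_module R Y" and E: "left_module R E" and C: "left_module R C"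
    and ses: "short_exact R Y i E p C" and f: "linear R A C f"
  obtains g where "linear R A E g" "\<And>a. a \<in> carrier A \<Longrightarrow> p (g a) = f a"
proof -
  obtain P :: "('r, 'm) module" and i' g p' where P: "left_module R P" and ses': "short_exact R Y i' P p' A"
    and g: "linear R P E g" "\<And>x. x \<in> carrier P \<Longrightarrow> p (g x) = f (p' x)"
    by (rule pullback[OF Y E C A ses f], blast)
  obtain s where s: "linear R A P s" "\<And>a. a \<in> carrier A \<Longrightarrow> p' (s a) = a"
    using van P ses' LMod_Ext1_vanishes_iff[OF A Y] by blast
  show ?thesis
    using that[OF linear_comp[OF s(1) g(1)]] g(2) s(2) linear_closed[OF s(1)] by simp
qed

text \<open>The zero map is a section in the first case and a retraction in the second.\<close>

lemma Ext1_vanishes_zero: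
  fixes Z B :: "('r, 'm) module"
  assumes Z: "left_module R Z" "carrier Z = {\<zero>\<^bsub>Z\<^esub>}" and B: "left_module R B"
  shows "Ext1_vanishes (LMod R) Z B" "Ext1_vanishes (LMod R) B Z"
proof -
  show "Ext1_vanishes (LMod R) Z B"
    unfolding LMod_Ext1_vanishes_iff[OF Z(1) B]
  proof (intro allI impI)
    fix i p and E :: "('r, 'm) module" assume E: "left_module R E" and ses: "short_exact R B i E p Z"
    have "p \<zero>\<^bsub>E\<^esub> = \<zero>\<^bsub>Z\<^esub>" using ses by (auto simp: short_exact_def intro: linear_zero[OF E Z(1)])
    then show "\<exists>s. linear R Z E s \<and> (\<forall>a \<in> carrier Z. p (s a) = a)"
      using linear_zero_fun[OF Z(1) E] Z(2) by auto
  qed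
  show "Ext1_vanishes (LMod R) B Z"
    unfolding LMod_Ext1_vanishes_iff[OF B Z(1)]
  proof (intro allI impI)
    fix i p and E :: "('r, 'm) module" assume E: "left_module R E" and ses: "short_exact R Z i E p B"
    show "\<exists>s. linear R B E s \<and> (\<forall>a \<in> carrier B. p (s a) = a)"
      by (rule short_exact_section[OF Z(1) E B ses linear_zero_fun[OF E Z(1)]]) (use Z(2) in auto)
  qed
qed

end

section \<open>An injective cogenerator\<close>

lemma frac_eqI:
  fixes a b :: rat
  assumes "a - b \<in> \<int>" shows "frac a = frac b"
proof -
  have "a - frac b = (a - b) + of_int \<lfloor>b\<rfloor>" by (simp add: frac_def)
  also have "\<dots> \<in> \<int>" using assms by (intro Ints_add) auto
  finally show ?thesis by (simp add: frac_unique_iff frac_ge_0 frac_lt_1)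
qed

lemma frac_diff_Ints: "frac a - (a :: rat) \<in> \<int>"
  by (simp add: frac_def)

lemma frac_frac_add: "frac (frac a + b) = frac (a + b :: rat)" "frac (a + frac b) = frac (a + b :: rat)"
  using frac_diff_Ints[of a] frac_diff_Ints[of b] by (auto intro!: frac_eqI)

lemma frac_frac_add_add: "frac (a + (frac b + c)) = frac (a + (b + c :: rat))" "frac (a + (b + frac c)) = frac (a + (b + c))"
  using frac_frac_add(2)[of "a + c" b] frac_frac_add(2)[of "a + b" c] by (simp_all add: ac_simps)

text \<open>Homomorphisms from subgroups of \<open>M\<close> to \<open>\<rat>/\<int>\<close>, represented by their preimages in
  \<open>M \<times> \<rat>\<close>, so that no arithmetic modulo \<open>\<int>\<close> is needed.\<close>

definition char_graph :: "('a, 'b) ring_scheme \<Rightarrow> ('a \<times> rat) set \<Rightarrow> bool" where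
  "char_graph M G \<longleftrightarrow> G \<subseteq> carrier M \<times> UNIV \<and>
     (\<forall>x a y b. (x, a) \<in> G \<longrightarrow> (y, b) \<in> G \<longrightarrow> (x \<ominus>\<^bsub>M\<^esub> y, a - b) \<in> G) \<and>
     (\<forall>a. (\<zero>\<^bsub>M\<^esub>, a) \<in> G \<longleftrightarrow> a \<in> \<int>)"

context abelian_group
begin

lemma char_graph_closed: "char_graph G H \<Longrightarrow> (x, a) \<in> H \<Longrightarrow> x \<in> carrier G"
  and char_graph_diff: "char_graph G H \<Longrightarrow> (x, a) \<in> H \<Longrightarrow> (y, b) \<in> H \<Longrightarrow> (x \<ominus> y, a - b) \<in> H"
  and char_graph_zero: "char_graph G H \<Longrightarrow> (\<zero>, a) \<in> H \<longleftrightarrow> a \<in> \<int>"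
  by (auto simp: char_graph_def)

lemma char_graph_add:
  assumes H: "char_graph G H" and "(x, a) \<in> H" "(y, b) \<in> H" shows "(x \<oplus> y, a + b) \<in> H"
proof -
  have "(\<zero> \<ominus> y, 0 - b) \<in> H" using assms by (intro char_graph_diff[OF H]) (simp_all add: char_graph_zero)
  from char_graph_diff[OF H assms(2) this] show ?thesis
    using char_graph_closed[OF H assms(2)] char_graph_closed[OF H assms(3)] by (simp add: a_minus_def)
qed

lemma char_graph_eq:
  assumes H: "char_graph G H" and "(x, a) \<in> H" "(x, b) \<in> H" shows "a - b \<in> \<int>"
  using char_graph_diff[OF assms] char_graph_closed[OF H assms(2)] char_graph_zero[OF H]
  by (simp add: a_minus_def r_neg)

lemma int_multiple_zero: "[(0 :: int)] \<cdot> x = \<zero>"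
  by (simp add: add_pow_def)

lemma char_graph_mult:
  assumes H: "char_graph G H" and x: "(x, a) \<in> H" shows "([(k :: int)] \<cdot> x, of_int k * a) \<in> H"
proof -
  have nat: "([(int n)] \<cdot> x, of_int (int n) * a) \<in> H" for n
  proof (induction n)
    case 0 then show ?case by (simp add: char_graph_zero[OF H] int_multiple_zero)
  next
    case (Suc n)
    have "[(int (Suc n))] \<cdot> x = [(int n)] \<cdot> x \<oplus> x"
      using add.int_pow_mult[of x "int n" 1] char_graph_closed[OF H x] by (simp add: add.int_pow_1 add.commute)
    with char_graph_add[OF H Suc x] show ?case by (simp add: algebra_simps)
  qed
  show ?thesis
  proof (cases "k \<ge> 0")
    case True with nat[of "nat k"] show ?thesis by simp
  next
    case False
    have "(\<zero> \<ominus> [(- k)] \<cdot> x, 0 - of_int (- k) * a) \<in> H"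
      using nat[of "nat (- k)"] False by (intro char_graph_diff[OF H]) (simp_all add: char_graph_zero[OF H])
    moreover have "\<zero> \<ominus> [(- k)] \<cdot> x = [k] \<cdot> x"
      using char_graph_closed[OF H x] add.int_pow_neg[of x k] by (simp add: a_minus_def)
    ultimately show ?thesis by simp
  qed
qed

text \<open>\<open>H'\<close> is generated by \<open>H\<close> and \<open>(x, c)\<close>. Assigning
  the value \<open>c\<close> to \<open>x\<close> can conflict with \<open>H\<close> only at
  multiples of \<open>x\<close> where \<open>H\<close> already has a value, and the assumption on
  \<open>c\<close> rules this out.\<close>

lemma char_graph_extend:
  assumes H: "char_graph G H" and x: "x \<in> carrier G"
    and c: "\<And>m b. ([(m :: int)] \<cdot> x, b) \<in> H \<Longrightarrow> b - of_int m * c \<in> \<int>"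
  obtains H' where "char_graph G H'" "H \<subseteq> H'" "(x, c) \<in> H'"
proof
  define H' where "H' = {(y \<oplus> [(m :: int)] \<cdot> x, a + of_int m * c) |y a m. (y, a) \<in> H}"
  have H'I: "(y \<oplus> [(m :: int)] \<cdot> x, a + of_int m * c) \<in> H'" if "(y, a) \<in> H" for y a m
    using that by (auto simp: H'_def)
  note [simp] = char_graph_closed[OF H] x add.int_pow_closed[OF x]
  show "H \<subseteq> H'"
  proof (rule subrelI)
    fix y a assume "(y, a) \<in> H"
    with H'I[OF this, of 0] show "(y, a) \<in> H'" by (simp add: int_multiple_zero)
  qed
  show "(x, c) \<in> H'" using H'I[of \<zero> 0 1] char_graph_zero[OF H] by (simp add: add.int_pow_1)
  have diff: "(u \<ominus> v, a - b) \<in> H'" if uv: "(u, a) \<in> H'" "(v, b) \<in> H'" for u v a b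
  proof -
    obtain y y' a' b' m m' where eq: "u = y \<oplus> [(m :: int)] \<cdot> x" "a = a' + of_int m * c" "(y, a') \<in> H"
        "v = y' \<oplus> [(m' :: int)] \<cdot> x" "b = b' + of_int m' * c" "(y', b') \<in> H"
      using uv unfolding H'_def by blast
    have "u \<ominus> v = (y \<ominus> y') \<oplus> [(m - m')] \<cdot> x"
      using eq by (simp add: a_minus_def minus_add a_ac add.int_pow_diff)
    moreover have "a - b = (a' - b') + of_int (m - m') * c" using eq by (simp add: algebra_simps)
    ultimately show ?thesis using H'I[OF char_graph_diff[OF H eq(3,6)], of "m - m'"] by simp
  qed
  have "a \<in> \<int>" if a: "(\<zero>, a) \<in> H'" for a
  proof -
    obtain y b m where eq: "\<zero> = y \<oplus> [(m :: int)] \<cdot> x" "a = b + of_int m * c" "(y, b) \<in> H"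
      using a unfolding H'_def by blast
    have y: "y \<in> carrier G" using eq by simp
    have "[m] \<cdot> x = \<ominus> y" using eq(1) y minus_equality[of "[m] \<cdot> x" y] by (simp add: a_comm)
    moreover have "(\<ominus> y, - b) \<in> H"
      using char_graph_diff[OF H _ eq(3), of \<zero> 0] y by (simp add: char_graph_zero[OF H] a_minus_def)
    ultimately have "- b - of_int m * c \<in> \<int>" using c by simp
    then have "- (- b - of_int m * c) \<in> \<int>" by (rule Ints_minus)
    then show ?thesis using eq(2) by (simp add: algebra_simps)
  qed
  moreover have "(\<zero>, a) \<in> H'" if "a \<in> \<int>" for a
    using that \<open>H \<subseteq> H'\<close> char_graph_zero[OF H] by blast
  moreover have "H' \<subseteq> carrier G \<times> UNIV" by (auto simp: H'_def)
  ultimately show "char_graph G H'" using diff unfolding char_graph_def by blast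
qed

text \<open>Divisibility of \<open>\<rat>/\<int>\<close>, in a form that also separates points. If
  some positive multiple of \<open>x\<close> is in the domain, let \<open>k\<close> be the least one
  and \<open>d\<close> a value at \<open>k x\<close>; then \<open>c = d / k\<close> works, because
  every \<open>m\<close> with \<open>m x\<close> in the domain is a multiple of \<open>k\<close>.
  Choosing \<open>c\<close> nonintegral for \<open>x\<close> outside the domain is what later yields
  a cogenerator.\<close>

lemma char_graph_value:
  assumes H: "char_graph G H" and x: "x \<in> carrier G"
  obtains c where "\<And>m b. ([(m :: int)] \<cdot> x, b) \<in> H \<Longrightarrow> b - of_int m * c \<in> \<int>" "x \<notin> Domain H \<Longrightarrow> c \<notin> \<int>"
proof (cases "\<exists>k > 0. \<exists>b. ([(int k)] \<cdot> x, b) \<in> H")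
  case False
  have m0: "m = 0" if m: "([(m :: int)] \<cdot> x, b) \<in> H" for m b
  proof (rule ccontr)
    assume "m \<noteq> 0"
    have "([(- m)] \<cdot> x, - b) \<in> H"
      using char_graph_mult[OF H m, of "-1"] x by (simp add: add.int_pow_pow)
    then have "([(int (nat \<bar>m\<bar>))] \<cdot> x, b) \<in> H \<or> ([(int (nat \<bar>m\<bar>))] \<cdot> x, - b) \<in> H"
      using m by (cases "m > 0") auto
    with False \<open>m \<noteq> 0\<close> show False by (metis nat_0_iff not_gr_zero abs_le_zero_iff)
  qed
  \<comment> \<open>Only \<open>m = 0\<close> constrains \<open>c\<close> here, so any nonintegral
    number would do.\<close>
  have "(1 / 2 :: rat) \<notin> \<int>" by (simp add: fraction_not_in_Ints)
  moreover have "b - of_int m * (1 / 2) \<in> \<int>" if "([(m :: int)] \<cdot> x, b) \<in> H" for m b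
    using that m0[OF that] char_graph_zero[OF H] by (simp add: int_multiple_zero)
  ultimately show ?thesis using that by blast
next
  case True
  define k where "k = (LEAST k. k > 0 \<and> (\<exists>b. ([(int k)] \<cdot> x, b) \<in> H))"
  have k: "k > 0" "\<exists>b. ([(int k)] \<cdot> x, b) \<in> H"
    using LeastI_ex[OF True[unfolded Bex_def]] by (auto simp: k_def)
  have min: "\<not> (\<exists>b. ([(int r)] \<cdot> x, b) \<in> H)" if "r > 0" "r < k" for r
    using not_less_Least[of r "\<lambda>k. k > 0 \<and> (\<exists>b. ([(int k)] \<cdot> x, b) \<in> H)"] that by (auto simp: k_def)
  obtain b0 where b0: "([(int k)] \<cdot> x, b0) \<in> H" using k by blast
  \<comment> \<open>For \<open>k = 1\<close> the element \<open>x\<close> is in the domain and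
    nothing is asked. Otherwise \<open>b0\<close> and \<open>b0 + 1\<close> are both values at
    \<open>k x\<close>, and their quotients by \<open>k\<close> differ by \<open>1 / k\<close>, so
    they are not both integers.\<close>
  have "\<exists>d. ([(int k)] \<cdot> x, d) \<in> H \<and> (x \<notin> Domain H \<longrightarrow> d / of_nat k \<notin> \<int>)"
  proof (cases "k = 1")
    case True then show ?thesis using b0 x by (auto simp: add.int_pow_1)
  next
    case False
    have b1: "([(int k)] \<cdot> x, b0 + 1) \<in> H"
      using char_graph_add[OF H b0, of \<zero> 1] x by (simp add: char_graph_zero[OF H] add.int_pow_closed)
    have "\<not> (b0 / of_nat k \<in> \<int> \<and> (b0 + 1) / of_nat k \<in> \<int>)"
    proof
      assume "b0 / of_nat k \<in> \<int> \<and> (b0 + 1) / of_nat k \<in> \<int>"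
      then have "(b0 + 1) / of_nat k - b0 / of_nat k \<in> \<int>" by (intro Ints_diff) auto
      then have "1 / of_nat k \<in> (\<int> :: rat set)" by (simp add: diff_divide_distrib[symmetric])
      then obtain z where z: "1 / of_nat k = (of_int z :: rat)" by (auto elim: Ints_cases)
      then have "of_int (z * int k) = (of_int 1 :: rat)" using k by (simp add: field_simps)
      then have "z * int k = 1" by (simp only: of_int_eq_iff)
      then show False using False k by (simp add: zmult_eq_1_iff)
    qed
    with b0 b1 show ?thesis by blast
  qed
  then obtain d where d: "([(int k)] \<cdot> x, d) \<in> H" "x \<notin> Domain H \<Longrightarrow> d / of_nat k \<notin> \<int>" by blast
  show ?thesis
  proof
    fix m b assume mb: "([(m :: int)] \<cdot> x, b) \<in> H"
    define q r where "q = m div int k" and "r = m mod int k"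
    have m: "m = int k * q + r" and r: "0 \<le> r" "r < int k" using k by (simp_all add: q_def r_def)
    have "([(int k * q)] \<cdot> x, of_int q * d) \<in> H"
      using char_graph_mult[OF H d(1), of q] x by (simp add: add.int_pow_pow)
    from char_graph_diff[OF H mb this] have *: "([r] \<cdot> x, b - of_int q * d) \<in> H"
      using x add.int_pow_diff[of x m "int k * q"] m by (simp add: a_minus_def)
    then have "r = 0" using min[of "nat r"] r by (cases "r = 0") auto
    with * have "b - of_int q * d \<in> \<int>" by (simp add: int_multiple_zero char_graph_zero[OF H])
    moreover have "of_int m * (d / of_nat k) = of_int q * d" using m \<open>r = 0\<close> k by simp
    ultimately show "b - of_int m * (d / of_nat k) \<in> \<int>" by simp
  qed (fact d(2))
qed

text \<open>Zorn's lemma gives a maximal graph above \<open>H\<close>. It is defined everywhere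
  since otherwise it could be extended, and its values are determined modulo \<open>\<int>\<close>,
  so their fractional parts give a function. Thus \<open>\<rat>/\<int>\<close> is injective as an
  abelian group.\<close>

lemma character_exists:
  assumes H: "char_graph G H"
  obtains \<chi> :: "'a \<Rightarrow> rat" where "\<And>x. x \<in> carrier G \<Longrightarrow> 0 \<le> \<chi> x \<and> \<chi> x < 1"
    "\<And>x y. x \<in> carrier G \<Longrightarrow> y \<in> carrier G \<Longrightarrow> \<chi> (x \<oplus> y) = frac (\<chi> x + \<chi> y)"
    "\<And>x a. (x, a) \<in> H \<Longrightarrow> \<chi> x = frac a"
proof -
  have "\<exists>U \<in> {H'. char_graph G H' \<and> H \<subseteq> H'}. \<forall>X \<in> {H'. char_graph G H' \<and> H \<subseteq> H'}. U \<subseteq> X \<longrightarrow> X = U"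
  proof (rule subset_Zorn_nonempty)
    show "{H'. char_graph G H' \<and> H \<subseteq> H'} \<noteq> {}" using H by blast
  next
    fix \<C> assume ne: "\<C> \<noteq> {}" and chain: "subset.chain {H'. char_graph G H' \<and> H \<subseteq> H'} \<C>"
    have mem: "char_graph G K" "H \<subseteq> K" if "K \<in> \<C>" for K
      using chain that by (auto simp: subset.chain_def)
    have "char_graph G (\<Union>\<C>)"
      unfolding char_graph_def
    proof (intro conjI allI impI)
      show "\<Union>\<C> \<subseteq> carrier G \<times> UNIV" using char_graph_closed[OF mem(1)] by auto
      show "(\<zero>, a) \<in> \<Union>\<C> \<longleftrightarrow> a \<in> \<int>" for a using char_graph_zero[OF mem(1)] ne by auto
      fix x a y b assume "(x, a) \<in> \<Union>\<C>" "(y, b) \<in> \<Union>\<C>"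
      then obtain K L where KL: "K \<in> \<C>" "(x, a) \<in> K" "L \<in> \<C>" "(y, b) \<in> L" by blast
      then have "K \<subseteq> L \<or> L \<subseteq> K" using chain unfolding subset_chain_def by blast
      then show "(x \<ominus> y, a - b) \<in> \<Union>\<C>"
        using KL mem(1) by (meson UnionI char_graph_diff subsetD)
    qed
    then show "\<Union>\<C> \<in> {H'. char_graph G H' \<and> H \<subseteq> H'}" using ne mem by blast
  qed
  then obtain U where U0: "U \<in> {H'. char_graph G H' \<and> H \<subseteq> H'}"
    "\<forall>X \<in> {H'. char_graph G H' \<and> H \<subseteq> H'}. U \<subseteq> X \<longrightarrow> X = U" by (rule bexE)
  then have U: "char_graph G U" "H \<subseteq> U" by simp_all
  have maximal: "X = U" if "char_graph G X" "U \<subseteq> X" for X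
    using U0(2) that U(2) by (metis (no_types, lifting) mem_Collect_eq subset_trans)
  have dom: "\<exists>a. (x, a) \<in> U" if x: "x \<in> carrier G" for x
  proof -
    obtain c where c: "\<And>m b. ([(m :: int)] \<cdot> x, b) \<in> U \<Longrightarrow> b - of_int m * c \<in> \<int>"
      using char_graph_value[OF U(1) x] by blast
    obtain X where "char_graph G X" "U \<subseteq> X" "(x, c) \<in> X"
      using char_graph_extend[OF U(1) x c] by blast
    then show ?thesis using maximal by blast
  qed
  define \<chi> where "\<chi> x = frac (SOME a. (x, a) \<in> U)" for x
  have \<chi>: "\<chi> x = frac a" if "(x, a) \<in> U" for x a
    unfolding \<chi>_def using char_graph_eq[OF U(1) someI[of "\<lambda>a. (x, a) \<in> U", OF that] that] by (rule frac_eqI)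
  show ?thesis
  proof
    show "0 \<le> \<chi> x \<and> \<chi> x < 1" for x by (simp add: \<chi>_def frac_ge_0 frac_lt_1)
    show "\<chi> x = frac a" if "(x, a) \<in> H" for x a using \<chi> U(2) that by blast
    show "\<chi> (x \<oplus> y) = frac (\<chi> x + \<chi> y)" if xy: "x \<in> carrier G" "y \<in> carrier G" for x y
    proof -
      obtain a b where ab: "(x, a) \<in> U" "(y, b) \<in> U" using dom xy by blast
      from \<chi>[OF char_graph_add[OF U(1) this]] show ?thesis by (simp add: \<chi>[OF ab(1)] \<chi>[OF ab(2)] frac_frac_add)
    qed
  qed
qed

end

text \<open>The character module \<open>Hom\<^sub>\<int>(R, \<rat>/\<int>)\<close>, with
  \<open>\<rat>/\<int>\<close> modelled by the rationals in \<open>[0, 1)\<close> and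
  \<open>frac\<close> applied after each addition. Right multiplication inside the argument makes
  the action a left one.\<close>

definition char_module :: "('r, 'e) ring_scheme \<Rightarrow> ('r, 'r \<Rightarrow> rat) module" where
  "char_module R = \<lparr>carrier = {\<phi> \<in> carrier R \<rightarrow>\<^sub>E {0..<1}.
       \<forall>x \<in> carrier R. \<forall>y \<in> carrier R. \<phi> (x \<oplus>\<^bsub>R\<^esub> y) = frac (\<phi> x + \<phi> y)},
     mult = undefined, one = undefined, zero = (\<lambda>x \<in> carrier R. 0),
     add = (\<lambda>\<phi> \<psi>. \<lambda>x \<in> carrier R. frac (\<phi> x + \<psi> x)), smult = (\<lambda>a \<phi>. \<lambda>x \<in> carrier R. \<phi> (x \<otimes>\<^bsub>R\<^esub> a))\<rparr>"

context ring
begin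

lemma char_module_carrier: "\<phi> \<in> carrier (char_module R) \<longleftrightarrow> \<phi> \<in> extensional (carrier R) \<and>
    (\<forall>x \<in> carrier R. 0 \<le> \<phi> x \<and> \<phi> x < 1) \<and> (\<forall>x \<in> carrier R. \<forall>y \<in> carrier R. \<phi> (x \<oplus> y) = frac (\<phi> x + \<phi> y))"
  by (auto simp: char_module_def PiE_def)

lemma char_module_eqI:
  assumes "\<phi> \<in> extensional (carrier R)" "\<psi> \<in> extensional (carrier R)" "\<And>x. x \<in> carrier R \<Longrightarrow> \<phi> x = \<psi> x"
  shows "\<phi> = (\<psi> :: 'a \<Rightarrow> rat)"
  using assms by (rule extensionalityI)

lemma char_module_simps:
  "\<zero>\<^bsub>char_module R\<^esub> = (\<lambda>x \<in> carrier R. 0)"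
  "\<phi> \<oplus>\<^bsub>char_module R\<^esub> \<psi> = (\<lambda>x \<in> carrier R. frac (\<phi> x + \<psi> x))"
  "a \<odot>\<^bsub>char_module R\<^esub> \<phi> = (\<lambda>x \<in> carrier R. \<phi> (x \<otimes> a))"
  by (simp_all add: char_module_def)

lemma left_module_char_module: "left_module R (char_module R)"
proof (rule left_moduleI[OF ring_axioms])
  let ?H = "char_module R"
  note [simp] = char_module_carrier char_module_simps frac_ge_0 frac_lt_1 frac_frac_add frac_frac_add_add
  have frac_id: "frac (\<phi> x) = \<phi> x" if "\<phi> \<in> carrier (?H)" "x \<in> carrier R" for \<phi> x
    using that by (simp add: frac_eq)
  show "\<zero>\<^bsub>?H\<^esub> \<in> carrier (?H)" by simp
  show "\<phi> \<oplus>\<^bsub>?H\<^esub> \<psi> \<in> carrier (?H)"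
    if "\<phi> \<in> carrier (?H)" "\<psi> \<in> carrier (?H)" for \<phi> \<psi>
    using that by (simp add: ac_simps)
  show "\<phi> \<oplus>\<^bsub>?H\<^esub> \<psi> \<oplus>\<^bsub>?H\<^esub> \<xi> = \<phi> \<oplus>\<^bsub>?H\<^esub> (\<psi> \<oplus>\<^bsub>?H\<^esub> \<xi>)" for \<phi> \<psi> \<xi>
    by (rule char_module_eqI) (simp_all add: ac_simps)
  show "\<phi> \<oplus>\<^bsub>?H\<^esub> \<psi> = \<psi> \<oplus>\<^bsub>?H\<^esub> \<phi>" for \<phi> \<psi>
    by (rule char_module_eqI) (simp_all add: ac_simps)
  show "\<zero>\<^bsub>?H\<^esub> \<oplus>\<^bsub>?H\<^esub> \<phi> = \<phi>" if "\<phi> \<in> carrier (?H)" for \<phi>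
    using that by (intro char_module_eqI) (simp_all add: frac_eq)
  show "\<exists>\<psi> \<in> carrier (?H). \<psi> \<oplus>\<^bsub>?H\<^esub> \<phi> = \<zero>\<^bsub>?H\<^esub>"
    if \<phi>: "\<phi> \<in> carrier (?H)" for \<phi>
  proof (rule bexI)
    let ?\<psi> = "\<lambda>x \<in> carrier R. frac (- \<phi> x)"
    show "?\<psi> \<oplus>\<^bsub>?H\<^esub> \<phi> = \<zero>\<^bsub>?H\<^esub>" by (rule char_module_eqI) simp_all
    have "frac (- frac a) = frac (- a)" for a :: rat by (rule frac_eqI) (simp add: frac_def)
    moreover have "frac (frac a - b) = frac (a - b)" for a b :: rat by (rule frac_eqI) (simp add: frac_def)
    ultimately show "?\<psi> \<in> carrier (?H)" using \<phi> by (simp add: ac_simps)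
  qed
  show "a \<odot>\<^bsub>?H\<^esub> \<phi> \<in> carrier (?H)" if "a \<in> carrier R" "\<phi> \<in> carrier (?H)" for a \<phi>
    using that by (simp add: l_distr)
  show "(a \<oplus> b) \<odot>\<^bsub>?H\<^esub> \<phi> = a \<odot>\<^bsub>?H\<^esub> \<phi> \<oplus>\<^bsub>?H\<^esub> b \<odot>\<^bsub>?H\<^esub> \<phi>"
    if "a \<in> carrier R" "b \<in> carrier R" "\<phi> \<in> carrier (?H)" for a b \<phi>
    using that by (intro char_module_eqI) (simp_all add: r_distr)
  show "a \<odot>\<^bsub>?H\<^esub> (\<phi> \<oplus>\<^bsub>?H\<^esub> \<psi>) = a \<odot>\<^bsub>?H\<^esub> \<phi> \<oplus>\<^bsub>?H\<^esub> a \<odot>\<^bsub>?H\<^esub> \<psi>"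
    if "a \<in> carrier R" for a \<phi> \<psi>
    using that by (intro char_module_eqI) simp_all
  show "(a \<otimes> b) \<odot>\<^bsub>?H\<^esub> \<phi> = a \<odot>\<^bsub>?H\<^esub> (b \<odot>\<^bsub>?H\<^esub> \<phi>)"
    if "a \<in> carrier R" "b \<in> carrier R" for a b \<phi>
    using that by (intro char_module_eqI) (simp_all add: m_assoc)
  show "\<one> \<odot>\<^bsub>?H\<^esub> \<phi> = \<phi>" if "\<phi> \<in> carrier (?H)" for \<phi>
    using that by (intro char_module_eqI) simp_all
qed

text \<open>One direction of the adjunction between characters of the group \<open>M\<close> and
  linear maps from \<open>M\<close> to \<open>char_module R\<close>; the inverse is evaluation at
  \<open>\<one>\<close>.\<close>

lemma character_linear:
  assumes M: "left_module R M" and range: "\<And>x. x \<in> carrier M \<Longrightarrow> 0 \<le> \<chi> x \<and> \<chi> x < (1 :: rat)"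
    and add: "\<And>x y. x \<in> carrier M \<Longrightarrow> y \<in> carrier M \<Longrightarrow> \<chi> (x \<oplus>\<^bsub>M\<^esub> y) = frac (\<chi> x + \<chi> y)"
  shows "linear R M (char_module R) (\<lambda>x. \<lambda>s \<in> carrier R. \<chi> (s \<odot>\<^bsub>M\<^esub> x))"
proof -
  interpret M: left_module R M by fact
  show ?thesis
    by (rule linearI)
     (auto intro!: char_module_eqI simp: char_module_carrier char_module_simps range add M.smult_closed
        M.smult_l_distr M.smult_r_distr M.smult_assoc1)
qed

text \<open>By the adjunction, \<open>f\<close> is the same as the character sending
  \<open>a\<close> to \<open>f a \<one>\<close>. This is carried to the image of \<open>i\<close>,
  extended to all of \<open>E\<close>, and turned back into a linear map.\<close>

lemma char_module_injective:
  assumes A: "left_module R A" and E: "left_module R E" and i: "linear R A E i" "inj_on i (carrier A)"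
    and f: "linear R A (char_module R) f"
  obtains g where "linear R E (char_module R) g" "\<And>a. a \<in> carrier A \<Longrightarrow> g (i a) = f a"
proof -
  interpret A: left_module R A by fact
  interpret E: left_module R E by fact
  note H = left_module_char_module
  have fa: "f a \<in> carrier (char_module R)" if "a \<in> carrier A" for a using that by (rule linear_closed[OF f])
  \<comment> \<open>All representatives modulo \<open>\<int>\<close> are included, as
    \<open>char_graph\<close> requires; injectivity of \<open>i\<close> makes the fibre over zero
    exactly \<open>\<int>\<close>.\<close>
  define G where "G = {(i a, f a \<one> + of_int z) |a z. a \<in> carrier A}"
  have GI: "(i a, f a \<one> + c) \<in> G" if "a \<in> carrier A" "c \<in> \<int>" for a c
    using that by (auto simp: G_def elim!: Ints_cases)
  have G: "char_graph E G"
    unfolding char_graph_def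
  proof (intro conjI allI impI)
    show "G \<subseteq> carrier E \<times> UNIV" by (auto simp: G_def linear_closed[OF i(1)])
    fix x a y b assume "(x, a) \<in> G" "(y, b) \<in> G"
    then obtain u v z w where eq: "x = i u" "a = f u \<one> + of_int z" "u \<in> carrier A" "y = i v" "b = f v \<one> + of_int w" "v \<in> carrier A"
      unfolding G_def by blast
    have "f u = f (u \<ominus>\<^bsub>A\<^esub> v) \<oplus>\<^bsub>char_module R\<^esub> f v"
      using eq linear_add[OF f, of "u \<ominus>\<^bsub>A\<^esub> v" v] by (simp add: a_minus_def A.a_assoc A.l_neg)
    then have "f u \<one> = frac (f (u \<ominus>\<^bsub>A\<^esub> v) \<one> + f v \<one>)" by (simp add: char_module_simps)
    then have "f u \<one> - (f (u \<ominus>\<^bsub>A\<^esub> v) \<one> + f v \<one>) \<in> \<int>" by (simp add: frac_diff_Ints)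
    then have "f u \<one> - (f (u \<ominus>\<^bsub>A\<^esub> v) \<one> + f v \<one>) + of_int (z - w) \<in> \<int>" by (rule Ints_add) simp
    from GI[OF _ this, of "u \<ominus>\<^bsub>A\<^esub> v"] show "(x \<ominus>\<^bsub>E\<^esub> y, a - b) \<in> G"
      using eq by (simp add: linear_diff[OF A E i(1)] algebra_simps)
  next
    fix a
    have f0: "f \<zero>\<^bsub>A\<^esub> \<one> = 0" by (simp add: linear_zero[OF A H f] char_module_simps)
    show "(\<zero>\<^bsub>E\<^esub>, a) \<in> G \<longleftrightarrow> a \<in> \<int>"
    proof
      assume "(\<zero>\<^bsub>E\<^esub>, a) \<in> G"
      then obtain u z where u: "i u = i \<zero>\<^bsub>A\<^esub>" "a = f u \<one> + of_int z" "u \<in> carrier A"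
        unfolding G_def linear_zero[OF A E i(1)] by auto
      then have "u = \<zero>\<^bsub>A\<^esub>" using i(2) by (simp add: inj_on_eq_iff)
      then show "a \<in> \<int>" using u f0 by simp
    qed (use GI[of "\<zero>\<^bsub>A\<^esub>" a] f0 in \<open>simp add: linear_zero[OF A E i(1)]\<close>)
  qed
  obtain \<chi> :: "_ \<Rightarrow> rat" where \<chi>: "\<And>x. x \<in> carrier E \<Longrightarrow> 0 \<le> \<chi> x \<and> \<chi> x < 1"
    "\<And>x y. x \<in> carrier E \<Longrightarrow> y \<in> carrier E \<Longrightarrow> \<chi> (x \<oplus>\<^bsub>E\<^esub> y) = frac (\<chi> x + \<chi> y)"
    "\<And>x a. (x, a) \<in> G \<Longrightarrow> \<chi> x = frac a"
    by (rule E.character_exists[OF G], rule that)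
  have \<chi>i: "\<chi> (i a) = f a \<one>" if "a \<in> carrier A" for a
    using \<chi>(3)[OF GI[of a 0]] fa[OF that] that by (simp add: char_module_carrier frac_eq)
  show ?thesis
  proof
    show "linear R E (char_module R) (\<lambda>x. \<lambda>s \<in> carrier R. \<chi> (s \<odot>\<^bsub>E\<^esub> x))"
      by (rule character_linear[of E \<chi>, OF E \<chi>(1,2)])
    show "(\<lambda>s \<in> carrier R. \<chi> (s \<odot>\<^bsub>E\<^esub> i a)) = f a" if a: "a \<in> carrier A" for a
    proof (rule char_module_eqI)
      \<comment> \<open>The computation is \<open>\<chi> (s (i a)) = \<chi> (i (s a)) = f (s a)
        \<one> = (s (f a)) \<one> = f a s\<close>.\<close>
      fix s assume s: "s \<in> carrier R"
      then show "(\<lambda>s \<in> carrier R. \<chi> (s \<odot>\<^bsub>E\<^esub> i a)) s = f a s"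
        using a \<chi>i[of "s \<odot>\<^bsub>A\<^esub> a"]
        by (simp add: linear_smult[OF i(1), symmetric] A.smult_closed linear_smult[OF f] char_module_simps)
    qed (use fa[OF a] in \<open>simp_all add: char_module_carrier\<close>)
  qed
qed

text \<open>Start from the zero character on \<open>K\<close>, give \<open>x\<close> a nonintegral
  value, which is possible as \<open>x\<close> is outside \<open>K\<close>, and extend to
  \<open>M\<close>. The associated linear map vanishes on \<open>K\<close> since \<open>K\<close> is
  a submodule, and at \<open>x\<close> it is nonzero when evaluated at
  \<open>\<one>\<close>.\<close>

lemma char_module_separates:
  assumes M: "left_module R M" and K: "left_module R (M\<lparr>carrier := K\<rparr>)" "K \<subseteq> carrier M"
    and x: "x \<in> carrier M" "x \<notin> K"
  obtains f where "linear R M (char_module R) f" "\<And>k. k \<in> K \<Longrightarrow> f k = \<zero>\<^bsub>char_module R\<^esub>"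
    "f x \<noteq> \<zero>\<^bsub>char_module R\<^esub>"
proof -
  interpret M: left_module R M by fact
  interpret K: left_module R "M\<lparr>carrier := K\<rparr>" by fact
  have incl: "linear R (M\<lparr>carrier := K\<rparr>) M (\<lambda>x. x)" using K(2) by (auto simp: linear_def)
  have diff: "u \<ominus>\<^bsub>M\<^esub> v \<in> K" if "u \<in> K" "v \<in> K" for u v
    using that K.minus_closed[of u v] linear_diff[OF K(1) M incl, of u v] by simp
  have smult: "a \<odot>\<^bsub>M\<^esub> u \<in> K" if "a \<in> carrier R" "u \<in> K" for a u
    using that K.smult_closed[of a u] by simp
  have H: "char_graph M (K \<times> \<int>)"
    using K(2) K.zero_closed diff by (auto simp: char_graph_def)
  obtain c :: rat where c: "\<And>m b. (add_pow M (m :: int) x, b) \<in> K \<times> \<int> \<Longrightarrow> b - of_int m * c \<in> \<int>"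
    "x \<notin> Domain (K \<times> (\<int> :: rat set)) \<Longrightarrow> c \<notin> \<int>"
    using M.char_graph_value[OF H x(1)] by blast
  obtain G where G: "char_graph M G" "K \<times> \<int> \<subseteq> G" "(x, c) \<in> G"
    using M.char_graph_extend[OF H x(1) c(1)] by blast
  obtain \<chi> :: "_ \<Rightarrow> rat" where \<chi>: "\<And>x. x \<in> carrier M \<Longrightarrow> 0 \<le> \<chi> x \<and> \<chi> x < 1"
    "\<And>x y. x \<in> carrier M \<Longrightarrow> y \<in> carrier M \<Longrightarrow> \<chi> (x \<oplus>\<^bsub>M\<^esub> y) = frac (\<chi> x + \<chi> y)"
    "\<And>x a. (x, a) \<in> G \<Longrightarrow> \<chi> x = frac a"
    by (rule M.character_exists[OF G(1)], rule that)
  have K0: "\<chi> k = 0" if "k \<in> K" for k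
    using \<chi>(3)[OF subsetD[OF G(2)], of k 0] that by simp
  have "c \<notin> \<int>" using c(2) x(2) by auto
  then have "\<chi> x \<noteq> 0" using \<chi>(3)[OF G(3)] by (simp add: frac_eq_0_iff)
  show ?thesis
  proof
    let ?f = "\<lambda>x. \<lambda>s \<in> carrier R. \<chi> (s \<odot>\<^bsub>M\<^esub> x)"
    show "linear R M (char_module R) ?f" by (rule character_linear[of M \<chi>, OF M \<chi>(1,2)])
    show "?f k = \<zero>\<^bsub>char_module R\<^esub>" if "k \<in> K" for k
      using that by (simp add: char_module_simps K0 smult cong: restrict_cong)
    have "?f x \<one> \<noteq> \<zero>\<^bsub>char_module R\<^esub> \<one>"
      using \<open>\<chi> x \<noteq> 0\<close> by (simp add: char_module_simps M.smult_one[OF x(1)])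
    then show "?f x \<noteq> \<zero>\<^bsub>char_module R\<^esub>" by metis
  qed
qed

end

text \<open>The character module is transported into \<open>'m\<close>. Injectivity extends the
  identity of the copy along \<open>i\<close>, giving a retraction of any extension, which therefore
  splits.\<close>

lemma (in module_universe) injective_cogenerator:
  assumes univ: "universe_for R TYPE('m)"
  obtains I :: "('r, 'm) module" where "left_module R I" "\<And>A :: ('r, 'm) module. left_module R A \<Longrightarrow> Ext1_vanishes (LMod R) A I"
    "\<And>(M :: ('r, 'm) module) K x. left_module R M \<Longrightarrow> left_module R (M\<lparr>carrier := K\<rparr>) \<Longrightarrow> K \<subseteq> carrier M \<Longrightarrow>
       x \<in> carrier M \<Longrightarrow> x \<notin> K \<Longrightarrow> \<exists>f. linear R M I f \<and> (\<forall>k \<in> K. f k = \<zero>\<^bsub>I\<^esub>) \<and> f x \<noteq> \<zero>\<^bsub>I\<^esub>"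
proof -
  obtain h :: "('r \<Rightarrow> nat) \<Rightarrow> 'm" where h: "inj_on h (carrier R \<rightarrow>\<^sub>E UNIV)"
    using univ by (auto simp: universe_for_def lepoll_def)
  \<comment> \<open>Rationals are countable, so a character can be coded as a function from
    \<open>carrier R\<close> to the naturals; this is the reason for the cardinal in
    \<open>universe_for\<close>.\<close>
  define j where "j \<phi> = h (\<lambda>s \<in> carrier R. to_nat (\<phi> s :: rat))" for \<phi>
  have "inj_on j (carrier (char_module R))"
  proof (rule inj_onI)
    fix \<phi> \<psi> assume \<phi>: "\<phi> \<in> carrier (char_module R)" "\<psi> \<in> carrier (char_module R)" "j \<phi> = j \<psi>"
    then have "(\<lambda>s \<in> carrier R. to_nat (\<phi> s)) = (\<lambda>s \<in> carrier R. to_nat (\<psi> s))"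
      using h unfolding j_def by (auto dest!: inj_onD)
    then have "\<phi> s = \<psi> s" if "s \<in> carrier R" for s using that by (metis inj_to_nat injD restrict_apply')
    then show "\<phi> = \<psi>" using \<phi> by (intro char_module_eqI) (auto simp: char_module_carrier)
  qed
  note j = inj_image_module[OF left_module_char_module this]
  let ?I = "image_module j (char_module R)"
  note j_inv = linear_inv_into[OF left_module_char_module j(2,3)]
  show ?thesis
  proof (rule that[OF j(1)])
    fix A :: "('r, 'm) module" assume A: "left_module R A"
    show "Ext1_vanishes (LMod R) A ?I"
      unfolding LMod_Ext1_vanishes_iff[OF A j(1)]
    proof (intro allI impI)
      fix i p and E :: "('r, 'm) module" assume E: "left_module R E" and ses: "short_exact R ?I i E p A"
      obtain g where g: "linear R E (char_module R) g"
        "\<And>a. a \<in> carrier ?I \<Longrightarrow> g (i a) = inv_into (carrier (char_module R)) j a"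
        by (rule char_module_injective[OF j(1) E _ _ j_inv, of i]) (use ses in \<open>auto simp: short_exact_def\<close>)
      have "j (g (i a)) = a" if "a \<in> carrier ?I" for a
        using that j(3) by (simp add: g(2) bij_betw_inv_into_right)
      with linear_comp[OF g(1) j(2)] show "\<exists>s. linear R A E s \<and> (\<forall>a \<in> carrier A. p (s a) = a)"
        using short_exact_section[OF j(1) E A ses, of "\<lambda>x. j (g x)"] by metis
    qed
  next
    fix M :: "('r, 'm) module" and K x
    assume M: "left_module R M" "left_module R (M\<lparr>carrier := K\<rparr>)" "K \<subseteq> carrier M" "x \<in> carrier M" "x \<notin> K"
    obtain f where f: "linear R M (char_module R) f" "\<And>k. k \<in> K \<Longrightarrow> f k = \<zero>\<^bsub>char_module R\<^esub>"
      "f x \<noteq> \<zero>\<^bsub>char_module R\<^esub>"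
      using char_module_separates[OF M] by blast
    have zero: "j \<zero>\<^bsub>char_module R\<^esub> = \<zero>\<^bsub>?I\<^esub>" by (rule linear_zero[OF left_module_char_module j(1,2)])
    have "j (f x) \<noteq> j \<zero>\<^bsub>char_module R\<^esub>"
      using f(3) j(3) linear_closed[OF f(1) M(4)] left_module_zero[OF left_module_char_module]
      by (auto simp: bij_betw_def inj_on_eq_iff)
    then show "\<exists>f. linear R M ?I f \<and> (\<forall>k \<in> K. f k = \<zero>\<^bsub>?I\<^esub>) \<and> f x \<noteq> \<zero>\<^bsub>?I\<^esub>"
      using linear_comp[OF f(1) j(2)] f(2) zero by (intro exI[of _ "\<lambda>x. j (f x)"]) simp
  qed
qed

section \<open>Exact, elementary and shifted complexes\<close>

lemma linear_image_subgroup: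
  assumes M: "left_module R M" and N: "left_module R N" and f: "linear R M N f"
  shows "subgroup (f ` carrier M) (add_monoid N)"
proof -
  interpret M: left_module R M by fact
  interpret N: left_module R N by fact
  have "inv\<^bsub>add_monoid N\<^esub> (f x) = f (\<ominus>\<^bsub>M\<^esub> x)" if "x \<in> carrier M" for x
    using that linear_minus[OF M N f, of x] by (simp add: a_inv_def)
  then show ?thesis
    by (intro group.subgroupI[OF N.a_group])
      (auto simp: linear_closed[OF f] linear_add[OF f, symmetric] intro: M.zero_closed)
qed

lemma cycles_eq: "cycles C n = (component C n)\<lparr>carrier := {x \<in> elems C n.
    diff C n x = \<zero>\<^bsub>component C (n - 1)\<^esub>}\<rparr>"
  by (simp add: cycles_def a_kernel_def kernel_def)

lemma cycles_simps [simp]: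
  "x \<in> carrier (cycles C n) \<longleftrightarrow> x \<in> elems C n \<and> diff C n x = \<zero>\<^bsub>component C (n - 1)\<^esub>"
  "\<zero>\<^bsub>cycles C n\<^esub> = \<zero>\<^bsub>component C n\<^esub>"
  by (simp_all add: cycles_eq)

lemma left_module_cycles:
  assumes C: "chain_complex R C" shows "left_module R (cycles C n)"
  unfolding cycles_eq using left_module_kernel[OF _ _ diff_linear[OF C]] complex_module[OF C] by blast

lemma diff_linear_cycles:
  assumes C: "chain_complex R C"
  shows "linear R (component C n) (cycles C (n - 1)) (diff C n)"
  using diff_linear[OF C, of n] diff_diff[OF C, of _ n]
  by (auto simp: linear_def cycles_eq)

text \<open>The homology group is a set of cosets whose neutral element is the boundary group
  itself, so it is trivial iff every cycle has that coset, that is, is a boundary.\<close>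

lemma exact_complex_iff:
  assumes C: "chain_complex R C"
  shows "exact_complex R C \<longleftrightarrow> (\<forall>n. \<forall>x \<in> elems C n. diff C n x = \<zero>\<^bsub>component C (n - 1)\<^esub> \<longrightarrow>
      x \<in> diff C (n + 1) ` elems C (n + 1))"
proof -
  have "trivial_group (homology C n) \<longleftrightarrow> (\<forall>x \<in> elems C n. diff C n x = \<zero>\<^bsub>component C (n - 1)\<^esub> \<longrightarrow>
      x \<in> diff C (n + 1) ` elems C (n + 1))" for n
  proof -
    let ?Z = "add_monoid (cycles C n)" and ?B = "boundaries C n"
    interpret Z: left_module R "cycles C n" by (rule left_module_cycles[OF C])
    have sub: "subgroup ?B ?Z"
      using linear_image_subgroup[OF complex_module[OF C] left_module_cycles[OF C]
          diff_linear_cycles[OF C, of "n + 1"]]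
      by (simp add: boundaries_def)
    then have norm: "?B \<lhd> ?Z" by (rule Z.a_comm_group[THEN comm_group.normal_iff_subgroup, THEN iffD2])
    have "group (homology C n)"
      using normal.factorgroup_is_group[OF norm] by (simp add: homology_def A_FactGroup_def)
    moreover have "carrier (homology C n) = rcosets\<^bsub>?Z\<^esub> ?B" "one (homology C n) = ?B"
      by (simp_all add: homology_def A_FactGroup_def FactGroup_def)
    moreover have "rcosets\<^bsub>?Z\<^esub> ?B = {?B} \<longleftrightarrow> carrier (cycles C n) \<subseteq> ?B"
    proof
      assume *: "rcosets\<^bsub>?Z\<^esub> ?B = {?B}"
      show "carrier (cycles C n) \<subseteq> ?B"
      proof
        fix x assume x: "x \<in> carrier (cycles C n)"
        then have "?B #>\<^bsub>?Z\<^esub> x \<in> rcosets\<^bsub>?Z\<^esub> ?B" by (auto simp: RCOSETS_def)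
        moreover have "x \<in> ?B #>\<^bsub>?Z\<^esub> x" using group.rcos_self[OF Z.a_group _ sub] x by simp
        ultimately show "x \<in> ?B" using * by auto
      qed
    next
      assume *: "carrier (cycles C n) \<subseteq> ?B"
      have "?B #>\<^bsub>?Z\<^esub> x = ?B" if "x \<in> carrier (cycles C n)" for x
        using group.coset_join2[OF Z.a_group _ sub] that * by auto
      then show "rcosets\<^bsub>?Z\<^esub> ?B = {?B}" using Z.zero_closed unfolding RCOSETS_def by auto
    qed
    ultimately show ?thesis by (auto simp: trivial_group_def boundaries_def)
  qed
  then show ?thesis using C by (simp add: exact_complex_def)
qed

lemma exact_complexD:
  assumes "exact_complex R C" "x \<in> elems C n" "diff C n x = \<zero>\<^bsub>component C (n - 1)\<^esub>"
  obtains y where "y \<in> elems C (n + 1)" "x = diff C (n + 1) y"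
proof -
  have "chain_complex R C" using assms(1) by (simp add: exact_complex_def)
  then show ?thesis using assms that exact_complex_iff by blast
qed

lemma short_exact_cycles:
  assumes ex: "exact_complex R C"
  shows "short_exact R (cycles C n) (\<lambda>x. x) (component C n) (diff C n) (cycles C (n - 1))"
proof -
  have C: "chain_complex R C" using ex by (simp add: exact_complex_def)
  have "carrier (cycles C (n - 1)) = diff C n ` elems C n"
  proof (intro equalityI subsetI)
    fix x assume "x \<in> carrier (cycles C (n - 1))"
    then obtain y where "y \<in> elems C (n - 1 + 1)" "x = diff C (n - 1 + 1) y"
      using exact_complexD[OF ex, of x "n - 1"] by auto
    then show "x \<in> diff C n ` elems C n" by simp
  qed (use linear_closed[OF diff_linear_cycles[OF C]] in blast)
  from short_exact_kernel[OF diff_linear[OF C] this] show ?thesis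
    by (simp add: cycles_eq)
qed

text \<open>The components are \<open>M\<close> in the degrees in \<open>S\<close>, and \<open>T\<close> is the set of degrees in which the differential
  is the identity. The zero components keep the operations of \<open>M\<close>, so no zero module has to be chosen.\<close>

definition elementary_complex :: "('r, 'm) module \<Rightarrow> int set \<Rightarrow> int set \<Rightarrow> ('r, 'm) complex_data" where
  "elementary_complex M S T = make_complex (\<lambda>n. M\<lparr>carrier := if n \<in> S then carrier M else {\<zero>\<^bsub>M\<^esub>}\<rparr>)
     (\<lambda>n x. if n \<in> T then x else \<zero>\<^bsub>M\<^esub>)"

abbreviation disk :: "int \<Rightarrow> ('r, 'm) module \<Rightarrow> ('r, 'm) complex_data" where
  "disk n M \<equiv> elementary_complex M {n, n - 1} {n}"

abbreviation sphere :: "int \<Rightarrow> ('r, 'm) module \<Rightarrow> ('r, 'm) complex_data" where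
  "sphere n M \<equiv> elementary_complex M {n} {}"

lemma left_module_zero_submodule:
  assumes M: "left_module R M" shows "left_module R (M\<lparr>carrier := {\<zero>\<^bsub>M\<^esub>}\<rparr>)"
proof -
  interpret M: left_module R M by fact
  show ?thesis by (intro left_module_submodule[OF M]) (auto simp: M.smult_zero M.uminus_zero)
qed

lemma elementary_complex_component:
  "component (elementary_complex M S T) n = (if n \<in> S then M else M\<lparr>carrier := {\<zero>\<^bsub>M\<^esub>}\<rparr>)"
  by (simp add: elementary_complex_def)

lemma elementary_complex_diff:
  "x \<in> elems (elementary_complex M S T) n \<Longrightarrow>
    diff (elementary_complex M S T) n x = (if n \<in> T then x else \<zero>\<^bsub>M\<^esub>)"
  by (simp add: elementary_complex_def)

text \<open>Where the differential is the identity, its target has to be the full \<open>M\<close>,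
  and the next differential has to be zero for the composite to vanish.\<close>

lemma chain_complex_elementary:
  assumes M: "left_module R M" and T: "\<And>n. n \<in> T \<Longrightarrow> n - 1 \<in> S \<and> n - 1 \<notin> T"
  shows "chain_complex R (elementary_complex M S T)"
proof -
  interpret M: left_module R M by fact
  show ?thesis
    unfolding elementary_complex_def
    by (rule chain_complex_make)
      (use T left_module_zero_submodule[OF M] M in \<open>auto simp: linear_def M.smult_zero\<close>)
qed

lemmas chain_complex_disk = chain_complex_elementary[where S = "{n, n - 1}" and T = "{n}" for n, simplified]
lemmas chain_complex_sphere = chain_complex_elementary[where S = "{n}" and T = "{}" for n, simplified]

text \<open>The sign turns chain maps into the anticommuting families that twist a direct sum, and back.\<close>

definition shift_complex :: "int \<Rightarrow> ('r, 'm) complex_data \<Rightarrow> ('r, 'm) complex_data" where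
  "shift_complex k C = make_complex (\<lambda>n. component C (n + k))
     (\<lambda>n x. \<ominus>\<^bsub>component C (n + k - 1)\<^esub> diff C (n + k) x)"

lemma shift_complex_simps [simp]:
  "component (shift_complex k C) n = component C (n + k)"
  "x \<in> elems C (n + k) \<Longrightarrow> diff (shift_complex k C) n x = \<ominus>\<^bsub>component C (n + k - 1)\<^esub> diff C (n + k) x"
  by (simp_all add: shift_complex_def)

context
  fixes R :: "('r, 'e) ring_scheme" and C :: "('r, 'm) complex_data"
  assumes C: "chain_complex R C"
begin

interpretation C: left_module R "component C n" for n by (rule complex_module[OF C])

lemma chain_complex_shift: "chain_complex R (shift_complex k C)"
  unfolding shift_complex_def
proof (rule chain_complex_make)
  fix n
  \<comment> \<open>Degrees index the components, so equal integers in different normal forms have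
    to be rewritten before the facts about \<open>C\<close> apply.\<close>
  have 1: "n - 1 + k = n + k - 1" "n - 2 + k = n + k - 2" "n + k - 1 - 1 = n + k - 2" by simp_all
  show "left_module R (component C (n + k))" by (rule complex_module[OF C])
  show "linear R (component C (n + k)) (component C (n - 1 + k)) (\<lambda>x. \<ominus>\<^bsub>component C (n + k - 1)\<^esub> diff C (n + k) x)"
    unfolding 1 by (intro linear_minus_fun complex_module[OF C] diff_linear[OF C])
  show "\<ominus>\<^bsub>component C (n - 1 + k - 1)\<^esub> diff C (n - 1 + k) (\<ominus>\<^bsub>component C (n + k - 1)\<^esub> diff C (n + k) x)
      = \<zero>\<^bsub>component C (n - 2 + k)\<^esub>" if "x \<in> elems C (n + k)" for x
    unfolding 1 using that
    by (simp add: C.uminus_zero linear_minus[OF complex_module[OF C] complex_module[OF C] diff_linear[OF C]]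
        diff_closed[OF C] diff_diff[OF C])
qed

lemma cycles_shift: "cycles (shift_complex k C) n = cycles C (n + k)"
proof -
  have eq: "n - 1 + k = n + k - 1" by simp
  have "{x \<in> elems C (n + k). diff (shift_complex k C) n x = \<zero>\<^bsub>component C (n - 1 + k)\<^esub>} =
      {x \<in> elems C (n + k). diff C (n + k) x = \<zero>\<^bsub>component C (n + k - 1)\<^esub>}"
    by (auto simp: eq diff_closed[OF C])
  then show ?thesis by (simp add: cycles_eq)
qed

lemma exact_complex_shift:
  assumes ex: "exact_complex R C" shows "exact_complex R (shift_complex k C)"
  unfolding exact_complex_iff[OF chain_complex_shift]
proof (intro allI ballI impI)
  fix n x assume x: "x \<in> elems (shift_complex k C) n"
    "diff (shift_complex k C) n x = \<zero>\<^bsub>component (shift_complex k C) (n - 1)\<^esub>"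
  have 1: "n - 1 + k = n + k - 1" "n + 1 + k = n + k + 1" by simp_all
  have "diff C (n + k) x = \<zero>\<^bsub>component C (n + k - 1)\<^esub>"
    using x by (simp add: 1 diff_closed[OF C])
  then obtain y where y: "y \<in> elems C (n + k + 1)" "x = diff C (n + k + 1) y"
    using x exact_complexD[OF ex, of x "n + k"] by auto
  \<comment> \<open>The shifted differential carries a sign, so the preimage is negated.\<close>
  then have "x = diff (shift_complex k C) (n + 1) (\<ominus>\<^bsub>component C (n + k + 1)\<^esub> y)"
    using diff_closed[OF C y(1)]
    by (simp add: 1 linear_minus[OF complex_module[OF C] complex_module[OF C] diff_linear[OF C]])
  moreover have "\<ominus>\<^bsub>component C (n + k + 1)\<^esub> y \<in> elems (shift_complex k C) (n + 1)"
    using y by (simp add: 1)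
  ultimately show "x \<in> diff (shift_complex k C) (n + 1) ` elems (shift_complex k C) (n + 1)"
    by (rule image_eqI)
qed

end

lemma tilde_class_shift:
  assumes "C \<in> tilde_class R \<U> \<X>" shows "shift_complex k C \<in> tilde_class R \<U> \<X>"
proof -
  have ex: "exact_complex R C" and C: "chain_complex R C" using assms by (auto simp: tilde_class_def exact_complex_def)
  show ?thesis using assms exact_complex_shift[OF C ex] by (simp add: tilde_class_def cycles_shift[OF C])
qed

lemma null_homotopicI:
  assumes C: "chain_complex R C"
    and "\<And>n. linear R (component C n) (component D (n + 1)) (s n)"
    and "\<And>n x. x \<in> elems C n \<Longrightarrow>
      f n x = diff D (n + 1) (s n x) \<oplus>\<^bsub>component D n\<^esub> s (n - 1) (diff C n x)"
  shows "null_homotopic R C D f"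
  unfolding null_homotopic_def
  using assms module_hom_restrict[OF complex_module[OF C] assms(2)] diff_closed[OF C]
  by (intro exI[of _ "\<lambda>n. restrict (s n) (elems C n)"]) auto

lemma null_homotopicE:
  assumes "null_homotopic R C D f"
  obtains s where "\<And>n. linear R (component C n) (component D (n + 1)) (s n)"
    "\<And>n x. x \<in> elems C n \<Longrightarrow>
      f n x = diff D (n + 1) (s n x) \<oplus>\<^bsub>component D n\<^esub> s (n - 1) (diff C n x)"
  using assms unfolding null_homotopic_def module_hom_iff by blast

section \<open>Ext of complexes, homotopies and disks\<close>

lemma short_exact_zero_right:
  assumes B: "left_module R B" and Z: "left_module R Z" "carrier Z = {\<zero>\<^bsub>Z\<^esub>}"
  shows "short_exact R B (\<lambda>x. x) B (\<lambda>x. \<zero>\<^bsub>Z\<^esub>) Z"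
  using Z left_module_zero[OF B]
  by (auto simp: short_exact_def linear_id linear_zero_fun[OF B Z(1)])

lemma short_exact_zero_left:
  assumes A: "left_module R A" and Z: "left_module R Z" "carrier Z = {\<zero>\<^bsub>Z\<^esub>}"
  shows "short_exact R Z (\<lambda>x. \<zero>\<^bsub>A\<^esub>) A (\<lambda>x. x) A"
  using Z left_module_zero[OF A]
  by (auto simp: short_exact_def linear_id linear_zero_fun[OF Z(1) A])

context module_universe
begin

text \<open>A section of the twisted sum has the form \<open>x \<mapsto> (t x, x)\<close>, and the
  first coordinate of its compatibility with the differentials is the stated equation.\<close>

lemma Ch_Ext1_homotopy:
  fixes X V :: "('r, 'm) complex_data"
  assumes X: "chain_complex R X" and V: "chain_complex R V" and van: "Ext1_vanishes (Ch R) X V"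
    and f: "\<And>n. linear R (component X n) (component V (n - 1)) (f n)"
    and anti: "\<And>n x. x \<in> elems X n \<Longrightarrow>
      diff V (n - 1) (f n x) \<oplus>\<^bsub>component V (n - 2)\<^esub> f (n - 1) (diff X n x) = \<zero>\<^bsub>component V (n - 2)\<^esub>"
  obtains t where "\<And>n. linear R (component X n) (component V n) (t n)"
    "\<And>n x. x \<in> elems X n \<Longrightarrow> diff V n (t n x) \<oplus>\<^bsub>component V (n - 1)\<^esub> f n x = t (n - 1) (diff X n x)"
proof -
  note tw = twisted_sum[OF V X f anti]
  obtain s where s: "complex_map R X (twisted_sum V X f) s"
    "\<And>n x. x \<in> elems X n \<Longrightarrow> pair_snd (s n x) = x"
    using van tw Ch_Ext1_vanishes_iff[OF X V] by blast
  have comp: "component (twisted_sum V X f) n = direct_sum (component V n) (component X n)" for n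
    by (simp add: twisted_sum_def)
  show ?thesis
  proof
    show "linear R (component X n) (component V n) (\<lambda>x. pair_fst (s n x))" for n
      by (rule linear_comp[OF complex_map_linear[OF s(1), of n, unfolded comp]
          direct_sum_linear(3)[OF complex_module[OF V] complex_module[OF X]]])
    show "diff V n (pair_fst (s n x)) \<oplus>\<^bsub>component V (n - 1)\<^esub> f n x = pair_fst (s (n - 1) (diff X n x))"
      if x: "x \<in> elems X n" for n x
      using complex_map_diff[OF s(1) x, symmetric] complex_map_closed[OF s(1) x] s(2)[OF x]
      by (simp add: comp) (simp add: twisted_sum_def)
  qed
qed

text \<open>Converse of \<open>Ch_Ext1_homotopy\<close>, for arbitrary extensions. Sections
  \<open>s\<close> exist in each degree by \<open>van\<close>; their failure
  \<open>d s - s d\<close> to be a chain map takes values in \<open>V\<close> and is an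
  anticommuting family \<open>c\<close>. A homotopy \<open>t\<close> for \<open>c\<close> corrects
  the sections to \<open>s + i t\<close>.\<close>

lemma Ch_Ext1_vanishesI:
  fixes X V :: "('r, 'm) complex_data"
  assumes X: "chain_complex R X" and V: "chain_complex R V"
    and van: "\<And>n. Ext1_vanishes (LMod R) (component X n) (component V n)"
    and htpy: "\<And>f. (\<And>n. linear R (component X n) (component V (n - 1)) (f n)) \<Longrightarrow>
      (\<And>n x. x \<in> elems X n \<Longrightarrow>
        diff V (n - 1) (f n x) \<oplus>\<^bsub>component V (n - 2)\<^esub> f (n - 1) (diff X n x) = \<zero>\<^bsub>component V (n - 2)\<^esub>) \<Longrightarrow>
      \<exists>t. (\<forall>n. linear R (component X n) (component V n) (t n)) \<and>
        (\<forall>n. \<forall>x \<in> elems X n. diff V n (t n x) \<oplus>\<^bsub>component V (n - 1)\<^esub> f n x = t (n - 1) (diff X n x))"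
  shows "Ext1_vanishes (Ch R) X V"
  unfolding Ch_Ext1_vanishes_iff[OF X V]
proof (intro allI impI)
  fix i p and E :: "('r, 'm) complex_data" assume E: "chain_complex R E" and ses: "complex_ses R V i E p X"
  note XM = complex_module[OF X] and VM = complex_module[OF V] and EM = complex_module[OF E]
  note Xd = diff_linear[OF X] and Vd = diff_linear[OF V] and Ed = diff_linear[OF E]
  interpret X: left_module R "component X n" for n by (rule XM)
  interpret V: left_module R "component V n" for n by (rule VM)
  interpret E: left_module R "component E n" for n by (rule EM)
  have sn: "short_exact R (component V n) (i n) (component E n) (p n) (component X n)" for n
    using ses by (simp add: complex_ses_def)
  have i: "complex_map R V E i" and p: "complex_map R E X p" using ses by (auto simp: complex_ses_def)
  note il = complex_map_linear[OF i] and pl = complex_map_linear[OF p]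
  have inj: "inj_on (i n) (elems V n)"
    and pi: "x \<in> elems V n \<Longrightarrow> p n (i n x) = \<zero>\<^bsub>component X n\<^esub>" for n x
    using sn[of n] by (auto simp: short_exact_def)
  have "\<exists>s. linear R (component X n) (component E n) s \<and> (\<forall>x \<in> elems X n. p n (s x) = x)" for n
    using van[of n] EM sn LMod_Ext1_vanishes_iff[OF XM VM] by blast
  then obtain s where s: "\<And>n. linear R (component X n) (component E n) (s n)"
    "\<And>n x. x \<in> elems X n \<Longrightarrow> p n (s n x) = x" by metis
  note closed = complex_map_closed[OF i] complex_map_closed[OF p] linear_closed[OF s(1)]
    diff_closed[OF X] diff_closed[OF E] diff_closed[OF V]
  define k where "k n x = diff E n (s n x) \<ominus>\<^bsub>component E (n - 1)\<^esub> s (n - 1) (diff X n x)" for n x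
  have k: "linear R (component X n) (component E (n - 1)) (k n)" for n
    unfolding k_def by (intro linear_diff_fun[OF XM EM] linear_comp[OF s(1) Ed] linear_comp[OF Xd s(1)])
  have pk: "p (n - 1) (k n x) = \<zero>\<^bsub>component X (n - 1)\<^esub>" if "x \<in> elems X n" for n x
    using that by (simp add: k_def linear_diff[OF EM XM pl] closed complex_map_diff[OF p, symmetric] s(2) X.right_minus_eq)
  have "\<exists>c. linear R (component X n) (component V (n - 1)) c \<and> (\<forall>x \<in> elems X n. i (n - 1) (c x) = k n x)" for n
    by (rule short_exact_kernel_lift[OF VM EM XM sn k[of n] pk[of _ n]], assumption, blast)
  then obtain c where c: "\<And>n. linear R (component X n) (component V (n - 1)) (c n)"
    "\<And>n x. x \<in> elems X n \<Longrightarrow> i (n - 1) (c n x) = k n x" by metis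
  \<comment> \<open>Checked after the injective \<open>i\<close>: there \<open>d c\<close> becomes
    \<open>d (d s - s d) = - d s d\<close>, and \<open>c d\<close> becomes
    \<open>(d s - s d) d = d s d\<close>.\<close>
  have anti: "diff V (n - 1) (c n x) \<oplus>\<^bsub>component V (n - 2)\<^esub> c (n - 1) (diff X n x) = \<zero>\<^bsub>component V (n - 2)\<^esub>"
    if x: "x \<in> elems X n" for n x
  proof -
    have cl: "c n x \<in> elems V (n - 1)" "c (n - 1) (diff X n x) \<in> elems V (n - 2)"
      "diff V (n - 1) (c n x) \<in> elems V (n - 2)" "diff X n x \<in> elems X (n - 1)"
      "s n x \<in> elems E n" "diff E n (s n x) \<in> elems E (n - 1)"
      "s (n - 1) (diff X n x) \<in> elems E (n - 1)"
      "diff E (n - 1) (s (n - 1) (diff X n x)) \<in> elems E (n - 2)"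
      using x closed linear_closed[OF c(1)] linear_closed[OF c(1), of _ "n - 1"]
        diff_closed[OF V, of _ "n - 1"] diff_closed[OF E, of _ "n - 1"] by auto
    have "i (n - 2) (diff V (n - 1) (c n x)) = diff E (n - 1) (k n x)"
      using complex_map_diff[OF i cl(1)] c(2)[OF x] by simp
    also have "\<dots> = \<zero>\<^bsub>component E (n - 2)\<^esub> \<ominus>\<^bsub>component E (n - 2)\<^esub> diff E (n - 1) (s (n - 1) (diff X n x))"
      using linear_diff[OF EM EM Ed cl(6,7)] diff_diff[OF E cl(5)] by (simp add: k_def)
    finally have 1: "i (n - 2) (diff V (n - 1) (c n x)) =
      \<zero>\<^bsub>component E (n - 2)\<^esub> \<ominus>\<^bsub>component E (n - 2)\<^esub> diff E (n - 1) (s (n - 1) (diff X n x))" .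
    have 2: "i (n - 2) (c (n - 1) (diff X n x)) = diff E (n - 1) (s (n - 1) (diff X n x))"
      using c(2)[OF cl(4)] diff_diff[OF X x] cl(8)
      by (simp add: k_def linear_zero[OF XM EM s(1)] a_minus_def E.uminus_zero)
    have "i (n - 2) (diff V (n - 1) (c n x) \<oplus>\<^bsub>component V (n - 2)\<^esub> c (n - 1) (diff X n x)) = i (n - 2) \<zero>\<^bsub>component V (n - 2)\<^esub>"
      using cl(8) unfolding linear_add[OF il cl(3,2)] 1 2
      by (simp add: linear_zero[OF VM EM il] a_minus_def E.l_neg)
    then show ?thesis using inj[of "n - 2"] cl by (simp add: inj_on_eq_iff)
  qed
  obtain t where t: "\<And>n. linear R (component X n) (component V n) (t n)"
    "\<And>n x. x \<in> elems X n \<Longrightarrow> diff V n (t n x) \<oplus>\<^bsub>component V (n - 1)\<^esub> c n x = t (n - 1) (diff X n x)"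
    using htpy[OF c(1) anti] by blast
  let ?s = "\<lambda>n x. s n x \<oplus>\<^bsub>component E n\<^esub> i n (t n x)"
  have "diff E n (?s n x) = ?s (n - 1) (diff X n x)" if x: "x \<in> elems X n" for n x
  proof -
    note cl = closed(1)[OF linear_closed[OF t(1)]] closed(3) closed(4) closed(5) closed(6) linear_closed[OF t(1)] linear_closed[OF c(1)]
    have cx: "i (n - 1) (c n x) = diff E n (s n x) \<ominus>\<^bsub>component E (n - 1)\<^esub> s (n - 1) (diff X n x)"
      using c(2)[OF x] by (simp add: k_def)
    have "i (n - 1) (t (n - 1) (diff X n x)) = i (n - 1) (diff V n (t n x)) \<oplus>\<^bsub>component E (n - 1)\<^esub> i (n - 1) (c n x)"
      using x cl by (simp add: t(2)[OF x, symmetric] linear_add[OF il])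
    then have "?s (n - 1) (diff X n x) = s (n - 1) (diff X n x) \<oplus>\<^bsub>component E (n - 1)\<^esub>
      (i (n - 1) (diff V n (t n x)) \<oplus>\<^bsub>component E (n - 1)\<^esub>
       (diff E n (s n x) \<ominus>\<^bsub>component E (n - 1)\<^esub> s (n - 1) (diff X n x)))"
      by (simp only: cx)
    also have "\<dots> = diff E n (s n x) \<oplus>\<^bsub>component E (n - 1)\<^esub> i (n - 1) (diff V n (t n x))"
      using x cl closed(1) E.r_neg2[of "s (n - 1) (diff X n x)" "n - 1" "diff E n (s n x) \<oplus>\<^bsub>component E (n - 1)\<^esub> i (n - 1) (diff V n (t n x))"]
      by (simp add: a_minus_def E.a_ac)
    also have "\<dots> = diff E n (?s n x)"
      using x cl by (simp add: linear_add[OF Ed] complex_map_diff[OF i])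
    finally show ?thesis ..
  qed
  moreover have "linear R (component X n) (component E n) (?s n)" for n
    by (intro linear_add_fun[OF XM EM] s(1) linear_comp[OF t(1) il])
  moreover have "p n (?s n x) = x" if "x \<in> elems X n" for n x
    using that by (simp add: linear_add[OF pl] closed linear_closed[OF t(1)] s(2) pi)
  ultimately show "\<exists>s. complex_map R X E s \<and> (\<forall>n. \<forall>a \<in> elems X n. p n (s n a) = a)"
    unfolding complex_map_def by (intro exI[of _ ?s]) simp
qed

text \<open>An extension \<open>E\<close> of \<open>U\<close> by \<open>V\<close> in degree
  \<open>n\<close> is spread out to an extension of \<open>disk n U\<close> by the complex
  \<open>V\<close>: degree \<open>n\<close> becomes \<open>E\<close>, degree \<open>n - 1\<close>
  the pushout \<open>Q\<close> of \<open>E\<close> along the differential, and nothing else changes.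
  A section of complexes is a section of \<open>E\<close> in degree \<open>n\<close>.\<close>

lemma Ext1_vanishes_disk_left:
  fixes U :: "('r, 'm) module" and V :: "('r, 'm) complex_data"
  assumes U: "left_module R U" and V: "chain_complex R V" and van: "Ext1_vanishes (Ch R) (disk n U) V"
  shows "Ext1_vanishes (LMod R) U (component V n)"
  unfolding LMod_Ext1_vanishes_iff[OF U complex_module[OF V]]
proof (intro allI impI)
  fix i p and E :: "('r, 'm) module" assume E: "left_module R E" and ses: "short_exact R (component V n) i E p U"
  note VM = complex_module[OF V] and Vd = diff_linear[OF V]
  note Vcl = diff_closed[OF V] and Vdd = diff_diff[OF V]
  have il: "linear R (component V n) E i" and pl: "linear R E U p"
    and pi: "x \<in> elems V n \<Longrightarrow> p (i x) = \<zero>\<^bsub>U\<^esub>" for x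
    using ses by (auto simp: short_exact_def)
  obtain Q :: "('r, 'm) module" and i' g p' where Q: "left_module R Q"
    and ses': "short_exact R (component V (n - 1)) i' Q p' U" and g: "linear R E Q g"
    and gi: "\<And>b. b \<in> elems V n \<Longrightarrow> g (i b) = i' (diff V n b)"
    and p'g: "\<And>e. e \<in> carrier E \<Longrightarrow> p' (g e) = p e"
    and dec: "\<And>x. x \<in> carrier Q \<Longrightarrow> \<exists>b \<in> elems V (n - 1). \<exists>e \<in> carrier E. x = i' b \<oplus>\<^bsub>Q\<^esub> g e"
    \<comment> \<open>The differential out of \<open>Q\<close>: that of \<open>V\<close> on the part
      from \<open>V\<close> and zero on the part from \<open>E\<close>. The two agree on degree
      \<open>n\<close> of \<open>V\<close> because the differential of \<open>V\<close> squares to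
      zero.\<close>
    and ex: "\<exists>m. linear R Q (component V (n - 2)) m \<and> (\<forall>b \<in> elems V (n - 1). m (i' b) = diff V (n - 1) b) \<and>
        (\<forall>e \<in> carrier E. m (g e) = \<zero>\<^bsub>component V (n - 2)\<^esub>)"
  proof (rule pushout[OF VM E U VM ses Vd], goal_cases)
    case (1 Q i' g p')
    have "linear R (component V (n - 1)) (component V (n - 2)) (diff V (n - 1))" using Vd[of "n - 1"] by simp
    from 1(8)[OF VM this linear_zero_fun[OF E VM]] show ?case using 1 Vdd by (intro 1(1)) simp_all
  qed
  obtain m where m: "linear R Q (component V (n - 2)) m"
    "\<And>b. b \<in> elems V (n - 1) \<Longrightarrow> m (i' b) = diff V (n - 1) b"
    "\<And>e. e \<in> carrier E \<Longrightarrow> m (g e) = \<zero>\<^bsub>component V (n - 2)\<^esub>" using ex by blast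
  have i'l: "linear R (component V (n - 1)) Q i'"
    using ses' by (auto simp: short_exact_def)
  define M where "M = (component V)(n := E, n - 1 := Q)"
  define d where "d = (diff V)(n + 1 := (\<lambda>x. i (diff V (n + 1) x)), n := g, n - 1 := m)"
  define P where "P = make_complex M d"
  have MM: "left_module R (M k)" for k by (simp add: M_def E Q VM)
  have Vd1: "linear R (component V (n + 1)) (component V n) (diff V (n + 1))" using Vd[of "n + 1"] by simp
  have dl: "linear R (M k) (M (k - 1)) (d k)" for k
  proof -
    consider "k = n + 1" | "k = n" | "k = n - 1" | "k \<noteq> n + 1" "k \<noteq> n" "k \<noteq> n - 1" by blast
    then show ?thesis
      by cases (simp_all add: M_def d_def g m linear_comp[OF Vd1 il] Vd diff_eq_eq)
  qed
  have dd: "d (k - 1) (d k x) = \<zero>\<^bsub>M (k - 2)\<^esub>" if x: "x \<in> carrier (M k)" for k x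
  proof -
    consider "k = n + 2" | "k = n + 1" | "k = n" | "k = n - 1" | "k \<noteq> n + 2" "k \<noteq> n + 1" "k \<noteq> n" "k \<noteq> n - 1" by blast
    then show ?thesis
    proof cases
      case 1
      then show ?thesis using x Vdd[of x "n + 2"] by (simp add: M_def d_def linear_zero[OF VM E il] add.commute[of 1 n])
    next
      case 2
      then show ?thesis using x Vdd[of x "n + 1"] Vcl[of x "n + 1"] by (simp add: M_def d_def gi linear_zero[OF VM Q i'l])
    next
      case 3
      then show ?thesis using x by (simp add: M_def d_def m)
    next
      case 4
      then have "x \<in> carrier Q" using x by (simp add: M_def)
      then obtain b e where be: "b \<in> elems V (n - 1)" "e \<in> carrier E" "x = i' b \<oplus>\<^bsub>Q\<^esub> g e"
        using dec by blast
      interpret V2: left_module R "component V (n - 2)" by (rule VM)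
      have "m x = diff V (n - 1) b"
        using be Vcl[of b "n - 1"] by (simp add: linear_add[OF m(1)] linear_closed[OF i'l] linear_closed[OF g] m)
      then show ?thesis using 4 Vdd[of b "n - 1"] be by (simp add: M_def d_def)
    next
      case 5
      then show ?thesis using x Vdd[of x k] by (simp add: M_def d_def diff_eq_eq)
    qed
  qed
  have P: "chain_complex R P" unfolding P_def by (rule chain_complex_make[of R M d, OF MM dl dd])
  have Pc: "component P = M" by (simp add: P_def)
  have Pd: "x \<in> carrier (M k) \<Longrightarrow> diff P k x = d k x" for k x by (simp add: P_def)
  define I where "I = (\<lambda>k x. x)(n := i, n - 1 := i')"
  define Pr where "Pr = (\<lambda>k x. \<zero>\<^bsub>U\<^esub>)(n := p, n - 1 := p')"
  let ?Z = "U\<lparr>carrier := {\<zero>\<^bsub>U\<^esub>}\<rparr>"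
  have D: "component (disk n U) k = (if k = n \<or> k = n - 1 then U else ?Z)" for k
    by (simp add: elementary_complex_component)
  have Z: "left_module R ?Z" "carrier ?Z = {\<zero>\<^bsub>?Z\<^esub>}" using left_module_zero_submodule[OF U] by simp_all
  have sk: "short_exact R (component V k) (I k) (component P k) (Pr k) (component (disk n U) k)" for k
    using ses ses' short_exact_zero_right[OF VM Z] by (simp add: I_def Pr_def Pc M_def D)
  have "complex_ses R V I P Pr (disk n U)"
    unfolding complex_ses_def
  proof (intro conjI allI sk)
    have "diff P k (I k x) = I (k - 1) (diff V k x)" if x: "x \<in> elems V k" for k x
    proof -
      have Ix: "I k x \<in> carrier (M k)" using sk[of k] x by (auto simp: short_exact_def Pc linear_closed)
      consider "k = n + 1" | "k = n" | "k = n - 1" | "k \<noteq> n + 1" "k \<noteq> n" "k \<noteq> n - 1" by blast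
      then show ?thesis unfolding Pd[OF Ix]
        by cases (use x in \<open>simp_all add: I_def d_def gi m diff_eq_eq\<close>)
    qed
    then show "complex_map R V P I" using sk by (simp add: complex_map_def short_exact_def)
    have "diff (disk n U) k (Pr k x) = Pr (k - 1) (diff P k x)" if x: "x \<in> elems P k" for k x
    proof -
      have Prx: "Pr k x \<in> elems (disk n U) k" using sk[of k] x by (auto simp: short_exact_def)
      consider "k = n + 1" | "k = n" | "k = n - 1" | "k \<noteq> n + 1" "k \<noteq> n" "k \<noteq> n - 1" by blast
      then show ?thesis unfolding elementary_complex_diff[OF Prx]
        by cases (use x Vcl[of x "n + 1"] in \<open>simp_all add: Pc Pd Pr_def d_def M_def pi p'g diff_eq_eq\<close>)
    qed
    then show "complex_map R P (disk n U) Pr" using sk by (simp add: complex_map_def short_exact_def)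
  qed
  then obtain s where s: "complex_map R (disk n U) P s"
    "\<And>k a. a \<in> elems (disk n U) k \<Longrightarrow> Pr k (s k a) = a"
    using van P Ch_Ext1_vanishes_iff[OF chain_complex_disk[OF U] V] by blast
  then show "\<exists>s. linear R U E s \<and> (\<forall>a \<in> carrier U. p (s a) = a)"
    using complex_map_linear[OF s(1), of n] s(2)[of _ n] by (auto simp: Pc M_def D Pr_def)
qed

text \<open>Dual to \<open>Ext1_vanishes_disk_left\<close>. The disk occupies degrees
  \<open>n + 1\<close> and \<open>n\<close>; \<open>E\<close> is placed in degree \<open>n\<close>
  and the pullback \<open>Q\<close> of \<open>E\<close> along the differential in degree
  \<open>n + 1\<close>.\<close>

lemma Ext1_vanishes_disk_right:
  fixes Y :: "('r, 'm) module" and X :: "('r, 'm) complex_data"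
  assumes Y: "left_module R Y" and X: "chain_complex R X" and van: "Ext1_vanishes (Ch R) X (disk (n + 1) Y)"
  shows "Ext1_vanishes (LMod R) (component X n) Y"
  unfolding LMod_Ext1_vanishes_iff[OF complex_module[OF X] Y]
proof (intro allI impI)
  fix i p and E :: "('r, 'm) module" assume E: "left_module R E" and ses: "short_exact R Y i E p (component X n)"
  note XM = complex_module[OF X] and Xd = diff_linear[OF X]
  note Xcl = diff_closed[OF X] and Xdd = diff_diff[OF X]
  have Xd1: "linear R (component X (n + 1)) (component X n) (diff X (n + 1))" using Xd[of "n + 1"] by simp
  have Xd2: "linear R (component X (n + 2)) (component X (n + 1)) (diff X (n + 2))" using Xd[of "n + 2"] by (simp add: add.commute[of _ n])
  have il: "linear R Y E i" and pl: "linear R E (component X n) p"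
    and pi: "x \<in> carrier Y \<Longrightarrow> p (i x) = \<zero>\<^bsub>component X n\<^esub>" for x
    using ses by (auto simp: short_exact_def)
  obtain Q :: "('r, 'm) module" and i' g p' where Q: "left_module R Q"
    and ses': "short_exact R Y i' Q p' (component X (n + 1))" and g: "linear R Q E g"
    and gi': "\<And>b. b \<in> carrier Y \<Longrightarrow> g (i' b) = i b"
    and pg: "\<And>x. x \<in> carrier Q \<Longrightarrow> p (g x) = diff X (n + 1) (p' x)"
    and joint: "\<And>x. x \<in> carrier Q \<Longrightarrow> p' x = \<zero>\<^bsub>component X (n + 1)\<^esub> \<Longrightarrow> g x = \<zero>\<^bsub>E\<^esub> \<Longrightarrow> x = \<zero>\<^bsub>Q\<^esub>"
    \<comment> \<open>The differential into \<open>Q\<close> has the two coordinates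
      \<open>diff X (n + 2)\<close> and zero.\<close>
    and ex: "\<exists>m. linear R (component X (n + 2)) Q m \<and> (\<forall>c \<in> elems X (n + 2). p' (m c) = diff X (n + 2) c) \<and>
        (\<forall>c \<in> elems X (n + 2). g (m c) = \<zero>\<^bsub>E\<^esub>)"
  proof (rule pullback[OF Y E XM XM ses Xd1], goal_cases)
    case (1 Q i' g p')
    from 1(8)[OF XM Xd2 linear_zero_fun[OF XM E]] show ?case
      using 1 Xdd[of _ "n + 2"] by (intro 1(1)) (simp_all add: linear_zero[OF E XM pl] add.commute[of _ n])
  qed
  obtain m where m: "linear R (component X (n + 2)) Q m"
    "\<And>c. c \<in> elems X (n + 2) \<Longrightarrow> p' (m c) = diff X (n + 2) c"
    "\<And>c. c \<in> elems X (n + 2) \<Longrightarrow> g (m c) = \<zero>\<^bsub>E\<^esub>" using ex by blast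
  have i'l: "linear R Y Q i'" and p'l: "linear R Q (component X (n + 1)) p'"
    using ses' by (auto simp: short_exact_def)
  define M where "M = (component X)(n := E, n + 1 := Q)"
  define d where "d = (diff X)(n := (\<lambda>x. diff X n (p x)), n + 1 := g, n + 2 := m)"
  define P where "P = make_complex M d"
  have MM: "left_module R (M k)" for k by (simp add: M_def E Q XM)
  have dl: "linear R (M k) (M (k - 1)) (d k)" for k
  proof -
    consider "k = n + 2" | "k = n + 1" | "k = n" | "k \<noteq> n + 2" "k \<noteq> n + 1" "k \<noteq> n" by blast
    then show ?thesis
      by cases (simp_all add: M_def d_def g m linear_comp[OF pl Xd] Xd diff_eq_eq)
  qed
  have dd: "d (k - 1) (d k x) = \<zero>\<^bsub>M (k - 2)\<^esub>" if x: "x \<in> carrier (M k)" for k x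
  proof -
    consider "k = n + 3" | "k = n + 2" | "k = n + 1" | "k = n" | "k \<noteq> n + 3" "k \<noteq> n + 2" "k \<noteq> n + 1" "k \<noteq> n" by blast
    then show ?thesis
    proof cases
      case 1
      then have x': "x \<in> elems X (n + 3)" using x by (simp add: M_def)
      then have dx: "diff X (n + 3) x \<in> elems X (n + 2)" using Xcl[of x "n + 3"] by (simp add: add.commute[of _ n])
      \<comment> \<open>Both projections of this element vanish, so \<open>joint\<close>
        applies.\<close>
      have "m (diff X (n + 3) x) = \<zero>\<^bsub>Q\<^esub>"
        by (rule joint) (use dx Xdd[OF x'] in \<open>simp_all add: m linear_closed[OF m(1)] add.commute[of _ n]\<close>)
      then show ?thesis using 1 by (simp add: M_def d_def add.commute[of _ n])
    next
      case 2
      then show ?thesis using x m by (simp add: M_def d_def add.commute[of _ n])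
    next
      case 3
      then show ?thesis using x Xdd[of "p' x" "n + 1"] by (simp add: M_def d_def pg linear_closed[OF p'l])
    next
      case 4
      then show ?thesis using x Xdd[of "p x" n] by (simp add: M_def d_def linear_closed[OF pl])
    next
      case 5
      then show ?thesis using x Xdd[of x k] by (simp add: M_def d_def diff_eq_eq)
    qed
  qed
  have P: "chain_complex R P" unfolding P_def by (rule chain_complex_make[of R M d, OF MM dl dd])
  have Pc: "component P = M" by (simp add: P_def)
  have Pd: "x \<in> carrier (M k) \<Longrightarrow> diff P k x = d k x" for k x by (simp add: P_def)
  define I where "I = (\<lambda>k x. \<zero>\<^bsub>component X k\<^esub>)(n := i, n + 1 := i')"
  define Pr where "Pr = (\<lambda>k x. x)(n := p, n + 1 := p')"
  let ?Z = "Y\<lparr>carrier := {\<zero>\<^bsub>Y\<^esub>}\<rparr>"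
  define DY where "DY = disk (n + 1) Y"
  have D: "component DY k = (if k = n + 1 \<or> k = n then Y else ?Z)" for k
    by (simp add: DY_def elementary_complex_component)
  have Dd: "diff DY k x = (if k = n + 1 then x else \<zero>\<^bsub>Y\<^esub>)" if "x \<in> elems DY k" for k x
    using elementary_complex_diff[OF that[unfolded DY_def]] by (simp add: DY_def)
  have Z: "left_module R ?Z" "carrier ?Z = {\<zero>\<^bsub>?Z\<^esub>}" using left_module_zero_submodule[OF Y] by simp_all
  have sk: "short_exact R (component DY k) (I k) (component P k) (Pr k) (component X k)" for k
    using ses ses' short_exact_zero_left[OF XM Z] by (simp add: I_def Pr_def Pc M_def D)
  have "complex_ses R DY I P Pr X"
    unfolding complex_ses_def
  proof (intro conjI allI sk)
    have "diff P k (I k x) = I (k - 1) (diff DY k x)" if x: "x \<in> elems DY k" for k x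
    proof -
      have Ix: "I k x \<in> carrier (M k)" using sk[of k] x by (auto simp: short_exact_def Pc linear_closed)
      have "d k (I k x) = I (k - 1) (if k = n + 1 then x else \<zero>\<^bsub>Y\<^esub>)"
      proof -
        consider "k = n + 2" | "k = n + 1" | "k = n" | "k \<noteq> n + 2" "k \<noteq> n + 1" "k \<noteq> n" by blast
        then show ?thesis
        proof cases
          case 1 then show ?thesis
            by (simp add: I_def d_def add.commute[of _ n] linear_zero[OF XM Q m(1)] linear_zero[OF Y Q i'l])
        next
          case 2 then show ?thesis using x
            by (simp add: I_def d_def D gi')
        next
          case 3 then show ?thesis using x
            by (simp add: I_def d_def D pi linear_zero[OF XM XM Xd])
        next
          case 4 then show ?thesis using x
            by (simp add: I_def d_def D diff_eq_eq linear_zero[OF XM XM Xd])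
        qed
      qed
      then show ?thesis by (simp only: Pd[OF Ix] Dd[OF x])
    qed
    then show "complex_map R DY P I" using sk by (simp add: complex_map_def short_exact_def)
    have "diff X k (Pr k x) = Pr (k - 1) (diff P k x)" if x: "x \<in> elems P k" for k x
    proof -
      consider "k = n + 2" | "k = n + 1" | "k = n" | "k \<noteq> n + 2" "k \<noteq> n + 1" "k \<noteq> n" by blast
      then show ?thesis
        by cases (use x in \<open>simp_all add: Pc Pd Pr_def d_def M_def pg m diff_eq_eq add.commute[of _ n]\<close>)
    qed
    then show "complex_map R P X Pr" using sk by (simp add: complex_map_def short_exact_def)
  qed
  then obtain s where s: "complex_map R X P s"
    "\<And>k a. a \<in> elems X k \<Longrightarrow> Pr k (s k a) = a"
    using van P unfolding DY_def using Ch_Ext1_vanishes_iff[OF X chain_complex_disk[OF Y, of "n + 1"]] by blast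
  then show "\<exists>s. linear R (component X n) E s \<and> (\<forall>a \<in> elems X n. p (s a) = a)"
    using complex_map_linear[OF s(1), of n] s(2)[of _ n] by (auto simp: Pc M_def Pr_def)
qed

end

section \<open>The two cotorsion pairs\<close>

lemma elementary_complex_zero: "\<zero>\<^bsub>component (elementary_complex M S T) n\<^esub> = \<zero>\<^bsub>M\<^esub>"
  by (simp add: elementary_complex_component)

lemma cotorsion_pairD:
  assumes "cotorsion_pair C A B"
  shows "M \<in> A \<longleftrightarrow> M \<in> Obj C \<and> (\<forall>N \<in> B. Ext1_vanishes C M N)"
    and "N \<in> B \<longleftrightarrow> N \<in> Obj C \<and> (\<forall>M \<in> A. Ext1_vanishes C M N)"
  using assms unfolding cotorsion_pair_def left_perp_def right_perp_def by blast+

locale two_cotorsion_pairs = module_universe R ty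
  for R :: "('r, 'e) ring_scheme" (structure) and ty :: "'m itself" +
  fixes \<U> \<V> \<X> \<Y> :: "('r, 'm) module set"
  assumes universe: "universe_for R TYPE('m)"
    and UV: "cotorsion_pair (LMod R) \<U> \<V>" and XY: "cotorsion_pair (LMod R) \<X> \<Y>" and sub: "\<U> \<subseteq> \<X>"
begin

lemma U_module: "M \<in> \<U> \<Longrightarrow> left_module R M"
  and V_module: "N \<in> \<V> \<Longrightarrow> left_module R N"
  and UV_Ext: "M \<in> \<U> \<Longrightarrow> N \<in> \<V> \<Longrightarrow> Ext1_vanishes (LMod R) M N"
  and U_memI: "left_module R M \<Longrightarrow> (\<And>N. N \<in> \<V> \<Longrightarrow> Ext1_vanishes (LMod R) M N) \<Longrightarrow> M \<in> \<U>"
  and V_memI: "left_module R N \<Longrightarrow> (\<And>M. M \<in> \<U> \<Longrightarrow> Ext1_vanishes (LMod R) M N) \<Longrightarrow> N \<in> \<V>"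
  using cotorsion_pairD[OF UV, unfolded LMod_simps mem_Collect_eq] by blast+

lemma Y_module: "N \<in> \<Y> \<Longrightarrow> left_module R N"
  and XY_Ext: "M \<in> \<X> \<Longrightarrow> N \<in> \<Y> \<Longrightarrow> Ext1_vanishes (LMod R) M N"
  and X_module: "M \<in> \<X> \<Longrightarrow> left_module R M"
  and X_memI: "left_module R M \<Longrightarrow> (\<And>N. N \<in> \<Y> \<Longrightarrow> Ext1_vanishes (LMod R) M N) \<Longrightarrow> M \<in> \<X>"
  and Y_memI: "left_module R N \<Longrightarrow> (\<And>M. M \<in> \<X> \<Longrightarrow> Ext1_vanishes (LMod R) M N) \<Longrightarrow> N \<in> \<Y>"
  using cotorsion_pairD[OF XY, unfolded LMod_simps mem_Collect_eq] by blast+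

text \<open>Passing to orthogonal classes reverses \<open>sub\<close>; the nonzero component of a
  sphere on a module of \<open>\<Y>\<close> therefore meets the condition for
  \<open>\<V>\<close>.\<close>

lemma Y_subset_V: "\<Y> \<subseteq> \<V>"
  using sub Y_module XY_Ext by (blast intro: V_memI)

lemma zero_module_mem:
  assumes "left_module R M"
  shows "M\<lparr>carrier := {\<zero>\<^bsub>M\<^esub>}\<rparr> \<in> \<U>" "M\<lparr>carrier := {\<zero>\<^bsub>M\<^esub>}\<rparr> \<in> \<V>"
  using left_module_zero_submodule[OF assms] Ext1_vanishes_zero[OF left_module_zero_submodule[OF assms]]
    U_module V_module
  by (auto intro!: U_memI V_memI)

definition homotopy_perp :: "('r, 'm) complex_data set" where
  "homotopy_perp = {V. chain_complex R V \<and> (\<forall>n. component V n \<in> \<V>) \<and>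
     (\<forall>U \<in> tilde_class R \<U> \<X>. \<forall>f \<in> chain_map R U V. null_homotopic R U V f)}"

lemma tilde_classD:
  assumes "U \<in> tilde_class R \<U> \<X>"
  shows "chain_complex R U" "exact_complex R U" "component U n \<in> \<U>" "cycles U n \<in> \<X>"
  using assms by (auto simp: tilde_class_def exact_complex_def)

text \<open>The cycles are \<open>M\<close> in degree \<open>n - 1\<close> and zero elsewhere, so
  they lie in \<open>\<U>\<close>, hence in \<open>\<X>\<close>.\<close>

lemma disk_mem_tilde_class:
  assumes M: "M \<in> \<U>" shows "disk n M \<in> tilde_class R \<U> \<X>"
proof -
  have lM: "left_module R M" using M by (rule U_module)
  note D = chain_complex_disk[OF lM, of n]
  have zero: "diff (disk n M) k \<zero>\<^bsub>M\<^esub> = \<zero>\<^bsub>M\<^esub>" for k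
    using left_module_zero[OF lM] by (subst elementary_complex_diff) (simp_all add: elementary_complex_component)
  have "exact_complex R (disk n M)"
    unfolding exact_complex_iff[OF D]
  proof (intro allI ballI impI)
    fix k x assume x: "x \<in> elems (disk n M) k" "diff (disk n M) k x = \<zero>\<^bsub>component (disk n M) (k - 1)\<^esub>"
    show "x \<in> diff (disk n M) (k + 1) ` elems (disk n M) (k + 1)"
    proof (cases "x = \<zero>\<^bsub>M\<^esub>")
      case True
      have "\<zero>\<^bsub>M\<^esub> \<in> elems (disk n M) (k + 1)"
        using left_module_zero[OF lM] by (simp add: elementary_complex_component)
      then show ?thesis using True zero[of "k + 1"] by (metis imageI)
    next
      case False
      \<comment> \<open>In degree \<open>n\<close> the differential is the identity and kills no
        nonzero element; outside \<open>n\<close> and \<open>n - 1\<close> there is none.\<close>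
      then have k: "k = n - 1"
        using x unfolding elementary_complex_diff[OF x(1)] by (auto simp: elementary_complex_component split: if_splits)
      then have "x \<in> elems (disk n M) (k + 1)" using x by (simp add: elementary_complex_component)
      moreover from this have "diff (disk n M) (k + 1) x = x" using k by (simp add: elementary_complex_diff)
      ultimately show ?thesis by (metis imageI)
    qed
  qed
  moreover have "component (disk n M) k \<in> \<U>" for k
    using M zero_module_mem[OF lM] by (simp add: elementary_complex_component)
  moreover have "cycles (disk n M) k \<in> \<U>" for k
  proof -
    have "{x \<in> elems (disk n M) k. diff (disk n M) k x = \<zero>\<^bsub>M\<^esub>} = (if k = n - 1 then carrier M else {\<zero>\<^bsub>M\<^esub>})"
      using left_module_zero[OF lM] zero[of k]
      by (auto simp: elementary_complex_diff elementary_complex_component split: if_splits)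
    moreover have "cycles (disk n M) k =
        M\<lparr>carrier := {x \<in> elems (disk n M) k. diff (disk n M) k x = \<zero>\<^bsub>M\<^esub>}\<rparr>"
      by (simp add: cycles_eq elementary_complex_component)
    ultimately show ?thesis using M zero_module_mem[OF lM] by simp
  qed
  ultimately show ?thesis using sub by (auto simp: tilde_class_def)
qed

text \<open>An anticommuting family is a chain map out of the shift of \<open>X\<close>, which is
  again in the tilde class, so it is null homotopic by assumption on \<open>V\<close>.\<close>

lemma Ext1_vanishes_homotopy_perp:
  assumes X: "X \<in> tilde_class R \<U> \<X>" and V: "V \<in> homotopy_perp"
  shows "Ext1_vanishes (Ch R) X V"
proof -
  note XC = tilde_classD(1)[OF X]
  have VC: "chain_complex R V" using V by (simp add: homotopy_perp_def)
  note XM = complex_module[OF XC] and VM = complex_module[OF VC]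
  interpret X: left_module R "component X n" for n by (rule XM)
  interpret V: left_module R "component V n" for n by (rule VM)
  define S where "S = shift_complex 1 X"
  have Sc: "component S n = component X (n + 1)" for n by (simp add: S_def)
  have Sd: "diff S n x = \<ominus>\<^bsub>component X n\<^esub> diff X (n + 1) x" if "x \<in> elems X (n + 1)" for n x
    using that by (simp add: S_def)
  show ?thesis
  proof (rule Ch_Ext1_vanishesI[OF XC VC])
    show "Ext1_vanishes (LMod R) (component X n) (component V n)" for n
      using tilde_classD(3)[OF X, of n] V by (simp add: homotopy_perp_def UV_Ext)
  next
    fix f assume f: "\<And>n. linear R (component X n) (component V (n - 1)) (f n)"
      and anti: "\<And>n x. x \<in> elems X n \<Longrightarrow>
        diff V (n - 1) (f n x) \<oplus>\<^bsub>component V (n - 2)\<^esub> f (n - 1) (diff X n x) = \<zero>\<^bsub>component V (n - 2)\<^esub>"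
    have f1: "linear R (component X (n + 1)) (component V n) (f (n + 1))" for n using f[of "n + 1"] by simp
    have SC: "chain_complex R S" unfolding S_def by (rule chain_complex_shift[OF XC])
    have "diff V n (f (n + 1) x) = f n (diff S n x)" if x: "x \<in> elems X (n + 1)" for n x
    proof -
      have dx: "diff X (n + 1) x \<in> elems X n" using diff_closed[OF XC x] by simp
      have "diff V n (f (n + 1) x) \<oplus>\<^bsub>component V (n - 1)\<^esub> f n (diff X (n + 1) x) = \<zero>\<^bsub>component V (n - 1)\<^esub>"
        using anti[OF x] by simp
      then show ?thesis
        using V.minus_equality linear_closed[OF f dx] diff_closed[OF VC linear_closed[OF f1 x]]
        by (simp add: Sd[OF x] linear_minus[OF XM VM f dx])
    qed
    then have "complex_map R S V (\<lambda>n. f (n + 1))" by (simp add: complex_map_def Sc f1)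
    then have "(\<lambda>n. restrict (f (n + 1)) (elems S n)) \<in> chain_map R S V"
      using complex_map_cong[OF SC] by (simp add: chain_map_iff)
    moreover have "S \<in> tilde_class R \<U> \<X>" unfolding S_def by (rule tilde_class_shift[OF X])
    ultimately have "null_homotopic R S V (\<lambda>n. restrict (f (n + 1)) (elems S n))"
      using V by (simp add: homotopy_perp_def)
    then obtain s where s: "\<And>n. linear R (component S n) (component V (n + 1)) (s n)"
      "\<And>n x. x \<in> elems S n \<Longrightarrow> restrict (f (n + 1)) (elems S n) x =
        diff V (n + 1) (s n x) \<oplus>\<^bsub>component V n\<^esub> s (n - 1) (diff S n x)"
      by (rule null_homotopicE) blast
    have s1: "linear R (component X n) (component V n) (s (n - 1))" for n
      using s(1)[of "n - 1"] by (simp add: Sc)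
    show "\<exists>t. (\<forall>n. linear R (component X n) (component V n) (t n)) \<and>
      (\<forall>n. \<forall>x \<in> elems X n. diff V n (t n x) \<oplus>\<^bsub>component V (n - 1)\<^esub> f n x = t (n - 1) (diff X n x))"
    \<comment> \<open>A null homotopy \<open>s\<close> gives \<open>f = d s - s d\<close>, the minus
      coming from the shifted differential; \<open>d t + f = t d\<close> then holds for
      \<open>t = - s\<close>. The index \<open>n - 1\<close> undoes the shift.\<close>
    proof (intro exI[of _ "\<lambda>n x. \<ominus>\<^bsub>component V n\<^esub> s (n - 1) x"] conjI allI ballI)
      show "linear R (component X n) (component V n) (\<lambda>x. \<ominus>\<^bsub>component V n\<^esub> s (n - 1) x)" for n
        by (intro linear_minus_fun[OF XM VM] s1)
      fix n x assume x: "x \<in> elems X n"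
      have dx: "diff X n x \<in> elems X (n - 1)" using diff_closed[OF XC x] .
      have sx: "s (n - 1) x \<in> elems V n" using linear_closed[OF s1 x] .
      have sdx: "s (n - 2) (diff X n x) \<in> elems V (n - 1)" using linear_closed[OF s1 dx] by simp
      have "f n x = diff V n (s (n - 1) x) \<oplus>\<^bsub>component V (n - 1)\<^esub> s (n - 2) (diff S (n - 1) x)"
        using s(2)[of x "n - 1"] x by (simp add: Sc)
      also have "s (n - 2) (diff S (n - 1) x) = \<ominus>\<^bsub>component V (n - 1)\<^esub> s (n - 2) (diff X n x)"
        using Sd[of x "n - 1"] x linear_minus[OF XM VM s1 dx] by simp
      finally show "diff V n (\<ominus>\<^bsub>component V n\<^esub> s (n - 1) x) \<oplus>\<^bsub>component V (n - 1)\<^esub> f n x =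
          \<ominus>\<^bsub>component V (n - 1)\<^esub> s (n - 1 - 1) (diff X n x)"
        using diff_closed[OF VC sx] sdx
        by (simp add: linear_minus[OF VM VM diff_linear[OF VC] sx] V.r_neg1)
    qed
  qed
qed

text \<open>Disks in the tilde class give the condition on components. For the homotopies, the
  argument of \<open>Ext1_vanishes_homotopy_perp\<close> is run backwards.\<close>

lemma right_perp_subset_homotopy_perp: "right_perp (Ch R) (tilde_class R \<U> \<X>) \<subseteq> homotopy_perp"
proof
  fix V assume "V \<in> right_perp (Ch R) (tilde_class R \<U> \<X>)"
  then have VC: "chain_complex R V" and van: "\<And>U. U \<in> tilde_class R \<U> \<X> \<Longrightarrow> Ext1_vanishes (Ch R) U V"
    by (auto simp: right_perp_def Ch_simps)
  note VM = complex_module[OF VC]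
  interpret V: left_module R "component V n" for n by (rule VM)
  have "component V n \<in> \<V>" for n
    using VM van[OF disk_mem_tilde_class] Ext1_vanishes_disk_left[OF U_module VC] by (blast intro: V_memI)
  moreover have "null_homotopic R U V f" if U: "U \<in> tilde_class R \<U> \<X>" and f: "f \<in> chain_map R U V" for U f
  proof -
    note UC = tilde_classD(1)[OF U]
    note UM = complex_module[OF UC]
    interpret U: left_module R "component U n" for n by (rule UM)
    have fm: "complex_map R U V f" using f by (simp add: chain_map_iff)
    \<comment> \<open>In degree \<open>n\<close> this is \<open>U\<close> in degree
      \<open>n - 1\<close>, so \<open>f\<close> becomes a family from \<open>S\<close> to
      \<open>V\<close> that lowers degrees by one, and the sign makes it anticommute.\<close>
    define S where "S = shift_complex (-1) U"
    have Sc: "component S n = component U (n - 1)" for n by (simp add: S_def)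
    have Sd: "diff S n x = \<ominus>\<^bsub>component U (n - 2)\<^esub> diff U (n - 1) x" if "x \<in> elems U (n - 1)" for n x
      using that by (simp add: S_def)
    have SC: "chain_complex R S" unfolding S_def by (rule chain_complex_shift[OF UC])
    have S: "S \<in> tilde_class R \<U> \<X>" unfolding S_def by (rule tilde_class_shift[OF U])
    have fl: "linear R (component S n) (component V (n - 1)) (f (n - 1))" for n
      unfolding Sc by (rule complex_map_linear[OF fm])
    have anti: "diff V (n - 1) (f (n - 1) x) \<oplus>\<^bsub>component V (n - 2)\<^esub> f (n - 1 - 1) (diff S n x) = \<zero>\<^bsub>component V (n - 2)\<^esub>"
      if "x \<in> elems S n" for n x
    proof -
      have x: "x \<in> elems U (n - 1)" using that by (simp add: Sc)
      have dx: "diff U (n - 1) x \<in> elems U (n - 2)" using diff_closed[OF UC x] by simp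
      show ?thesis
        using complex_map_diff[OF fm x] linear_minus[OF UM VM complex_map_linear[OF fm] dx] complex_map_closed[OF fm dx]
        by (simp add: Sd[OF x] V.r_neg)
    qed
    obtain t where t: "\<And>n. linear R (component S n) (component V n) (t n)"
      "\<And>n x. x \<in> elems S n \<Longrightarrow> diff V n (t n x) \<oplus>\<^bsub>component V (n - 1)\<^esub> f (n - 1) x = t (n - 1) (diff S n x)"
      by (rule Ch_Ext1_homotopy[OF SC VC van[OF S] fl anti]) blast+
    have t1: "linear R (component U n) (component V (n + 1)) (t (n + 1))" for n
      using t(1)[of "n + 1"] by (simp add: Sc)
    have t0: "linear R (component U (n - 1)) (component V n) (t n)" for n
      using t(1)[of n] by (simp add: Sc)
    show ?thesis
    proof (rule null_homotopicI[OF UC, where s = "\<lambda>n x. \<ominus>\<^bsub>component V (n + 1)\<^esub> t (n + 1) x"])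
      show "linear R (component U n) (component V (n + 1)) (\<lambda>x. \<ominus>\<^bsub>component V (n + 1)\<^esub> t (n + 1) x)" for n
        by (intro linear_minus_fun[OF UM VM] t1)
      fix n x assume x: "x \<in> elems U n"
      have dx: "diff U n x \<in> elems U (n - 1)" using diff_closed[OF UC x] .
      have tx: "t (n + 1) x \<in> elems V (n + 1)" using linear_closed[OF t1 x] .
      have dtx: "diff V (n + 1) (t (n + 1) x) \<in> elems V n" using diff_closed[OF VC tx] by simp
      have tdx: "t n (diff U n x) \<in> elems V n" using linear_closed[OF t0 dx] .
      have "diff V (n + 1) (t (n + 1) x) \<oplus>\<^bsub>component V n\<^esub> f n x = t n (\<ominus>\<^bsub>component U (n - 1)\<^esub> diff U n x)"
        using t(2)[of x "n + 1"] Sd[of x "n + 1"] x by (simp add: Sc)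
      also have "\<dots> = \<ominus>\<^bsub>component V n\<^esub> t n (diff U n x)" by (rule linear_minus[OF UM VM t0 dx])
      finally have "f n x = \<ominus>\<^bsub>component V n\<^esub> diff V (n + 1) (t (n + 1) x) \<oplus>\<^bsub>component V n\<^esub> \<ominus>\<^bsub>component V n\<^esub> t n (diff U n x)"
        using V.add_eq_iff dtx tdx complex_map_closed[OF fm x] by simp
      then show "f n x = diff V (n + 1) (\<ominus>\<^bsub>component V (n + 1)\<^esub> t (n + 1) x) \<oplus>\<^bsub>component V n\<^esub>
          \<ominus>\<^bsub>component V (n - 1 + 1)\<^esub> t (n - 1 + 1) (diff U n x)"
        using linear_minus[OF VM VM diff_linear[OF VC] tx] by simp
    qed
  qed
  ultimately show "V \<in> homotopy_perp" using VC by (simp add: homotopy_perp_def)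
qed

lemma right_perp_eq: "right_perp (Ch R) (tilde_class R \<U> \<X>) = homotopy_perp"
  using right_perp_subset_homotopy_perp Ext1_vanishes_homotopy_perp
  by (auto simp: right_perp_def Ch_simps homotopy_perp_def)

text \<open>Disks are contractible. A chain map \<open>f\<close> to the disk satisfies
  \<open>f n = f (n - 1) d\<close>, so \<open>f (n - 1)\<close>, read as a map into degree
  \<open>n\<close>, is the whole homotopy.\<close>

lemma disk_mem_homotopy_perp:
  assumes N: "N \<in> \<V>" shows "disk n N \<in> homotopy_perp"
proof -
  have lN: "left_module R N" using N by (rule V_module)
  interpret N: left_module R N by (rule lN)
  have D: "component (disk n N) k = (if k = n \<or> k = n - 1 then N else N\<lparr>carrier := {\<zero>\<^bsub>N\<^esub>}\<rparr>)" for k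
    by (simp add: elementary_complex_component)
  have Dd: "diff (disk n N) k x = (if k = n then x else \<zero>\<^bsub>N\<^esub>)" if "x \<in> elems (disk n N) k" for k x
    using elementary_complex_diff[OF that] by simp
  have "null_homotopic R U (disk n N) f" if U: "U \<in> tilde_class R \<U> \<X>" and f: "f \<in> chain_map R U (disk n N)" for U f
  proof (rule null_homotopicI[where s = "(\<lambda>k x. \<zero>\<^bsub>N\<^esub>)(n - 1 := f (n - 1))"])
    show UC: "chain_complex R U" by (rule tilde_classD(1)[OF U])
    have fm: "complex_map R U (disk n N) f" using f by (simp add: chain_map_iff)
    note UM = complex_module[OF UC]
    have zl: "linear R (component U k) (component (disk n N) (k + 1)) (\<lambda>x. \<zero>\<^bsub>N\<^esub>)" for k
      using linear_zero_fun[OF UM complex_module[OF chain_complex_disk[OF lN]], of k n "k + 1"]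
      unfolding elementary_complex_zero .
    show s: "linear R (component U k) (component (disk n N) (k + 1)) (((\<lambda>k x. \<zero>\<^bsub>N\<^esub>)(n - 1 := f (n - 1))) k)" for k
      using complex_map_linear[OF fm, of "n - 1"] zl[of k] by (cases "k = n - 1") (simp add: D, simp)
    fix k x assume x: "x \<in> elems U k"
    note fx = complex_map_closed[OF fm x]
    have dfx: "f n x = f (n - 1) (diff U n x)" if "k = n"
      using complex_map_diff[OF fm x] Dd[OF fx] that by simp
    show "f k x = diff (disk n N) (k + 1) (((\<lambda>k x. \<zero>\<^bsub>N\<^esub>)(n - 1 := f (n - 1))) k x) \<oplus>\<^bsub>component (disk n N) k\<^esub>
        ((\<lambda>k x. \<zero>\<^bsub>N\<^esub>)(n - 1 := f (n - 1))) (k - 1) (diff U k x)"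
    proof -
      consider "k = n" | "k = n - 1" | "k \<noteq> n" "k \<noteq> n - 1" by blast
      then show ?thesis unfolding Dd[OF linear_closed[OF s x]]
        by cases (use fx dfx in \<open>simp_all add: D diff_eq_eq\<close>)
    qed
  qed
  then show ?thesis
    using N zero_module_mem[OF lN] chain_complex_disk[OF lN] by (simp add: homotopy_perp_def D)
qed

text \<open>A chain map to the sphere is a map from degree \<open>n\<close> of \<open>U\<close> to
  \<open>Y\<close> that kills boundaries. By exactness it factors through the cycles in degree
  \<open>n - 1\<close>; extending the factor \<open>f'\<close> to all of degree \<open>n - 1\<close>
  gives the homotopy.\<close>

lemma sphere_mem_homotopy_perp:
  assumes Y: "Y \<in> \<Y>" shows "sphere n Y \<in> homotopy_perp"
proof -
  have lY: "left_module R Y" using Y by (rule Y_module)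
  interpret Y: left_module R Y by (rule lY)
  have D: "component (sphere n Y) k = (if k = n then Y else Y\<lparr>carrier := {\<zero>\<^bsub>Y\<^esub>}\<rparr>)" for k
    by (simp add: elementary_complex_component)
  have Dd: "diff (sphere n Y) k x = \<zero>\<^bsub>Y\<^esub>" if "x \<in> elems (sphere n Y) k" for k x
    using elementary_complex_diff[OF that] by simp
  have "null_homotopic R U (sphere n Y) f" if U: "U \<in> tilde_class R \<U> \<X>" and f: "f \<in> chain_map R U (sphere n Y)" for U f
  proof -
    note UC = tilde_classD(1)[OF U] and ex = tilde_classD(2)[OF U]
    note UM = complex_module[OF UC] and ZM = left_module_cycles[OF UC]
    have fm: "complex_map R U (sphere n Y) f" using f by (simp add: chain_map_iff)
    have fn: "linear R (component U n) Y (f n)" using complex_map_linear[OF fm, of n] by (simp add: D)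
    have ses: "short_exact R (cycles U k) (\<lambda>x. x) (component U k) (diff U k) (cycles U (k - 1))" for k
      by (rule short_exact_cycles[OF ex])
    have ker: "f n x = \<zero>\<^bsub>Y\<^esub>" if x: "x \<in> elems U n" "diff U n x = \<zero>\<^bsub>cycles U (n - 1)\<^esub>" for x
    proof -
      obtain y where y: "y \<in> elems U (n + 1)" "x = diff U (n + 1) y"
        using x exact_complexD[OF ex x(1)] by auto
      then show ?thesis using complex_map_diff[OF fm y(1)] Dd[OF complex_map_closed[OF fm y(1)]] by simp
    qed
    have du: "linear R (component U n) (cycles U (n - 1)) (diff U n)" "diff U n ` elems U n = carrier (cycles U (n - 1))"
      using ses[of n] by (simp_all add: short_exact_def)
    obtain f' where f': "linear R (cycles U (n - 1)) Y f'" "\<And>x. x \<in> elems U n \<Longrightarrow> f' (diff U n x) = f n x"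
      by (rule linear_factor[OF UM ZM lY du fn ker]) blast+
    \<comment> \<open>The quotient of degree \<open>n - 1\<close> of \<open>U\<close> by its cycles
      is the cycle module in degree \<open>n - 2\<close>, so this Ext is the obstruction to
      extending \<open>f'\<close>.\<close>
    have van: "Ext1_vanishes (LMod R) (cycles U (n - 1 - 1)) Y"
      using tilde_classD(4)[OF U] Y by (rule XY_Ext)
    obtain g where g: "linear R (component U (n - 1)) Y g" "\<And>z. z \<in> carrier (cycles U (n - 1)) \<Longrightarrow> g z = f' z"
      by (rule Ext1_extend[OF van ZM lY ZM UM ses f'(1)]) blast
    have gd: "g (diff U n x) = f n x" if "x \<in> elems U n" for x
      using that g(2)[of "diff U n x"] f'(2) linear_closed[OF diff_linear_cycles[OF UC] that] by simp
    show ?thesis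
    proof (rule null_homotopicI[OF UC, where s = "(\<lambda>k x. \<zero>\<^bsub>Y\<^esub>)(n - 1 := g)"])
      have zl: "linear R (component U k) (component (sphere n Y) (k + 1)) (\<lambda>x. \<zero>\<^bsub>Y\<^esub>)" for k
        using linear_zero_fun[OF UM complex_module[OF chain_complex_sphere[OF lY]], of k n "k + 1"]
        unfolding elementary_complex_zero .
      show s: "linear R (component U k) (component (sphere n Y) (k + 1)) (((\<lambda>k x. \<zero>\<^bsub>Y\<^esub>)(n - 1 := g)) k)" for k
        using g(1) zl[of k] by (cases "k = n - 1") (simp add: D, simp)
      fix k x assume x: "x \<in> elems U k"
      have "diff (sphere n Y) (k + 1) (((\<lambda>k x. \<zero>\<^bsub>Y\<^esub>)(n - 1 := g)) k x) = \<zero>\<^bsub>Y\<^esub>"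
        by (rule Dd[OF linear_closed[OF s x]])
      then show "f k x = diff (sphere n Y) (k + 1) (((\<lambda>k x. \<zero>\<^bsub>Y\<^esub>)(n - 1 := g)) k x) \<oplus>\<^bsub>component (sphere n Y) k\<^esub>
          ((\<lambda>k x. \<zero>\<^bsub>Y\<^esub>)(n - 1 := g)) (k - 1) (diff U k x)"
        using complex_map_closed[OF fm x] x gd[of x] by (cases "k = n") (simp_all add: D)
    qed
  qed
  then show ?thesis
    using Y Y_subset_V zero_module_mem[OF lY] chain_complex_sphere[OF lY] by (auto simp: homotopy_perp_def D)
qed

text \<open>Such an \<open>f\<close> is a chain map from \<open>X\<close> to a sphere, and \<open>g\<close> is a null homotopy of it.\<close>

lemma left_perp_factor:
  assumes X: "X \<in> left_perp (Ch R) homotopy_perp" and Y: "Y \<in> \<Y>"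
    and f: "linear R (component X n) Y f" "\<And>y. y \<in> elems X (n + 1) \<Longrightarrow> f (diff X (n + 1) y) = \<zero>\<^bsub>Y\<^esub>"
  obtains g where "linear R (component X (n - 1)) Y g" "\<And>x. x \<in> elems X n \<Longrightarrow> g (diff X n x) = f x"
proof -
  have XC: "chain_complex R X" and van: "Ext1_vanishes (Ch R) X (sphere (n - 1) Y)"
    using X sphere_mem_homotopy_perp[OF Y] by (auto simp: left_perp_def Ch_simps)
  have lY: "left_module R Y" using Y by (rule Y_module)
  interpret Y: left_module R Y by (rule lY)
  note XM = complex_module[OF XC]
  define V where "V = sphere (n - 1) Y"
  have VC: "chain_complex R V" unfolding V_def by (rule chain_complex_sphere[OF lY])
  have D: "component V k = (if k = n - 1 then Y else Y\<lparr>carrier := {\<zero>\<^bsub>Y\<^esub>}\<rparr>)" for k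
    by (simp add: V_def elementary_complex_component)
  have Dd: "diff V k x = \<zero>\<^bsub>Y\<^esub>" if "x \<in> elems V k" for k x
    using elementary_complex_diff[OF that[unfolded V_def]] by (simp add: V_def)
  \<comment> \<open>A twisting family lowers degrees by one, hence the sphere sits in degree
    \<open>n - 1\<close>. Its zero differential reduces anticommutation to \<open>f\<close> killing
    boundaries.\<close>
  define h where "h = (\<lambda>k x. \<zero>\<^bsub>Y\<^esub>)(n := f)"
  have zl: "linear R (component X k) (component V l) (\<lambda>x. \<zero>\<^bsub>Y\<^esub>)" for k l
    using linear_zero_fun[OF XM complex_module[OF VC], of k l] unfolding V_def elementary_complex_zero .
  have h: "linear R (component X k) (component V (k - 1)) (h k)" for k
    using f(1) zl[of k "k - 1"] by (cases "k = n") (simp add: h_def D, simp add: h_def)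
  have h0: "h (k - 1) (diff X k x) = \<zero>\<^bsub>Y\<^esub>" if "x \<in> elems X k" for k x
    using f(2)[of x] that by (auto simp: h_def)
  have anti: "diff V (k - 1) (h k x) \<oplus>\<^bsub>component V (k - 2)\<^esub> h (k - 1) (diff X k x) = \<zero>\<^bsub>component V (k - 2)\<^esub>"
    if x: "x \<in> elems X k" for k x
    using Dd[OF linear_closed[OF h x]] h0[OF x] by (simp add: D)
  obtain t where t: "\<And>k. linear R (component X k) (component V k) (t k)"
    "\<And>k x. x \<in> elems X k \<Longrightarrow> diff V k (t k x) \<oplus>\<^bsub>component V (k - 1)\<^esub> h k x = t (k - 1) (diff X k x)"
    by (rule Ch_Ext1_homotopy[OF XC VC van[folded V_def] h anti]) blast+
  show ?thesis
  proof
    show "linear R (component X (n - 1)) Y (t (n - 1))" using t(1)[of "n - 1"] by (simp add: D)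
    show "t (n - 1) (diff X n x) = f x" if x: "x \<in> elems X n" for x
      using t(2)[OF x] Dd[OF linear_closed[OF t(1) x]] linear_closed[OF f(1) x] by (simp add: D h_def)
  qed
qed

text \<open>A cycle \<open>x\<close> that is not a boundary would be separated from the boundaries
  by a map \<open>f\<close> to the cogenerator. But \<open>f\<close> is of the form
  \<open>g d\<close>, so it vanishes on cycles.\<close>

lemma left_perp_exact:
  assumes X: "X \<in> left_perp (Ch R) homotopy_perp"
  shows "exact_complex R X"
proof -
  have XC: "chain_complex R X" using X by (auto simp: left_perp_def Ch_simps)
  note XM = complex_module[OF XC]
  obtain I :: "('r, 'm) module" where I: "left_module R I"
    "\<And>A :: ('r, 'm) module. left_module R A \<Longrightarrow> Ext1_vanishes (LMod R) A I"
    "\<And>(M :: ('r, 'm) module) K x. left_module R M \<Longrightarrow> left_module R (M\<lparr>carrier := K\<rparr>) \<Longrightarrow> K \<subseteq> carrier M \<Longrightarrow>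
       x \<in> carrier M \<Longrightarrow> x \<notin> K \<Longrightarrow> \<exists>f. linear R M I f \<and> (\<forall>k \<in> K. f k = \<zero>\<^bsub>I\<^esub>) \<and> f x \<noteq> \<zero>\<^bsub>I\<^esub>"
    by (rule injective_cogenerator[OF universe], rule that)
  have IY: "I \<in> \<Y>" using I(1,2) X_module by (blast intro: Y_memI)
  show ?thesis
    unfolding exact_complex_iff[OF XC]
  proof (intro allI ballI impI, rule ccontr)
    fix n x assume x: "x \<in> elems X n" "diff X n x = \<zero>\<^bsub>component X (n - 1)\<^esub>"
      and nin: "x \<notin> diff X (n + 1) ` elems X (n + 1)"
    have d: "linear R (component X (n + 1)) (component X n) (diff X (n + 1))"
      using diff_linear[OF XC, of "n + 1"] by simp
    obtain f where f: "linear R (component X n) I f" "\<And>k. k \<in> diff X (n + 1) ` elems X (n + 1) \<Longrightarrow> f k = \<zero>\<^bsub>I\<^esub>"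
      "f x \<noteq> \<zero>\<^bsub>I\<^esub>"
      using I(3)[OF XM left_module_image[OF XM XM d] _ x(1) nin] linear_closed[OF d] by blast
    obtain g where g: "linear R (component X (n - 1)) I g" "\<And>x. x \<in> elems X n \<Longrightarrow> g (diff X n x) = f x"
      using left_perp_factor[OF X IY f(1)] f(2) by blast
    from g(2)[OF x(1)] f(3) show False by (simp add: x(2) linear_zero[OF XM I(1) g(1)])
  qed
qed

lemma left_perp_component:
  assumes X: "X \<in> left_perp (Ch R) homotopy_perp"
  shows "component X n \<in> \<U>"
proof -
  have XC: "chain_complex R X" using X by (auto simp: left_perp_def Ch_simps)
  have "Ext1_vanishes (LMod R) (component X n) N" if N: "N \<in> \<V>" for N
    by (rule Ext1_vanishes_disk_right[OF V_module[OF N] XC])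
      (use X disk_mem_homotopy_perp[OF N] in \<open>unfold left_perp_def, blast\<close>)
  then show ?thesis using complex_module[OF XC] by (blast intro: U_memI)
qed

text \<open>Dimension shifting by explicit maps. Given an extension \<open>E\<close> of the cycles
  \<open>Z\<^sub>n\<close> by \<open>Y\<close>, the differential from degree \<open>n + 1\<close>
  lifts to \<open>h\<close> into \<open>E\<close>. On \<open>Z\<^sub>n\<^sub>+\<^sub>1\<close> the
  lift takes values in \<open>Y\<close>; this restriction \<open>f\<close> extends to a map
  \<open>G\<close> on all of degree \<open>n + 1\<close>, and \<open>h - i G\<close> descends to a
  section.\<close>

lemma left_perp_cycles:
  assumes X: "X \<in> left_perp (Ch R) homotopy_perp"
  shows "cycles X n \<in> \<X>"
proof (rule X_memI)
  have XC: "chain_complex R X" using X by (auto simp: left_perp_def Ch_simps)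
  note XM = complex_module[OF XC] and ZM = left_module_cycles[OF XC] and ex = left_perp_exact[OF X]
  show "left_module R (cycles X n)" by (rule ZM)
  fix Y assume Y: "Y \<in> \<Y>"
  have lY: "left_module R Y" using Y by (rule Y_module)
  interpret Y: left_module R Y by (rule lY)
  interpret Z: left_module R "cycles X n" by (rule ZM)
  define P where "P = component X (n + 1)"
  have P: "left_module R P" unfolding P_def by (rule XM)
  have van: "Ext1_vanishes (LMod R) P Y"
    using left_perp_component[OF X, of "n + 1"] sub Y XY_Ext by (auto simp: P_def)
  have sesX: "short_exact R (cycles X (n + 1)) (\<lambda>x. x) P (diff X (n + 1)) (cycles X n)"
    using short_exact_cycles[OF ex, of "n + 1"] by (simp add: P_def)
  then have d: "linear R P (cycles X n) (diff X (n + 1))" "diff X (n + 1) ` carrier P = carrier (cycles X n)"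
    by (simp_all add: short_exact_def)
  show "Ext1_vanishes (LMod R) (cycles X n) Y"
    unfolding LMod_Ext1_vanishes_iff[OF ZM lY]
  proof (intro allI impI)
    fix i p and E :: "('r, 'm) module" assume E: "left_module R E" and ses: "short_exact R Y i E p (cycles X n)"
    have il: "linear R Y E i" and pl: "linear R E (cycles X n) p"
      and pi: "\<And>y. y \<in> carrier Y \<Longrightarrow> p (i y) = \<zero>\<^bsub>cycles X n\<^esub>"
      using ses by (auto simp: short_exact_def)
    interpret E: left_module R E by (rule E)
    obtain h where h: "linear R P E h" "\<And>x. x \<in> carrier P \<Longrightarrow> p (h x) = diff X (n + 1) x"
      by (rule Ext1_lift[OF van P lY E ZM ses d(1)]) blast
    have hZ: "linear R (cycles X (n + 1)) E h"
      unfolding cycles_eq by (rule linear_restrict_carrier[OF h(1)[unfolded P_def]]) auto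
    have phZ: "p (h x) = \<zero>\<^bsub>cycles X n\<^esub>" if "x \<in> carrier (cycles X (n + 1))" for x
      using that by (simp add: h P_def)
    obtain f where f: "linear R (cycles X (n + 1)) Y f" "\<And>x. x \<in> carrier (cycles X (n + 1)) \<Longrightarrow> i (f x) = h x"
      by (rule short_exact_kernel_lift[OF lY E ZM ses hZ phZ]) blast+
    have d2: "linear R (component X (n + 2)) (cycles X (n + 1)) (diff X (n + 2))"
      using diff_linear_cycles[OF XC, of "n + 2"] by (simp add: add.commute[of _ n])
    have fd: "f (diff X (n + 2) (diff X (n + 2 + 1) y)) = \<zero>\<^bsub>Y\<^esub>" if "y \<in> elems X (n + 2 + 1)" for y
      using diff_diff[OF XC that] linear_zero[OF ZM lY f(1)] by (simp add: add.commute[of _ n])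
    \<comment> \<open>Since \<open>f\<close> is composed with the differential from degree
      \<open>n + 2\<close>, it becomes a map that kills boundaries, to which
      \<open>left_perp_factor\<close> applies. By exactness that differential is onto
      \<open>Z\<^sub>n\<^sub>+\<^sub>1\<close>, so \<open>G\<close> agrees with \<open>f\<close>
      there.\<close>
    obtain G where G: "linear R (component X (n + 2 - 1)) Y G"
      "\<And>x. x \<in> elems X (n + 2) \<Longrightarrow> G (diff X (n + 2) x) = f (diff X (n + 2) x)"
      using left_perp_factor[OF X Y linear_comp[OF d2 f(1)] fd] by blast
    have GP: "linear R P Y G" using G(1) by (simp add: P_def add.commute[of _ n])
    have Gf: "G z = f z" if z: "z \<in> carrier (cycles X (n + 1))" for z
    proof -
      obtain x where "x \<in> elems X (n + 1 + 1)" "z = diff X (n + 1 + 1) x"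
        using exact_complexD[OF ex, of z "n + 1"] z by auto
      then show ?thesis using G(2)[of x] by (simp add: add.assoc)
    qed
    have k: "linear R P E (\<lambda>x. h x \<ominus>\<^bsub>E\<^esub> i (G x))"
      by (intro linear_diff_fun[OF P E] h(1) linear_comp[OF GP il])
    have ker: "h x \<ominus>\<^bsub>E\<^esub> i (G x) = \<zero>\<^bsub>E\<^esub>" if "x \<in> carrier P" "diff X (n + 1) x = \<zero>\<^bsub>cycles X n\<^esub>" for x
    proof -
      have x: "x \<in> carrier (cycles X (n + 1))" using that by (simp add: P_def)
      then show ?thesis using Gf[OF x] f(2)[OF x] linear_closed[OF h(1) that(1)] by (simp add: E.right_minus_eq)
    qed
    obtain s where s: "linear R (cycles X n) E s" "\<And>x. x \<in> carrier P \<Longrightarrow> s (diff X (n + 1) x) = h x \<ominus>\<^bsub>E\<^esub> i (G x)"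
      by (rule linear_factor[OF P ZM E d k ker]) blast+
    have "p (s a) = a" if a: "a \<in> carrier (cycles X n)" for a
    proof -
      obtain x where x: "x \<in> carrier P" "a = diff X (n + 1) x" using a d(2) by blast
      have "p (s a) = p (h x) \<ominus>\<^bsub>cycles X n\<^esub> p (i (G x))"
        using x by (simp add: s linear_diff[OF E ZM pl] linear_closed[OF h(1)] linear_closed[OF il]
            linear_closed[OF GP])
      also have "\<dots> = a \<ominus>\<^bsub>cycles X n\<^esub> \<zero>\<^bsub>cycles X n\<^esub>"
        using x by (simp only: h pi linear_closed[OF GP])
      also have "\<dots> = a" using a unfolding a_minus_def Z.uminus_zero by (rule Z.r_zero)
      finally show ?thesis .
    qed
    with s(1) show "\<exists>s. linear R (cycles X n) E s \<and> (\<forall>a \<in> carrier (cycles X n). p (s a) = a)" by blast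
  qed
qed

lemma left_perp_homotopy_perp: "left_perp (Ch R) homotopy_perp = tilde_class R \<U> \<X>"
proof (intro equalityI subsetI)
  fix X assume "X \<in> left_perp (Ch R) homotopy_perp"
  then show "X \<in> tilde_class R \<U> \<X>"
    using left_perp_exact left_perp_component left_perp_cycles by (simp add: tilde_class_def)
next
  fix X assume X: "X \<in> tilde_class R \<U> \<X>"
  then show "X \<in> left_perp (Ch R) homotopy_perp"
    using tilde_classD(1) Ext1_vanishes_homotopy_perp by (simp add: left_perp_def Ch_simps)
qed

end

theorem theorem3p3:
  fixes R :: "('r, 'e) ring_scheme"
    and \<U> \<V> \<X> \<Y> :: "('r, 'm) module set"
  assumes "ring R"
    and "universe_for R TYPE('m)"
    and "cotorsion_pair (LMod R) \<U> \<V>"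
    and "cotorsion_pair (LMod R) \<X> \<Y>"
    and "\<U> \<subseteq> \<X>"
  shows "cotorsion_pair (Ch R) (tilde_class R \<U> \<X>) (right_perp (Ch R) (tilde_class R \<U> \<X>)) \<and>
    right_perp (Ch R) (tilde_class R \<U> \<X>) =
      {V \<in> Obj (Ch R).
         (\<forall>n. component V n \<in> \<V>) \<and>
         (\<forall>U \<in> tilde_class R \<U> \<X>. \<forall>f \<in> Mor (Ch R) U V. null_homotopic R U V f)}"
proof -
  interpret R: ring R by fact
  obtain h :: "('r \<Rightarrow> nat) \<Rightarrow> 'm" where h: "inj_on h (carrier R \<rightarrow>\<^sub>E UNIV)"
    using assms(2) by (auto simp: universe_for_def lepoll_def)
  \<comment> \<open>Constant functions embed the naturals into \<open>'m\<close>; they are distinct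
    because \<open>carrier R\<close> contains \<open>\<one>\<close>.\<close>
  have "inj (\<lambda>k. h (\<lambda>x \<in> carrier R. k))"
  proof (rule injI)
    fix k l assume "h (\<lambda>x \<in> carrier R. k) = h (\<lambda>x \<in> carrier R. l)"
    then have "(\<lambda>x \<in> carrier R. k) = (\<lambda>x \<in> carrier R. l)" by (rule inj_onD[OF h]) auto
    then show "k = l" using R.one_closed by (metis restrict_apply')
  qed
  then have "infinite (UNIV :: 'm set)" by (metis finite_imageD finite_subset infinite_UNIV_nat subset_UNIV)
  then interpret two_cotorsion_pairs R "TYPE('m)" \<U> \<V> \<X> \<Y>
    using assms by unfold_locales auto
  show ?thesis
    using left_perp_homotopy_perp right_perp_eq
    by (simp add: cotorsion_pair_def homotopy_perp_def Ch_simps)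
qed

end
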